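(* Let $n\ge1$ and let $f\colon\{0,1\}^n\to\{0,1\}$ be arbitrary. Let $F_1$ and $F_2$ denote the communication problems of computing $f(x\wedge y)$ and $f(x\vee y)$, respectively, on input $x,y\in\{0,1\}^n$ (Alice holds $x$, Bob holds $y$). Then either $$D(F_1)\ge R_{1/3}(F_1)\ge Q^*_{1/3}(F_1)\ge \Omega\big(\mathrm{bs}(f)^{1/4}\big)\ge\Omega\big(D(F_1)^{1/12}\big)$$ or $$D(F_2)\ge R_{1/3}(F_2)\ge Q^*_{1/3}(F_2)\ge \Omega\big(\mathrm{bs}(f)^{1/4}\big)\ge\Omega\big(D(F_2)^{1/12}\big)$$ or both. The constants hidden in $\Omega(\cdot)$ are absolute (positive and independent of $n$ and $f$).
   Context: The operations $x\wedge y$, $x\vee y$ are bitwise AND and OR, and $\oplus$ is bitwise XOR. Block sensitivity: for $S\subseteq\{1,\dots,n\}$ let $e_S\in\{0,1\}^n$ be the characteristic vector of $S$. $\mathrm{bs}(f)$ is the largest $k$ for which there exist nonempty pairwise disjoint sets $S_1,\dots,S_k\subseteq\{1,\dots,n\}$ and $z\in\{0,1\}^n$ with $f(z\oplus e_{S_1})=\cdots=f(z\oplus e_{S_k})\ne f(z)$ ($\mathrm{bs}(f)=0$ if $f$ is constant). Communication models, for $F\colon X\times Y\to\{0,1\}$ with $X,Y$ finite; Alice gets an element of $X$, Bob an element of $Y$. $D(F)$ is the deterministic communication complexity: the least worst-case number of bits exchanged by a deterministic protocol computing $F$. $R_{1/3}(F)$ is the least cost (worst-case number of bits exchanged) of a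 classical protocol with an unlimited supply of shared random bits that computes $F$ correctly with probability at least $2/3$ on every input. $Q^*_{1/3}(F)$ is the bounded-error quantum communication complexity with prior entanglement: the least cost of a quantum protocol that computes $F$ correctly with probability at least $2/3$ on every input, where the parties exchange messages through a shared quantum channel, may apply arbitrary unitary operations to their own registers (finite-dimensional private workspace together with the channel qubits currently in their hands), may start with arbitrary (finite but unlimited) prior entanglement independent of the inputs, e.g. $|E|^{-1/2}\sum_{e\in E}|e\rangle|e\rangle$ with $E$ any finite set, and obtain the output by a final measurement; the cost is the total number of qubits exchanged in the worst case. *)

theory Defs
  imports "HOL-Probability.Probability"
begin

section \<open>The Boolean cube and block sensitivity\<close>

definition cube :: "nat \<Rightarrow> (nat \<Rightarrow> bool) set" where
  "cube n = {1..n} \<rightarrow>\<^sub>E UNIV"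

definition bit_and :: "nat \<Rightarrow> (nat \<Rightarrow> bool) \<Rightarrow> (nat \<Rightarrow> bool) \<Rightarrow> (nat \<Rightarrow> bool)" where
  "bit_and n x y = (\<lambda>i\<in>{1..n}. x i \<and> y i)"

definition bit_or :: "nat \<Rightarrow> (nat \<Rightarrow> bool) \<Rightarrow> (nat \<Rightarrow> bool) \<Rightarrow> (nat \<Rightarrow> bool)" where
  "bit_or n x y = (\<lambda>i\<in>{1..n}. x i \<or> y i)"

definition bit_xor :: "nat \<Rightarrow> (nat \<Rightarrow> bool) \<Rightarrow> (nat \<Rightarrow> bool) \<Rightarrow> (nat \<Rightarrow> bool)" where
  "bit_xor n x y = (\<lambda>i\<in>{1..n}. x i \<noteq> y i)"

definition char_vec :: "nat \<Rightarrow> nat set \<Rightarrow> (nat \<Rightarrow> bool)" where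
  "char_vec n S = (\<lambda>i\<in>{1..n}. i \<in> S)"

text \<open>Since \<open>f\<close> is Boolean, the values at the \<open>k\<close> flipped points, each different from
  \<open>f z\<close>, are automatically equal to each other.  The value \<open>k = 0\<close> is always
  admissible, so a constant function has block sensitivity \<open>0\<close>.\<close>

definition block_sensitivity :: "nat \<Rightarrow> ((nat \<Rightarrow> bool) \<Rightarrow> bool) \<Rightarrow> nat" where
  "block_sensitivity n f = Max {k. \<exists>z\<in>cube n. \<exists>S :: nat \<Rightarrow> nat set.
      (\<forall>i\<in>{1..k}. S i \<noteq> {} \<and> S i \<subseteq> {1..n}) \<and>
      disjoint_family_on S {1..k} \<and>
      (\<forall>i\<in>{1..k}. f (bit_xor n z (char_vec n (S i))) \<noteq> f z)}"


section \<open>Deterministic communication complexity\<close>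

text \<open>Protocol trees: at an inner node one party sends one bit, a function of its own input,
  which selects the subtree (the first one if the bit is \<open>True\<close>).  The output is a function
  of the transcript.\<close>

datatype ('x, 'y) protocol =
    Output bool
  | Alice_Sends "'x \<Rightarrow> bool" "('x, 'y) protocol" "('x, 'y) protocol"
  | Bob_Sends "'y \<Rightarrow> bool" "('x, 'y) protocol" "('x, 'y) protocol"

primrec protocol_output :: "('x, 'y) protocol \<Rightarrow> 'x \<Rightarrow> 'y \<Rightarrow> bool" where
  "protocol_output (Output v) x y = v"
| "protocol_output (Alice_Sends a t u) x y = (if a x then protocol_output t x y else protocol_output u x y)"
| "protocol_output (Bob_Sends b t u) x y = (if b y then protocol_output t x y else protocol_output u x y)"

primrec bits_exchanged :: "('x, 'y) protocol \<Rightarrow> 'x \<Rightarrow> 'y \<Rightarrow> nat" where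
  "bits_exchanged (Output v) x y = 0"
| "bits_exchanged (Alice_Sends a t u) x y =
     Suc (if a x then bits_exchanged t x y else bits_exchanged u x y)"
| "bits_exchanged (Bob_Sends b t u) x y =
     Suc (if b y then bits_exchanged t x y else bits_exchanged u x y)"

definition deterministic_cc :: "'x set \<Rightarrow> 'y set \<Rightarrow> ('x \<Rightarrow> 'y \<Rightarrow> bool) \<Rightarrow> nat" where
  "deterministic_cc X Y F = (LEAST c. \<exists>P :: ('x, 'y) protocol.
      \<forall>x\<in>X. \<forall>y\<in>Y. protocol_output P x y = F x y \<and> bits_exchanged P x y \<le> c)"


section \<open>Randomized communication complexity with shared randomness\<close>

definition coin_flips :: "(nat \<Rightarrow> bool) measure" where
  "coin_flips = PiM UNIV (\<lambda>_. measure_pmf (bernoulli_pmf (1/2)))"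

text \<open>The shared random bits \<open>r\<close> are known to both parties, so they select a deterministic
  protocol.  A set that is not measurable has \<open>measure\<close> \<open>0\<close>; hence, for
  \<open>\<epsilon> < 1\<close>, the probability condition includes the measurability of the event.\<close>

definition randomized_cc ::
    "real \<Rightarrow> 'x set \<Rightarrow> 'y set \<Rightarrow> ('x \<Rightarrow> 'y \<Rightarrow> bool) \<Rightarrow> nat" where
  "randomized_cc \<epsilon> X Y F = (LEAST c. \<exists>P :: (nat \<Rightarrow> bool) \<Rightarrow> ('x, 'y) protocol.
      \<forall>x\<in>X. \<forall>y\<in>Y. measure coin_flips {r. protocol_output (P r) x y = F x y} \<ge> 1 - \<epsilon> \<and>
        (\<forall>r. bits_exchanged (P r) x y \<le> c))"


section \<open>Quantum communication complexity with prior entanglement\<close>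

text \<open>The system consists of Alice's workspace of dimension \<open>a\<close>, of \<open>m\<close> channel qubits, and
  of Bob's workspace of dimension \<open>b\<close>.  Its computational basis is indexed by the triples
  \<open>(i, w, j)\<close> with \<open>i < a\<close>, \<open>w \<subseteq> {..<m}\<close> and \<open>j < b\<close>, where \<open>w\<close> is the set of channel qubits
  that are in state \<open>1\<close>.  At each time, every channel qubit is in the hands of one of the
  parties.  The registers of a party with workspace dimension \<open>d\<close> holding the set \<open>H\<close> of
  channel qubits have the basis \<open>local_basis d H\<close>.\<close>

type_synonym qstate = "nat \<times> nat set \<times> nat \<Rightarrow> complex"
type_synonym local_op = "nat \<times> nat set \<Rightarrow> nat \<times> nat set \<Rightarrow> complex"

definition global_basis :: "nat \<Rightarrow> nat \<Rightarrow> nat \<Rightarrow> (nat \<times> nat set \<times> nat) set" where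
  "global_basis a m b = {..<a} \<times> Pow {..<m} \<times> {..<b}"

definition local_basis :: "nat \<Rightarrow> nat set \<Rightarrow> (nat \<times> nat set) set" where
  "local_basis d H = {..<d} \<times> Pow H"

definition unitary_on :: "'i set \<Rightarrow> ('i \<Rightarrow> 'i \<Rightarrow> complex) \<Rightarrow> bool" where
  "unitary_on J U \<longleftrightarrow> (\<forall>p\<in>J. \<forall>q\<in>J.
      (\<Sum>k\<in>J. cnj (U k p) * U k q) = (if p = q then 1 else 0) \<and>
      (\<Sum>k\<in>J. U p k * cnj (U q k)) = (if p = q then 1 else 0))"

text \<open>\<open>U\<close> applied to the workspace of one party and the channel qubits in \<open>H\<close>, tensored with
  the identity on all other registers.\<close>

definition apply_Alice :: "nat \<Rightarrow> nat set \<Rightarrow> local_op \<Rightarrow> qstate \<Rightarrow> qstate" where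
  "apply_Alice a H U \<psi> = (\<lambda>(i, w, j).
      \<Sum>(i', v)\<in>local_basis a H. U (i, w \<inter> H) (i', v) * \<psi> (i', v \<union> (w - H), j))"

definition apply_Bob :: "nat \<Rightarrow> nat set \<Rightarrow> local_op \<Rightarrow> qstate \<Rightarrow> qstate" where
  "apply_Bob b H U \<psi> = (\<lambda>(i, w, j).
      \<Sum>(j', v)\<in>local_basis b H. U (j, w \<inter> H) (j', v) * \<psi> (i, v \<union> (w - H), j'))"

text \<open>In one step a party applies a unitary, chosen according to its input, to its own
  registers and then hands over a (possibly empty) set of channel qubits to the other party.\<close>

datatype ('x, 'y) qstep =
    Alice_Step "'x \<Rightarrow> local_op" "nat set"
  | Bob_Step "'y \<Rightarrow> local_op" "nat set"

primrec qubits_sent :: "('x, 'y) qstep \<Rightarrow> nat" where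
  "qubits_sent (Alice_Step U S) = card S"
| "qubits_sent (Bob_Step V S) = card S"

datatype party = Alice | Bob

text \<open>\<open>alice_init\<close> is the set of channel qubits initially in Alice's hands; the others are
  in Bob's.  The initial state, which does not depend on the inputs, contains the prior
  entanglement.  At the end the \<open>measurer\<close> measures its own registers in the computational
  basis, and the output is \<open>1\<close> if and only if the result is in \<open>accept\<close>; other measurements
  are obtained by a preceding step that sends no qubits.\<close>

record ('x, 'y) qprotocol =
  dimA :: nat
  dimB :: nat
  qubits :: nat
  alice_init :: "nat set"
  initial :: qstate
  steps :: "('x, 'y) qstep list"
  measurer :: party
  accept :: "(nat \<times> nat set) set"

text \<open>In the following functions \<open>H\<close> is the set of channel qubits currently in Alice's hands.\<close>

fun valid_steps :: "'x set \<Rightarrow> 'y set \<Rightarrow> nat \<Rightarrow> nat \<Rightarrow> nat \<Rightarrow> nat set \<Rightarrow> ('x, 'y) qstep list \<Rightarrow> bool" where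
  "valid_steps X Y a m b H [] = True"
| "valid_steps X Y a m b H (Alice_Step U S # ss) \<longleftrightarrow>
     (\<forall>x\<in>X. unitary_on (local_basis a H) (U x)) \<and> S \<subseteq> H \<and>
     valid_steps X Y a m b (H - S) ss"
| "valid_steps X Y a m b H (Bob_Step V S # ss) \<longleftrightarrow>
     (\<forall>y\<in>Y. unitary_on (local_basis b ({..<m} - H)) (V y)) \<and> S \<subseteq> {..<m} - H \<and>
     valid_steps X Y a m b (H \<union> S) ss"

fun run_steps :: "nat \<Rightarrow> nat \<Rightarrow> nat \<Rightarrow> 'x \<Rightarrow> 'y \<Rightarrow> ('x, 'y) qstep list \<Rightarrow>
    nat set \<times> qstate \<Rightarrow> nat set \<times> qstate" where
  "run_steps a m b x y [] (H, \<psi>) = (H, \<psi>)"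
| "run_steps a m b x y (Alice_Step U S # ss) (H, \<psi>) =
     run_steps a m b x y ss (H - S, apply_Alice a H (U x) \<psi>)"
| "run_steps a m b x y (Bob_Step V S # ss) (H, \<psi>) =
     run_steps a m b x y ss (H \<union> S, apply_Bob b ({..<m} - H) (V y) \<psi>)"

definition valid_qprotocol :: "'x set \<Rightarrow> 'y set \<Rightarrow> ('x, 'y) qprotocol \<Rightarrow> bool" where
  "valid_qprotocol X Y P \<longleftrightarrow>
     alice_init P \<subseteq> {..<qubits P} \<and>
     (\<Sum>p\<in>global_basis (dimA P) (qubits P) (dimB P). (cmod (initial P p))\<^sup>2) = 1 \<and>
     valid_steps X Y (dimA P) (qubits P) (dimB P) (alice_init P) (steps P)"

definition qcost :: "('x, 'y) qprotocol \<Rightarrow> nat" where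
  "qcost P = sum_list (map qubits_sent (steps P))"

definition accepting :: "('x, 'y) qprotocol \<Rightarrow> nat set \<Rightarrow> nat \<times> nat set \<times> nat \<Rightarrow> bool" where
  "accepting P H = (\<lambda>(i, w, j). case measurer P of
       Alice \<Rightarrow> (i, w \<inter> H) \<in> accept P
     | Bob \<Rightarrow> (j, w - H) \<in> accept P)"

definition qoutput_prob :: "('x, 'y) qprotocol \<Rightarrow> 'x \<Rightarrow> 'y \<Rightarrow> bool \<Rightarrow> real" where
  "qoutput_prob P x y v =
     (let (H, \<psi>) = run_steps (dimA P) (qubits P) (dimB P) x y (steps P) (alice_init P, initial P)
      in \<Sum>p\<in>{p \<in> global_basis (dimA P) (qubits P) (dimB P). accepting P H p = v}. (cmod (\<psi> p))\<^sup>2)"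

definition quantum_cc ::
    "real \<Rightarrow> 'x set \<Rightarrow> 'y set \<Rightarrow> ('x \<Rightarrow> 'y \<Rightarrow> bool) \<Rightarrow> nat" where
  "quantum_cc \<epsilon> X Y F = (LEAST c. \<exists>P :: ('x, 'y) qprotocol.
      valid_qprotocol X Y P \<and> qcost P \<le> c \<and>
      (\<forall>x\<in>X. \<forall>y\<in>Y. qoutput_prob P x y (F x y) \<ge> 1 - \<epsilon>))"

end

(* A family of k disjoint sensitive blocks at z yields about sqrt k disjoint sensitive blocks at a
   possibly different point z' on which z' is constant: either many parts of blocks outside z can
   be flipped one after the other without changing the value, so that their partners inside z
   become sensitive, or this process stops because many outer parts are sensitive.  If z' is 0
   (resp. 1) on K such blocks, then f(x and y) (resp. f(x or y)) contains the problem of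
   distinguishing disjoint subsets of a K-element set from subsets with one common element.

   Split according to the qubits in transit, a c-qubit protocol has acceptance probabilities that
   are sums of 4^c terms <X(x), Y(y)> with vectors of norm at most 1.  Against the matrix
   psi(x|V xor w), where psi is a dual polynomial that certifies that OR on m bits, restricted to
   inputs of weight at most one, has approximate degree of order sqrt m, such sums are
   exponentially small in that degree.  The dual polynomial is explicit: divided differences on
   the nodes 0, 1 and 50 i^2.  Hence c is at least of order sqrt K.

   D is at most 2 bs^3 by querying 1-certificates of size bs^2, at most bs of them.  Q is at most R,
   without loss of a constant, because superdense coding sends two classical bits per qubit; this
   allows a fixed alternation of senders although in a protocol tree the speaker depends on the
   transcript. *)

theory Submission
  imports Defs "HOL-Computational_Algebra.Polynomial"
begin

section \<open>Sensitive blocks and certificates\<close>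

text \<open>The exponent 1/4 consists of two square roots: one is lost in passing from
  \<open>bs\<close> sensitive blocks to \<open>K\<close> blocks of one colour, the other in the
  estimate \<open>K \<le> 10000 * q\<^sup>2\<close> for the quantum cost \<open>q\<close>. Which of
  AND and OR is hard depends only on the colour of a largest monochromatic family, hence the
  disjunction. The obstacle on the quantum side is that entanglement and workspaces are unlimited,
  so no estimate may contain a dimension. A product of two branch amplitudes is therefore regrouped
  so that one copy of the initial state goes with all operators of Alice and the conjugate copy with
  all operators of Bob; both factors inherit norm at most 1 from the initial state. Pairs of sets
  with two or more common elements obey no promise, so the dual polynomial must have little mass
  beyond weight 1. The additive constants of the exponential estimate can be absorbed only because a
  protocol that sends nothing cannot signal. The relation between Q and R holds without any
  constant, so the simulation must not waste a single qubit; this explains the care with odd numbers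
  of messages and the choice of Bob, who acts last, as the one who measures.\<close>

definition sensitive_blocks :: "'a set \<Rightarrow> ('a set \<Rightarrow> bool) \<Rightarrow> 'a set \<Rightarrow> 'a set set \<Rightarrow> bool" where
  "sensitive_blocks U g z \<B> \<longleftrightarrow> z \<subseteq> U \<and> \<B> \<subseteq> Pow U \<and> {} \<notin> \<B> \<and> disjoint \<B> \<and>
     (\<forall>S\<in>\<B>. g (sym_diff z S) \<noteq> g z)"

lemma sensitive_blocks_finite: "finite U \<Longrightarrow> sensitive_blocks U g z \<B> \<Longrightarrow> finite \<B>"
  unfolding sensitive_blocks_def by (meson finite_Pow_iff finite_subset)

lemma card_image_disjoint_family:
  assumes "disjoint_family_on D J" "\<And>j. j \<in> J \<Longrightarrow> D j \<noteq> {}"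
  shows "card (D ` J) = card J"
proof (rule card_image, rule inj_onI, rule ccontr)
  fix i j assume "i \<in> J" "j \<in> J" "D i = D j" "i \<noteq> j"
  then show False using assms unfolding disjoint_family_on_def by blast
qed

lemma sensitive_blocks_image:
  assumes "z \<subseteq> U" "disjoint_family_on D J" "\<And>j. j \<in> J \<Longrightarrow> D j \<subseteq> U"
    "\<And>j. j \<in> J \<Longrightarrow> g (sym_diff z (D j)) \<noteq> g z"
  shows "sensitive_blocks U g z (D ` J)" "card (D ` J) = card J"
proof -
  have ne: "D j \<noteq> {}" if "j \<in> J" for j using assms(4)[OF that] by auto
  show "card (D ` J) = card J" using card_image_disjoint_family[OF assms(2) ne] .
  show "sensitive_blocks U g z (D ` J)"
    unfolding sensitive_blocks_def
  proof (intro conjI)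
    show "disjoint (D ` J)" using assms(2) by (rule disjoint_family_on_disjoint_image)
    show "{} \<notin> D ` J" using ne by fastforce
    show "D ` J \<subseteq> Pow U" using assms(3) by blast
    show "\<forall>S\<in>D ` J. g (sym_diff z S) \<noteq> g z" using assms(4) by blast
  qed (rule assms(1))
qed

lemma exists_minimal_block:
  assumes "finite S" "g (sym_diff z S) \<noteq> g z"
  obtains T where "T \<subseteq> S" "g (sym_diff z T) \<noteq> g z" "\<And>T'. T' \<subset> T \<Longrightarrow> g (sym_diff z T') = g z"
proof -
  define Q where "Q = (\<lambda>T. T \<subseteq> S \<and> g (sym_diff z T) \<noteq> g z)"
  have "Q S" using assms unfolding Q_def by auto
  then obtain T where T: "Q T" "\<And>T'. Q T' \<Longrightarrow> card T \<le> card T'"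
    using ex_has_least_nat[of Q S card] by auto
  show ?thesis
  proof (rule that)
    show "T \<subseteq> S" "g (sym_diff z T) \<noteq> g z" using T unfolding Q_def by auto
    fix T' assume T': "T' \<subset> T"
    have "card T' < card T" using T' T(1) assms(1) unfolding Q_def by (meson finite_subset psubset_card_mono)
    then have "\<not> Q T'" using T(2) by (meson leD)
    then show "g (sym_diff z T') = g z" using T' T(1) unfolding Q_def by auto
  qed
qed

text \<open>At the flipped point \<open>sym_diff z S\<close> every single element of a minimal block
  is itself sensitive: flipping \<open>i\<close> back leaves the proper subset
  \<open>S - {i}\<close> flipped, where \<open>g\<close> has its value at \<open>z\<close> again. So
  a minimal block yields \<open>card S\<close> singleton blocks at one point.\<close>

lemma minimal_block_card_le:
  assumes "finite U" "z \<subseteq> U" "S \<subseteq> U" "g (sym_diff z S) \<noteq> g z"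
    "\<And>T. T \<subset> S \<Longrightarrow> g (sym_diff z T) = g z"
    and k: "\<And>z \<B>. sensitive_blocks U g z \<B> \<Longrightarrow> card \<B> \<le> k"
  shows "card S \<le> k"
proof -
  have eq: "sym_diff (sym_diff z S) {i} = sym_diff z (S - {i})" if "i \<in> S" for i using that by blast
  have "sensitive_blocks U g (sym_diff z S) ((\<lambda>i. {i}) ` S)" "card ((\<lambda>i. {i}) ` S) = card S"
  proof -
    have 1: "sym_diff z S \<subseteq> U" "disjoint_family_on (\<lambda>i. {i}) S" "\<And>j. j \<in> S \<Longrightarrow> {j} \<subseteq> U"
      using assms(2,3) by (auto simp: disjoint_family_on_def)
    have 2: "g (sym_diff (sym_diff z S) {j}) \<noteq> g (sym_diff z S)" if "j \<in> S" for j
      using assms(4) assms(5)[of "S - {j}"] that unfolding eq[OF that] by blast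
    show "sensitive_blocks U g (sym_diff z S) ((\<lambda>i. {i}) ` S)" "card ((\<lambda>i. {i}) ` S) = card S"
      using sensitive_blocks_image[where D = "\<lambda>i. {i}" and g = g, OF 1(1) 1(2) 1(3) 2] by auto
  qed
  then show ?thesis using k by metis
qed

text \<open>A largest family of disjoint minimal blocks at \<open>z\<close> has at most
  \<open>k\<close> members with at most \<open>k\<close> elements each. Its union is a certificate:
  a point that agrees with \<open>z\<close> there but has another value would differ from
  \<open>z\<close> on a set containing a further minimal block, disjoint from the union.\<close>

lemma exists_certificate:
  assumes fin: "finite U" and z: "z \<subseteq> U"
    and k: "\<And>z \<B>. sensitive_blocks U g z \<B> \<Longrightarrow> card \<B> \<le> k"
  obtains C where "C \<subseteq> U" "card C \<le> k\<^sup>2" "\<And>z'. z' \<subseteq> U \<Longrightarrow> z' \<inter> C = z \<inter> C \<Longrightarrow> g z' = g z"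
proof -
  define Q where "Q = (\<lambda>\<B>. sensitive_blocks U g z \<B> \<and> (\<forall>S\<in>\<B>. \<forall>T. T \<subset> S \<longrightarrow> g (sym_diff z T) = g z))"
  have "Q {}" using z unfolding Q_def sensitive_blocks_def by auto
  moreover have "\<forall>\<B>. Q \<B> \<longrightarrow> card \<B> \<le> k" unfolding Q_def using k by blast
  ultimately obtain \<B> where B: "Q \<B>" "\<And>\<B>'. Q \<B>' \<Longrightarrow> card \<B>' \<le> card \<B>"
    using ex_has_greatest_nat[of Q "{}" card "Suc k"] by (metis le_imp_less_Suc)
  have sb: "sensitive_blocks U g z \<B>" using B(1) unfolding Q_def by auto
  have finB: "finite \<B>" using sensitive_blocks_finite[OF fin sb] .
  have sub: "\<Union>\<B> \<subseteq> U" using sb unfolding sensitive_blocks_def by auto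
  show ?thesis
  proof (rule that[OF sub])
    have "card S \<le> k" if S: "S \<in> \<B>" for S
    proof (rule minimal_block_card_le[OF fin z])
      show "S \<subseteq> U" "g (sym_diff z S) \<noteq> g z" using sb S unfolding sensitive_blocks_def by blast+
      show "g (sym_diff z T) = g z" if "T \<subset> S" for T using B(1) S that unfolding Q_def by blast
    qed (rule k)
    then have "card (\<Union>\<B>) \<le> (\<Sum>S\<in>\<B>. k)"
      using card_Union_le_sum_card[of \<B>] sum_mono[of \<B> card "\<lambda>_. k"] by (metis order_trans)
    also have "\<dots> \<le> k * k" using k[OF sb] by simp
    finally show "card (\<Union>\<B>) \<le> k\<^sup>2" by (simp add: power2_eq_square)
  next
    fix z' assume z': "z' \<subseteq> U" "z' \<inter> \<Union>\<B> = z \<inter> \<Union>\<B>"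
    show "g z' = g z"
    proof (rule ccontr)
      assume ne: "g z' \<noteq> g z"
      define D where "D = sym_diff z z'"
      have D: "sym_diff z D = z'" "D \<subseteq> U" "D \<inter> \<Union>\<B> = {}"
        using z z' unfolding D_def by blast+
      obtain T where T: "T \<subseteq> D" "g (sym_diff z T) \<noteq> g z" "\<And>T'. T' \<subset> T \<Longrightarrow> g (sym_diff z T') = g z"
        using exists_minimal_block[of D g z] D ne fin finite_subset by metis
      have "T \<noteq> {}" using T(2) by auto
      moreover have "T \<inter> \<Union>\<B> = {}" using T(1) D(3) by blast
      ultimately have nin: "T \<notin> \<B>" by auto
      have "Q (insert T \<B>)"
        unfolding Q_def sensitive_blocks_def
      proof (intro conjI)
        show "disjoint (insert T \<B>)"
          using sb \<open>T \<inter> \<Union>\<B> = {}\<close> unfolding sensitive_blocks_def pairwise_insert disjnt_def by blast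
        show "\<forall>S\<in>insert T \<B>. g (sym_diff z S) \<noteq> g z"
          using sb T(2) unfolding sensitive_blocks_def by blast
        show "\<forall>S\<in>insert T \<B>. \<forall>T. T \<subset> S \<longrightarrow> g (sym_diff z T) = g z"
          using B(1) T(3) unfolding Q_def by blast
        show "{} \<notin> insert T \<B>" using sb \<open>T \<noteq> {}\<close> unfolding sensitive_blocks_def by blast
        show "insert T \<B> \<subseteq> Pow U" using sb T(1) D(2) unfolding sensitive_blocks_def by blast
      qed (rule z)
      then have "card (insert T \<B>) \<le> card \<B>" by (rule B(2))
      then show False using nin finB by simp
    qed
  qed
qed

section \<open>Deterministic protocols that query certificates\<close>

definition protocol_on :: "'x set \<Rightarrow> 'y set \<Rightarrow> ('x \<Rightarrow> 'y \<Rightarrow> 'v) \<Rightarrow> ('v \<Rightarrow> bool) \<Rightarrow> 'v set \<Rightarrow> nat \<Rightarrow> bool" where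
  "protocol_on X Y p g Z c \<longleftrightarrow> (\<exists>P :: ('x, 'y) protocol. \<forall>x\<in>X. \<forall>y\<in>Y. p x y \<in> Z \<longrightarrow>
      protocol_output P x y = g (p x y) \<and> bits_exchanged P x y \<le> c)"

lemma protocol_on_const: "(\<And>z. z \<in> Z \<Longrightarrow> g z = v) \<Longrightarrow> protocol_on X Y p g Z c"
  unfolding protocol_on_def by (rule exI[of _ "Output v"]) auto

lemma protocol_on_mono: "protocol_on X Y p g Z c \<Longrightarrow> c \<le> c' \<Longrightarrow> protocol_on X Y p g Z c'"
  unfolding protocol_on_def by (meson order_trans)

text \<open>The set \<open>Z\<close> holds the combined points still consistent with what has been
  learned. Membership of \<open>i\<close> in the combined point is a function of one bit of Alice
  and one bit of Bob, so two bits of communication split \<open>Z\<close>.\<close>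

lemma protocol_on_query:
  fixes \<alpha> :: "'x \<Rightarrow> bool" and \<beta> :: "'y \<Rightarrow> bool"
  assumes "protocol_on X Y p g {z\<in>Z. i \<in> z} c" "protocol_on X Y p g {z\<in>Z. i \<notin> z} c"
    and h: "\<And>x y. x \<in> X \<Longrightarrow> y \<in> Y \<Longrightarrow> i \<in> p x y \<longleftrightarrow> h (\<alpha> x) (\<beta> y)"
  shows "protocol_on X Y p g Z (c + 2)"
proof -
  obtain P where P: "\<forall>x\<in>X. \<forall>y\<in>Y. p x y \<in> {z\<in>Z. i \<in> z} \<longrightarrow>
      protocol_output P x y = g (p x y) \<and> bits_exchanged P x y \<le> c"
    using assms(1) unfolding protocol_on_def by blast
  obtain P' where P': "\<forall>x\<in>X. \<forall>y\<in>Y. p x y \<in> {z\<in>Z. i \<notin> z} \<longrightarrow>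
      protocol_output P' x y = g (p x y) \<and> bits_exchanged P' x y \<le> c"
    using assms(2) unfolding protocol_on_def by blast
  define q where "q = (\<lambda>u v. if h u v then P else P')"
  have "\<forall>x\<in>X. \<forall>y\<in>Y. p x y \<in> Z \<longrightarrow>
     protocol_output (Alice_Sends \<alpha> (Bob_Sends \<beta> (q True True) (q True False)) (Bob_Sends \<beta> (q False True) (q False False))) x y
      = g (p x y) \<and> bits_exchanged (Alice_Sends \<alpha> (Bob_Sends \<beta> (q True True) (q True False)) (Bob_Sends \<beta> (q False True) (q False False))) x y \<le> c + 2"
    (is "\<forall>x\<in>X. \<forall>y\<in>Y. p x y \<in> Z \<longrightarrow> ?A x y")
  proof (intro ballI impI)
    fix x y assume xy: "x \<in> X" "y \<in> Y" "p x y \<in> Z"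
    have "?A x y \<longleftrightarrow> protocol_output (q (\<alpha> x) (\<beta> y)) x y = g (p x y) \<and> bits_exchanged (q (\<alpha> x) (\<beta> y)) x y \<le> c"
      by (cases "\<alpha> x"; cases "\<beta> y") auto
    also have "\<dots>" using P P' h[OF xy(1,2)] xy unfolding q_def by auto
    finally show "?A x y" .
  qed
  then show ?thesis unfolding protocol_on_def by blast
qed

lemma protocol_on_query_set:
  assumes "finite C"
    and h: "\<And>i. i \<in> C \<Longrightarrow> \<exists>(h :: bool \<Rightarrow> bool \<Rightarrow> bool) \<alpha> \<beta>. \<forall>x\<in>X. \<forall>y\<in>Y. i \<in> p x y \<longleftrightarrow> h (\<alpha> x) (\<beta> y)"
    and "\<And>w. w \<subseteq> C \<Longrightarrow> protocol_on X Y p g {z\<in>Z. z \<inter> C = w} c"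
  shows "protocol_on X Y p g Z (c + 2 * card C)"
  using assms
proof (induction C arbitrary: Z rule: finite_induct)
  case empty then show ?case by simp
next
  case (insert i C)
  obtain h :: "bool \<Rightarrow> bool \<Rightarrow> bool" and \<alpha> \<beta> where h: "\<forall>x\<in>X. \<forall>y\<in>Y. i \<in> p x y \<longleftrightarrow> h (\<alpha> x) (\<beta> y)" using insert.prems(1)[of i] by auto
  have "protocol_on X Y p g {z\<in>Z. i \<in> z} (c + 2 * card C)"
  proof (rule insert.IH)
    fix w assume w: "w \<subseteq> C"
    have "z \<inter> insert i C = insert i w \<longleftrightarrow> i \<in> z \<and> z \<inter> C = w" for z
      using w insert.hyps(2) by (intro iffI conjI equalityI) (blast | auto)+
    then have "{z \<in> {z \<in> Z. i \<in> z}. z \<inter> C = w} = {z\<in>Z. z \<inter> insert i C = insert i w}" by blast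
    then show "protocol_on X Y p g {z \<in> {z \<in> Z. i \<in> z}. z \<inter> C = w} c"
      using insert.prems(2)[of "insert i w"] w by auto
  qed (rule insert.prems(1), simp)
  moreover have "protocol_on X Y p g {z\<in>Z. i \<notin> z} (c + 2 * card C)"
  proof (rule insert.IH)
    fix w assume w: "w \<subseteq> C"
    have "z \<inter> insert i C = w \<longleftrightarrow> i \<notin> z \<and> z \<inter> C = w" for z
      using w insert.hyps(2) by (intro iffI conjI equalityI) (blast | auto)+
    then have "{z \<in> {z \<in> Z. i \<notin> z}. z \<inter> C = w} = {z\<in>Z. z \<inter> insert i C = w}" by blast
    then show "protocol_on X Y p g {z \<in> {z \<in> Z. i \<notin> z}. z \<inter> C = w} c"
      using insert.prems(2)[of "w"] w by auto
  qed (rule insert.prems(1), simp)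
  ultimately have "protocol_on X Y p g Z ((c + 2 * card C) + 2)"
    by (rule protocol_on_query[where h = h and \<alpha> = \<alpha> and \<beta> = \<beta>]) (use h in auto)
  then show ?case using insert.hyps by (simp add: algebra_simps)
qed

text \<open>Each round queries a certificate of some consistent 1-point. A consistent 0-point must
  differ from it on the certificate, and changing the 0-point there to agree with it is a sensitive
  block inside the newly queried coordinates. So each round adds one block to a disjoint family at
  every surviving 0-point, and after \<open>k\<close> rounds \<open>g\<close> is constant on the
  consistent points.\<close>

lemma protocol_on_block_sensitivity:
  assumes fin: "finite U"
    and k: "\<And>z \<B>. sensitive_blocks U g z \<B> \<Longrightarrow> card \<B> \<le> k"
    and h: "\<And>i. i \<in> U \<Longrightarrow> \<exists>(h :: bool \<Rightarrow> bool \<Rightarrow> bool) \<alpha> \<beta>. \<forall>x\<in>X. \<forall>y\<in>Y. i \<in> p x y \<longleftrightarrow> h (\<alpha> x) (\<beta> y)"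
  shows "protocol_on X Y p g (Pow U) (2 * k ^ 3)"
proof -
  \<comment> \<open>\<open>Q\<close> is the set of queried coordinates, \<open>w\<close> their
    values and \<open>s\<close> the number of rounds left; every consistent 0-point has
    \<open>k - s\<close> disjoint blocks inside \<open>Q\<close>.\<close>
  have *: "protocol_on X Y p g {z. z \<subseteq> U \<and> z \<inter> Q = w} (s * (2 * k\<^sup>2))"
    if "Q \<subseteq> U" "\<And>z. z \<subseteq> U \<Longrightarrow> z \<inter> Q = w \<Longrightarrow> \<not> g z \<Longrightarrow>
        \<exists>\<B>. sensitive_blocks U g z \<B> \<and> \<B> \<subseteq> Pow Q \<and> card \<B> + s = k" for Q w s
    using that
  proof (induction s arbitrary: Q w)
    case 0
    let ?Z = "{z. z \<subseteq> U \<and> z \<inter> Q = w}"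
    \<comment> \<open>A consistent 0-point already has \<open>k\<close> blocks inside
      \<open>Q\<close>; its difference from a consistent 1-point avoids \<open>Q\<close> and would
      be block number \<open>k + 1\<close>.\<close>
    have False if yz: "y \<in> ?Z" "z \<in> ?Z" "g y" "\<not> g z" for y z
    proof -
      obtain \<B> where B: "sensitive_blocks U g z \<B>" "\<B> \<subseteq> Pow Q" "card \<B> = k"
        using 0(2)[of z] yz by auto
      let ?D = "sym_diff z y"
      have D: "?D \<inter> Q = {}" "sym_diff z ?D = y" "?D \<subseteq> U" using yz by blast+
      have "y \<noteq> z" using yz by auto
      then have "?D \<noteq> {}" by blast
      note D = this D
      have nin: "?D \<notin> \<B>" using D B(2) by blast
      have "sensitive_blocks U g z (insert ?D \<B>)"
        unfolding sensitive_blocks_def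
      proof (intro conjI)
        show "disjoint (insert ?D \<B>)"
          using B(1,2) D(2) unfolding sensitive_blocks_def pairwise_insert disjnt_def by blast
        show "\<forall>S\<in>insert ?D \<B>. g (sym_diff z S) \<noteq> g z"
          using B(1) D(3) yz unfolding sensitive_blocks_def by auto
      qed (use B(1) D in \<open>auto simp: sensitive_blocks_def\<close>)
      then have "card (insert ?D \<B>) \<le> k" by (rule k)
      then show False using nin B(3) sensitive_blocks_finite[OF fin B(1)] by simp
    qed
    then have "g z = (\<exists>y\<in>?Z. g y)" if "z \<in> ?Z" for z using that by blast
    then show ?case by (rule protocol_on_const)
  next
    case (Suc s)
    let ?Z = "{z. z \<subseteq> U \<and> z \<inter> Q = w}"
    show ?case
    proof (cases "\<exists>y\<in>?Z. g y")
      case False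
      then have "g z = False" if "z \<in> ?Z" for z using that by blast
      then show ?thesis by (rule protocol_on_const)
    next
      case True
      then obtain y where y: "y \<subseteq> U" "y \<inter> Q = w" "g y" by auto
      obtain C where C: "C \<subseteq> U" "card C \<le> k\<^sup>2" "\<And>z'. z' \<subseteq> U \<Longrightarrow> z' \<inter> C = y \<inter> C \<Longrightarrow> g z' = g y"
        by (rule exists_certificate[OF fin y(1), of g k]) (use k in auto)
      have finC: "finite (C - Q)" using finite_subset[OF C(1) fin] by auto
      have "protocol_on X Y p g {z. z \<subseteq> U \<and> z \<inter> Q = w} (s * (2 * k\<^sup>2) + 2 * card (C - Q))"
      proof (rule protocol_on_query_set[OF finC])
        show "\<exists>(h :: bool \<Rightarrow> bool \<Rightarrow> bool) \<alpha> \<beta>. \<forall>x\<in>X. \<forall>y\<in>Y. i \<in> p x y \<longleftrightarrow> h (\<alpha> x) (\<beta> y)" if "i \<in> C - Q" for i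
          using that C(1) by (intro h) auto
        fix w' assume w': "w' \<subseteq> C - Q"
        have eq: "{z \<in> {z. z \<subseteq> U \<and> z \<inter> Q = w}. z \<inter> (C - Q) = w'} = {z. z \<subseteq> U \<and> z \<inter> (Q \<union> C) = w \<union> w'}"
          using y(2) w' by blast
        have "protocol_on X Y p g {z. z \<subseteq> U \<and> z \<inter> (Q \<union> C) = w \<union> w'} (s * (2 * k\<^sup>2))"
        proof (rule Suc.IH)
          show "Q \<union> C \<subseteq> U" using C Suc.prems by auto
          fix z assume z: "z \<subseteq> U" "z \<inter> (Q \<union> C) = w \<union> w'" "\<not> g z"
          have zQ: "z \<inter> Q = w" using z(2) w' y(2) by blast
          obtain \<B> where B: "sensitive_blocks U g z \<B>" "\<B> \<subseteq> Pow Q" "card \<B> + Suc s = k"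
            using Suc.prems(2)[OF z(1) zQ z(3)] by auto
          let ?D = "sym_diff z y \<inter> C"
          have D: "?D \<inter> Q = {}" "sym_diff z ?D \<subseteq> U" "sym_diff z ?D \<inter> C = y \<inter> C" "?D \<subseteq> U"
            using z y zQ C(1) by blast+
          have gD: "g (sym_diff z ?D)" using C(3)[OF D(2,3)] y(3) by simp
          have D0: "?D \<noteq> {}"
          proof
            assume "?D = {}" then have "g (sym_diff z {})" using gD by argo
            then show False using z(3) by simp
          qed
          have nin: "?D \<notin> \<B>"
          proof
            assume "?D \<in> \<B>"
            then have "?D \<subseteq> Q" using B(2) by (meson PowD subsetD)
            then show False using D(1) D0 by (metis inf.absorb1)
          qed
          have "sensitive_blocks U g z (insert ?D \<B>)"
            unfolding sensitive_blocks_def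
          proof (intro conjI)
            show "disjoint (insert ?D \<B>)"
              using B(1,2) D(1) unfolding sensitive_blocks_def pairwise_insert disjnt_def by blast
            show "\<forall>S\<in>insert ?D \<B>. g (sym_diff z S) \<noteq> g z"
              using B(1) gD z(3) unfolding sensitive_blocks_def by blast
            show "{} \<notin> insert ?D \<B>" using B(1) D0 unfolding sensitive_blocks_def by blast
          qed (use B(1) D(4) in \<open>auto simp: sensitive_blocks_def\<close>)
          moreover have "insert ?D \<B> \<subseteq> Pow (Q \<union> C)" using B(2) by blast
          moreover have "card (insert ?D \<B>) + s = k" using nin B(3) sensitive_blocks_finite[OF fin B(1)] by simp
          ultimately show "\<exists>\<B>. sensitive_blocks U g z \<B> \<and> \<B> \<subseteq> Pow (Q \<union> C) \<and> card \<B> + s = k" by blast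
        qed
        then show "protocol_on X Y p g {z \<in> {z. z \<subseteq> U \<and> z \<inter> Q = w}. z \<inter> (C - Q) = w'} (s * (2 * k\<^sup>2))"
          using eq by simp
      qed
      moreover have "card (C - Q) \<le> k\<^sup>2" using C(2) card_mono[OF finite_subset[OF C(1) fin], of "C - Q"] by auto
      ultimately show ?thesis by (elim protocol_on_mono) simp
    qed
  qed
  have "protocol_on X Y p g {z. z \<subseteq> U \<and> z \<inter> {} = {}} (k * (2 * k\<^sup>2))"
  proof (rule *)
    fix z assume z: "z \<subseteq> U"
    show "\<exists>\<B>. sensitive_blocks U g z \<B> \<and> \<B> \<subseteq> Pow {} \<and> card \<B> + k = k"
      by (rule exI[of _ "{}"]) (use z in \<open>auto simp: sensitive_blocks_def\<close>)
  qed auto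
  moreover have "{z. z \<subseteq> U \<and> z \<inter> {} = {}} = Pow U" by auto
  ultimately show ?thesis by (simp add: power2_eq_square power3_eq_cube algebra_simps)
qed

text \<open>If a block is split into its part outside \<open>z\<close> and its part inside \<open>z\<close>, then many
  of the outer parts can be flipped one after the other without changing the value, while
  flipping any single inner part afterwards changes it.\<close>

lemma monochromatic_blocks_bound:
  fixes g :: "'a set \<Rightarrow> bool"
  assumes fin: "finite U" and z: "z \<subseteq> U" and finI: "finite I" and dis: "disjoint_family_on S I"
    and SU: "\<And>i. i \<in> I \<Longrightarrow> S i \<subseteq> U" and sens: "\<And>i. i \<in> I \<Longrightarrow> g (sym_diff z (S i)) \<noteq> g z"
    and K0: "\<And>z \<B>. sensitive_blocks U g z \<B> \<Longrightarrow> \<forall>B\<in>\<B>. B \<inter> z = {} \<Longrightarrow> card \<B> \<le> K"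
    and K1: "\<And>z \<B>. sensitive_blocks U g z \<B> \<Longrightarrow> \<forall>B\<in>\<B>. B \<subseteq> z \<Longrightarrow> card \<B> \<le> K"
  shows "card I \<le> 4 * K\<^sup>2 + 3 * K"
proof (rule ccontr)
  assume big: "\<not> card I \<le> 4 * K\<^sup>2 + 3 * K"
  define A where "A = (\<lambda>i. S i - z)"
  define B where "B = (\<lambda>i. S i \<inter> z)"
  define v where "v = g z"
  define pt where "pt = (\<lambda>T. z \<union> (\<Union>i\<in>T. A i))"
  \<comment> \<open>At any one point at most \<open>K\<close> outer parts that avoid it are
    sensitive. Everything that can go wrong with a choice below is of this kind, at a suitable
    point.\<close>
  have zero: "card {j\<in>J. g (q \<union> A j) \<noteq> g q} \<le> K"
    if q: "q \<subseteq> U" "J \<subseteq> I" "\<And>j. j \<in> J \<Longrightarrow> A j \<inter> q = {}" for q J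
  proof -
    let ?J = "{j\<in>J. g (q \<union> A j) \<noteq> g q}"
    have sd: "sym_diff q (A j) = q \<union> A j" if "j \<in> J" for j using q(3)[OF that] by blast
    have s: "sensitive_blocks U g q (A ` ?J)" and c: "card (A ` ?J) = card ?J"
    proof -
      have 1: "disjoint_family_on A ?J" using dis q(2) unfolding disjoint_family_on_def A_def by blast
      have 2: "A j \<subseteq> U" if "j \<in> ?J" for j using that SU q(2) unfolding A_def by blast
      have 3: "g (sym_diff q (A j)) \<noteq> g q" if "j \<in> ?J" for j
        using that sd[of j] by auto
      show "sensitive_blocks U g q (A ` ?J)" by (rule sensitive_blocks_image(1)[OF q(1) 1 2 3])
      show "card (A ` ?J) = card ?J" by (rule sensitive_blocks_image(2)[OF q(1) 1 2 3])
    qed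
    have "card (A ` ?J) \<le> K" by (rule K0[OF s]) (use q(3) in auto)
    then show ?thesis using c by simp
  qed
  have ptU: "pt T \<subseteq> U" if "T \<subseteq> I" for T using that z SU unfolding pt_def A_def by blast
  have dA: "A j \<inter> pt T = {}" if "T \<subseteq> I" "j \<in> I" "j \<notin> T" for T j
    using that dis unfolding pt_def A_def disjoint_family_on_def by fastforce
  have AB: "A i \<inter> B j = {}" for i j unfolding A_def B_def by blast
  \<comment> \<open>State after \<open>t\<close> choices: the outer parts of \<open>T\<close> are
    switched on and the value is still \<open>v\<close>; removing the inner part of any chosen block
    changes it; switching any remaining block \<open>i\<close> completely changes it too. A choice
    costs at most \<open>2 * K + 1\<close> indices of \<open>R\<close>: the chosen one and those it
    spoils.\<close>
  have "\<exists>T R. T \<subseteq> I \<and> R \<subseteq> I \<and> T \<inter> R = {} \<and> card T = t \<and> card R + t * (2 * K + 1) \<ge> card I \<and>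
      g (pt T) = v \<and> (\<forall>j\<in>T. g (pt T - B j) \<noteq> v) \<and> (\<forall>i\<in>R. g ((pt T \<union> A i) - B i) \<noteq> v)"
    if "t \<le> K + 1" for t
    using that
  proof (induction t)
    case 0
    have "z \<union> A i - B i = sym_diff z (S i)" for i unfolding A_def B_def by blast
    then show ?case using sens by (intro exI[of _ "{}"] exI[of _ I]) (auto simp: pt_def v_def)
  next
    case (Suc t)
    then obtain T R where TR: "T \<subseteq> I" "R \<subseteq> I" "T \<inter> R = {}" "card T = t" "card R + t * (2 * K + 1) \<ge> card I"
      "g (pt T) = v" "\<And>j. j\<in>T \<Longrightarrow> g (pt T - B j) \<noteq> v" "\<And>i. i\<in>R \<Longrightarrow> g ((pt T \<union> A i) - B i) \<noteq> v"
      by auto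
    have finR: "finite R" "finite T" using TR finI finite_subset by auto
    \<comment> \<open>The choice of \<open>j\<close> must preserve the value at \<open>pt T\<close>
      (\<open>bad1\<close>), the effect of each earlier inner part (\<open>bad2\<close>) and that of
      each remaining block (\<open>bad3\<close>). The first two exclude at most
      \<open>K * (t + 1)\<close> indices altogether; the third is controlled only on
      average.\<close>
    define bad1 where "bad1 = {j\<in>R. g (pt T \<union> A j) \<noteq> g (pt T)}"
    define bad2 where "bad2 = (\<lambda>j'. {j\<in>R. g ((pt T - B j') \<union> A j) \<noteq> g (pt T - B j')})"
    define bad3 where "bad3 = (\<lambda>i. {j\<in>R-{i}. g (((pt T \<union> A i) - B i) \<union> A j) \<noteq> g ((pt T \<union> A i) - B i)})"
    have b1: "card bad1 \<le> K" unfolding bad1_def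
    proof (rule zero)
      show "A j \<inter> pt T = {}" if "j \<in> R" for j using dA[of T j] that TR(1-3) by blast
    qed (use ptU[of T] TR(1,2) in auto)
    have b2: "card (bad2 j') \<le> K" if "j' \<in> T" for j' unfolding bad2_def
    proof (rule zero)
      show "A j \<inter> (pt T - B j') = {}" if "j \<in> R" for j using dA[of T j] that TR(1-3) by blast
    qed (use ptU[of T] TR(1,2) in auto)
    have b3: "card (bad3 i) \<le> K" if i: "i \<in> R" for i unfolding bad3_def
    proof (rule zero)
      have "A i \<subseteq> U" using i TR(2) SU unfolding A_def by blast
      then show "pt T \<union> A i - B i \<subseteq> U" using ptU[of T] TR by blast
      show "A j \<inter> (pt T \<union> A i - B i) = {}" if j: "j \<in> R - {i}" for j
      proof -
        have "A j \<inter> pt (insert i T) = {}" by (rule dA) (use i j TR in auto)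
        then show ?thesis unfolding pt_def by blast
      qed
    qed (use TR in auto)
    define G where "G = R - bad1 - (\<Union>j'\<in>T. bad2 j')"
    have "card (bad1 \<union> (\<Union>j'\<in>T. bad2 j')) \<le> card bad1 + card (\<Union>j'\<in>T. bad2 j')" by (rule card_Un_le)
    also have "card (\<Union>j'\<in>T. bad2 j') \<le> (\<Sum>j'\<in>T. card (bad2 j'))" by (rule card_UN_le[OF finR(2)])
    also have "\<dots> \<le> (\<Sum>j'\<in>T. K)" by (rule sum_mono[OF b2])
    also have "card bad1 + (\<Sum>j'\<in>T. K) \<le> K * (t + 1)" using b1 TR(4) by (simp add: algebra_simps)
    finally have "card (bad1 \<union> (\<Union>j'\<in>T. bad2 j')) \<le> K * (t + 1)" by simp
    moreover have "card R - card (bad1 \<union> (\<Union>j'\<in>T. bad2 j')) \<le> card G"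
      unfolding G_def Diff_Diff_Int using diff_card_le_card_Diff[of "bad1 \<union> (\<Union>j'\<in>T. bad2 j')" R] finR
      by (simp add: Diff_eq Int_assoc bad1_def bad2_def)
    ultimately have Gc: "card R \<le> card G + K * (t + 1)" by linarith
    have tK: "t \<le> K" using Suc.prems by simp
    \<comment> \<open>The constants of the lemma come from here: for \<open>t \<le> K\<close> the
      indices already spent and twice those excluded now stay within
      \<open>4 * K\<^sup>2 + 3 * K\<close>, so at least half of \<open>R\<close> survives in
      \<open>G\<close>.\<close>
    have "t * (2 * K + 1) + 2 * (K * (t + 1)) \<le> K * (2 * K + 1) + 2 * (K * (K + 1))"
      using tK by (intro add_mono mult_mono) auto
    also have "\<dots> = 4 * K\<^sup>2 + 3 * K" by (simp add: power2_eq_square algebra_simps)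
    finally have "2 * (K * (t + 1)) < card R" using big TR(5) by linarith
    then have G2: "card R \<le> 2 * card G" "card G > 0" using Gc by linarith+
    have finG: "finite G" unfolding G_def using finR by auto
    \<comment> \<open>Double counting of the pairs with \<open>j \<in> bad3 i\<close>: there are at
      most \<open>K * card R \<le> 2 * K * card G\<close> of them, so some \<open>j \<in> G\<close>
      lies in at most \<open>2 * K\<close> of these sets.\<close>
    have "\<exists>j\<in>G. card {i\<in>R. j \<in> bad3 i} \<le> 2 * K"
    proof (rule ccontr)
      assume "\<not> ?thesis"
      then have lt: "2 * K + 1 \<le> card {i\<in>R. j \<in> bad3 i}" if "j \<in> G" for j using that by force
      have "card G * (2 * K + 1) = (\<Sum>j\<in>G. 2 * K + 1)" by simp
      also have "\<dots> \<le> (\<Sum>j\<in>G. card {i\<in>R. j \<in> bad3 i})" by (rule sum_mono[OF lt])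
      also have "\<dots> \<le> (\<Sum>j\<in>R. card {i\<in>R. j \<in> bad3 i})" by (rule sum_mono2) (auto simp: G_def finR)
      also have "\<dots> = (\<Sum>j\<in>R. \<Sum>i\<in>R. if j \<in> bad3 i then 1 else 0)"
        using finR by (intro sum.cong refl) (simp add: sum.If_cases Int_def)
      also have "\<dots> = (\<Sum>i\<in>R. \<Sum>j\<in>R. if j \<in> bad3 i then 1 else 0)" by (rule sum.swap)
      also have "\<dots> = (\<Sum>i\<in>R. card (bad3 i))"
      proof (intro sum.cong refl)
        fix i
        have "R \<inter> bad3 i = bad3 i" unfolding bad3_def by blast
        then show "(\<Sum>j\<in>R. if j \<in> bad3 i then 1 else 0) = card (bad3 i)"
          using finR by (simp add: sum.If_cases)
      qed
      also have "\<dots> \<le> (\<Sum>i\<in>R. K)" by (rule sum_mono[OF b3])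
      finally have "card G * (2 * K + 1) \<le> card R * K" by simp
      also have "\<dots> \<le> 2 * card G * K" using G2 by (intro mult_right_mono) auto
      finally show False using G2 by (simp add: algebra_simps)
    qed
    then obtain j where j: "j \<in> G" "card {i\<in>R. j \<in> bad3 i} \<le> 2 * K" by blast
    have jR: "j \<in> R" "j \<notin> T" using j TR(3) unfolding G_def by auto
    define R' where "R' = R - insert j {i\<in>R. j \<in> bad3 i}"
    have pt': "pt (insert j T) = pt T \<union> A j" unfolding pt_def by blast
    have "card (insert j {i\<in>R. j \<in> bad3 i}) \<le> 2 * K + 1" using j(2) finR by (simp add: card_insert_if)
    then have Rc: "card R \<le> card R' + (2 * K + 1)"
      using diff_card_le_card_Diff[of "insert j {i\<in>R. j \<in> bad3 i}" R] finR unfolding R'_def by simp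
    have "g (pt (insert j T)) = v" using j TR(6) unfolding pt' G_def bad1_def by auto
    moreover have "g (pt (insert j T) - B j') \<noteq> v" if j': "j' \<in> insert j T" for j'
    proof (cases "j' = j")
      case True then show ?thesis using TR(8)[OF jR(1)] pt' by simp
    next
      case False
      then have j'T: "j' \<in> T" using j' by simp
      have "pt (insert j T) - B j' = (pt T - B j') \<union> A j" unfolding pt' using AB[of j j'] by blast
      moreover have "j \<notin> bad2 j'" using j(1) j'T unfolding G_def by blast
      ultimately show ?thesis using TR(7)[OF j'T] jR(1) unfolding bad2_def by auto
    qed
    moreover have "g ((pt (insert j T) \<union> A i) - B i) \<noteq> v" if i: "i \<in> R'" for i
    proof -
      have iR: "i \<in> R" "i \<noteq> j" "j \<notin> bad3 i" using i unfolding R'_def by auto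
      have "(pt (insert j T) \<union> A i) - B i = ((pt T \<union> A i) - B i) \<union> A j" unfolding pt' using AB[of j i] by blast
      then show ?thesis using TR(8)[OF iR(1)] iR jR(1) unfolding bad3_def by auto
    qed
    moreover have "card R' + Suc t * (2 * K + 1) \<ge> card I" using Rc TR(5) by simp
    moreover have "card (insert j T) = Suc t" using jR finR TR(4) by simp
    moreover have "insert j T \<inter> R' = {}" "R' \<subseteq> I" "insert j T \<subseteq> I" using TR jR unfolding R'_def by auto
    ultimately show ?case by (intro exI[of _ "insert j T"] exI[of _ R'] conjI ballI)
  qed
  \<comment> \<open>Now \<open>K + 1\<close> inner parts are sensitive at one point and contained in
    it, one more than such families may have.\<close>
  from this[of "K + 1"] obtain T where T: "T \<subseteq> I" "card T = K + 1" "g (pt T) = v" "\<And>j. j \<in> T \<Longrightarrow> g (pt T - B j) \<noteq> v"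
    by auto
  have Bpt: "B j \<subseteq> pt T" for j unfolding B_def pt_def by blast
  then have sd: "sym_diff (pt T) (B j) = pt T - B j" for j by blast
  have 1: "disjoint_family_on B T" using dis T(1) unfolding disjoint_family_on_def B_def by blast
  have 2: "B j \<subseteq> U" if "j \<in> T" for j using that z unfolding B_def by blast
  have 3: "g (sym_diff (pt T) (B j)) \<noteq> g (pt T)" if "j \<in> T" for j using sd T that by metis
  have "card (B ` T) \<le> K"
    by (rule K1[OF sensitive_blocks_image(1)[OF ptU[OF T(1)] 1 2 3]]) (use Bpt in auto)
  then show False using sensitive_blocks_image(2)[OF ptU[OF T(1)] 1 2 3] T(2) by simp
qed

section \<open>A dual polynomial for OR\<close>

text \<open>The sum is the divided difference of \<open>q\<close> on \<open>T\<close>, that is, the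
  coefficient of degree \<open>card T - 1\<close> in the Lagrange interpolation polynomial. That
  polynomial is \<open>q\<close> itself, whose degree is smaller.\<close>

lemma divided_difference_eq_0:
  fixes T :: "'a::field set"
  assumes fin: "finite T" and deg: "degree q + 1 < card T"
  shows "(\<Sum>t\<in>T. poly q t / (\<Prod>u\<in>T-{t}. t - u)) = 0"
proof -
  define L where "L = (\<lambda>t. \<Prod>u\<in>T-{t}. [:-u, 1:])"
  define p where "p = (\<Sum>t\<in>T. smult (poly q t / (\<Prod>u\<in>T-{t}. t - u)) (L t))"
  have dL: "degree (L t) = card T - 1" if "t \<in> T" for t
    unfolding L_def by (subst degree_prod_eq_sum_degree) (use that fin in auto)
  have cL: "coeff (L t) (card T - 1) = 1" if "t \<in> T" for t
    using lead_coeff_prod[of "\<lambda>u. [:-u, 1:]" "T - {t}"] dL[OF that] unfolding L_def by simp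
  have degp: "degree p \<le> card T - 1"
    unfolding p_def using fin dL by (intro degree_sum_le) (auto intro: order_trans[OF degree_smult_le])
  have ev: "poly p s = poly q s" if s: "s \<in> T" for s
  proof -
    have "poly p s = (\<Sum>t\<in>T. poly q t / (\<Prod>u\<in>T-{t}. t - u) * (\<Prod>u\<in>T-{t}. s - u))"
      unfolding p_def L_def by (simp add: poly_sum poly_prod)
    also have "\<dots> = (\<Sum>t\<in>T. if t = s then poly q s else 0)"
    proof (intro sum.cong refl)
      fix t assume t: "t \<in> T"
      show "poly q t / (\<Prod>u\<in>T-{t}. t - u) * (\<Prod>u\<in>T-{t}. s - u) = (if t = s then poly q s else 0)"
      proof (cases "t = s")
        case True
        have "(\<Prod>u\<in>T-{s}. s - u) \<noteq> 0" using fin by auto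
        then show ?thesis using True by simp
      next
        case False
        then have "(\<Prod>u\<in>T-{t}. s - u) = 0" using fin s by (intro prod_zero) auto
        then show ?thesis using False by simp
      qed
    qed
    finally show ?thesis using fin s by simp
  qed
  have "p = q"
  proof (rule ccontr)
    assume "p \<noteq> q"
    then have nz: "p - q \<noteq> 0" by simp
    have "T \<subseteq> {x. poly (p - q) x = 0}" using ev by auto
    then have "card T \<le> card {x. poly (p - q) x = 0}" by (rule card_mono[OF poly_roots_finite[OF nz]])
    also have "\<dots> \<le> degree (p - q)" by (rule card_poly_roots_bound[OF nz])
    also have "\<dots> \<le> card T - 1" using degp deg by (intro degree_diff_le) auto
    finally show False using deg by simp
  qed
  then have "coeff p (card T - 1) = 0" using deg by (simp add: coeff_eq_0)
  moreover have "coeff p (card T - 1) = (\<Sum>t\<in>T. poly q t / (\<Prod>u\<in>T-{t}. t - u))"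
    unfolding p_def by (simp add: coeff_sum cL[unfolded One_nat_def])
  ultimately show ?thesis by simp
qed

section \<open>Products of differences of squares\<close>

lemma prod_square_differences_below:
  fixes i :: nat
  assumes "k < i"
  shows "(\<Prod>j=1..k. real (i\<^sup>2) - real (j\<^sup>2)) * fact i * fact (i - 1 - k) = fact (i + k) * fact (i - 1)"
  using assms
proof (induction k)
  case 0 then show ?case by simp
next
  case (Suc k)
  have 1: "fact (i - 1 - k) = (real i - real (Suc k)) * fact (i - 1 - Suc k)"
    using Suc.prems by (subst fact_reduce) (auto simp: of_nat_diff)
  have 2: "real (i\<^sup>2) - real ((Suc k)\<^sup>2) = (real i - real (Suc k)) * (real i + real (Suc k))"
    by (simp add: power2_eq_square algebra_simps)
  have 3: "fact (i + Suc k) = (real i + real (Suc k)) * fact (i + k)" by (simp add: algebra_simps)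
  have 4: "(\<Prod>j=1..Suc k. real (i\<^sup>2) - real (j\<^sup>2)) =
      (\<Prod>j=1..k. real (i\<^sup>2) - real (j\<^sup>2)) * (real (i\<^sup>2) - real ((Suc k)\<^sup>2))" by (simp add: mult.commute)
  have IH: "(\<Prod>j=1..k. real (i\<^sup>2) - real (j\<^sup>2)) * fact i * fact (i - 1 - k) = fact (i + k) * fact (i - 1)"
    using Suc by simp
  have "(\<Prod>j=1..Suc k. real (i\<^sup>2) - real (j\<^sup>2)) * fact i * fact (i - 1 - Suc k)
     = (real i + real (Suc k)) * ((\<Prod>j=1..k. real (i\<^sup>2) - real (j\<^sup>2)) * fact i * fact (i - 1 - k))"
    unfolding 4 2 1 by (simp only: mult_ac)
  also have "\<dots> = fact (i + Suc k) * fact (i - 1)" unfolding IH 3 by (simp only: mult_ac)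
  finally show ?case .
qed

text \<open>Every factor splits as \<open>\<bar>i - j\<bar> * (i + j)\<close>, and both halves are
  quotients of factorials. The extra \<open>2 * i\<^sup>2\<close> collects the omitted factor
  \<open>i + i\<close> and the quotient of \<open>fact i\<close> and
  \<open>fact (i - 1)\<close>.\<close>

lemma prod_square_differences:
  fixes i r :: nat
  assumes "1 \<le> i" "i \<le> r"
  shows "(\<Prod>j\<in>{1..r}-{i}. \<bar>real (i\<^sup>2) - real (j\<^sup>2)\<bar>) * (2 * real (i\<^sup>2)) = fact (r - i) * fact (r + i)"
  using assms(2)
proof (induction r rule: dec_induct)
  case base
  have "{1..i} - {i} = {1..i-1}" by auto
  then have A: "(\<Prod>j\<in>{1..i}-{i}. \<bar>real (i\<^sup>2) - real (j\<^sup>2)\<bar>) = (\<Prod>j=1..i-1. real (i\<^sup>2) - real (j\<^sup>2))"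
  proof (intro prod.cong)
    fix j assume "j \<in> {1..i-1}"
    then have "j\<^sup>2 \<le> i\<^sup>2" by (intro power_mono) auto
    then show "\<bar>real (i\<^sup>2) - real (j\<^sup>2)\<bar> = real (i\<^sup>2) - real (j\<^sup>2)" by linarith
  qed
  define P where "P = (\<Prod>j=1..i-1. real (i\<^sup>2) - real (j\<^sup>2))"
  have B: "P * real i = fact (2 * i - 1)"
  proof -
    have e: "i + (i - 1) = 2 * i - 1" by simp
    have f: "fact i = real i * fact (i - 1)" using assms(1) by (simp add: fact_reduce)
    have "P * fact i = fact (2 * i - 1) * fact (i - 1)"
      using prod_square_differences_below[of "i - 1" i] assms(1) unfolding P_def e by simp
    then show ?thesis unfolding f by simp
  qed
  have C: "fact (i + i) = 2 * real i * fact (2 * i - 1)"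
  proof -
    have e: "i + i = Suc (2 * i - 1)" using assms(1) by simp
    have "real (Suc (2 * i - 1)) = 2 * real i" using assms(1) by (simp add: of_nat_diff)
    then show ?thesis unfolding e fact_Suc by simp
  qed
  have "P * (2 * real (i\<^sup>2)) = 2 * real i * (P * real i)" by (simp add: power2_eq_square)
  then show ?case unfolding A P_def[symmetric] B C by simp
next
  case (step r)
  have eq: "{1..Suc r} - {i} = insert (Suc r) ({1..r} - {i})" using step by auto
  have A: "\<bar>real (i\<^sup>2) - real ((Suc r)\<^sup>2)\<bar> = real (Suc r - i) * real (Suc r + i)"
  proof -
    have "real (i\<^sup>2) \<le> real ((Suc r)\<^sup>2)" using step by (intro of_nat_mono power_mono) auto
    then show ?thesis using step by (simp add: of_nat_diff power2_eq_square algebra_simps)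
  qed
  have B: "fact (Suc r - i) = real (Suc r - i) * fact (r - i)" "fact (Suc r + i) = real (Suc r + i) * fact (r + i)"
    using step by (simp_all add: Suc_diff_le algebra_simps)
  have C: "(\<Prod>j\<in>{1..Suc r}-{i}. \<bar>real (i\<^sup>2) - real (j\<^sup>2)\<bar>) =
      \<bar>real (i\<^sup>2) - real ((Suc r)\<^sup>2)\<bar> * (\<Prod>j\<in>{1..r}-{i}. \<bar>real (i\<^sup>2) - real (j\<^sup>2)\<bar>)"
    unfolding eq by (subst prod.insert) auto
  have "(\<Prod>j\<in>{1..Suc r}-{i}. \<bar>real (i\<^sup>2) - real (j\<^sup>2)\<bar>) * (2 * real (i\<^sup>2)) =
      real (Suc r - i) * real (Suc r + i) * (fact (r - i) * fact (r + i))"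
    unfolding C A step.IH[symmetric] by (simp only: mult_ac)
  then show ?case unfolding B by (simp only: mult_ac)
qed

text \<open>The central binomial coefficient is the largest in its row, so the product of factorials
  in its denominator is the smallest.\<close>

lemma fact_square_le:
  assumes "i \<le> r"
  shows "(fact r)\<^sup>2 \<le> (fact (r - i) * fact (r + i) :: real)"
proof -
  have 1: "fact r * fact r * ((2 * r) choose r) = (fact (2 * r) :: nat)"
    using binomial_fact_lemma[of r "2 * r"] by (simp add: mult_2)
  have 2: "fact (r + i) * fact (r - i) * ((2 * r) choose (r + i)) = (fact (2 * r) :: nat)"
    using binomial_fact_lemma[of "r + i" "2 * r"] assms by (simp add: mult_2)
  have "fact r * fact r * ((2 * r) choose r) \<le> fact (r + i) * fact (r - i) * ((2 * r) choose r)"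
    using 1 2 binomial_maximum'[of r "r + i"] by (metis mult_le_mono2)
  then have "fact r * fact r \<le> (fact (r + i) * fact (r - i) :: nat)" by simp
  then have "real (fact r * fact r) \<le> real (fact (r + i) * fact (r - i))" by (rule of_nat_mono)
  then show ?thesis by (simp add: power2_eq_square mult_ac)
qed

text \<open>Compares the weight denominators at the nodes \<open>0\<close> and
  \<open>50 * i\<^sup>2\<close> up to scaling: moving the base point from 0 to
  \<open>i\<^sup>2\<close> shrinks the product of the distances to the other squares by at most a
  factor 2.\<close>

lemma prod_squares_le_square_differences:
  assumes "1 \<le> i" "i \<le> r"
  shows "(\<Prod>j\<in>{1..r}-{i}. real (j\<^sup>2)) \<le> 2 * (\<Prod>j\<in>{1..r}-{i}. \<bar>real (i\<^sup>2) - real (j\<^sup>2)\<bar>)"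
proof -
  have "(\<Prod>j=1..r. real (j\<^sup>2)) = (fact r)\<^sup>2"
    by (simp add: fact_prod prod_power_distrib)
  moreover have "(\<Prod>j=1..r. real (j\<^sup>2)) = real (i\<^sup>2) * (\<Prod>j\<in>{1..r}-{i}. real (j\<^sup>2))"
    using assms by (subst prod.remove[of _ i]) auto
  ultimately have "real (i\<^sup>2) * (\<Prod>j\<in>{1..r}-{i}. real (j\<^sup>2)) \<le> fact (r - i) * fact (r + i)"
    using fact_square_le[OF assms(2)] by simp
  also have "\<dots> = real (i\<^sup>2) * (2 * (\<Prod>j\<in>{1..r}-{i}. \<bar>real (i\<^sup>2) - real (j\<^sup>2)\<bar>))"
    using prod_square_differences[OF assms] by (simp add: mult_ac)
  finally show ?thesis using assms by (simp add: mult_le_cancel_left)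
qed

lemma sum_inverse_squares_le: "(\<Sum>i=1..r. 1 / (real i)\<^sup>2) \<le> 2"
proof -
  have "(\<Sum>i=1..Suc n. 1 / (real i)\<^sup>2) \<le> 2 - 1 / real (Suc n)" for n
  proof (induction n)
    case (Suc n)
    have "1 / (real (Suc (Suc n)))\<^sup>2 \<le> 1 / real (Suc n) - 1 / real (Suc (Suc n))"
    proof -
      have "1 / real (Suc n) - 1 / real (Suc (Suc n)) = 1 / (real (Suc n) * real (Suc (Suc n)))"
        by (simp add: field_simps)
      then show ?thesis unfolding power2_eq_square by (auto intro!: divide_left_mono mult_right_mono)
    qed
    then show ?case using Suc by simp
  qed simp
  then have "(\<Sum>i=1..Suc n. 1 / (real i)\<^sup>2) \<le> 2" for n by (rule order_trans) simp
  then show ?thesis by (cases r) auto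
qed

text \<open>The weights are divided-difference weights on the nodes \<open>0\<close>, \<open>1\<close> and \<open>50 i\<^sup>2\<close>; the quadratic
  growth of the nodes concentrates the mass on \<open>0\<close> and \<open>1\<close>.\<close>

lemma or_dual_weights:
  fixes r m :: nat
  assumes m: "50 * r\<^sup>2 \<le> m" "1 \<le> m"
  obtains \<phi> :: "nat \<Rightarrow> real" where "\<phi> 0 \<le> 0" "0 \<le> \<phi> 1" "(\<Sum>k\<le>m. \<bar>\<phi> k\<bar>) = 1"
    "(\<Sum>k=2..m. \<bar>\<phi> k\<bar>) \<le> 1 / 10"
    "\<And>a. a \<le> r \<Longrightarrow> (\<Sum>k\<le>m. \<phi> k * real (k choose a)) = 0"
proof -
  define s where "s = (\<lambda>i::nat. 50 * i\<^sup>2)"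
  define T where "T = insert 0 (insert 1 (s ` {1..r}))"
  have s2: "2 \<le> s i" if "1 \<le> i" for i using that unfolding s_def by (cases i) auto
  have inj: "inj_on s J" for J unfolding s_def inj_on_def by simp
  have s01: "0 \<notin> s ` {1..r}" "1 \<notin> s ` {1..r}" using s2 by fastforce+
  have finT: "finite T" unfolding T_def by simp
  have cardT: "card T = r + 2" unfolding T_def using s01 card_image[OF inj, of "{1..r}"] by (simp add: card_insert_if)
  have Tm: "T \<subseteq> {..m}"
  proof -
    have "s i \<le> m" if "i \<le> r" for i
      using m(1) power_mono[OF that, of 2] unfolding s_def by linarith
    then show ?thesis using m(2) unfolding T_def by auto
  qed
  define D where "D = (\<lambda>t. \<Prod>u\<in>T-{t}. real t - real u)"
  have D_nz: "D t \<noteq> 0" for t unfolding D_def using finT by auto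
  define W where "W = (\<Sum>t\<in>T. 1 / \<bar>D t\<bar>)"
  have W_pos: "W > 0" unfolding W_def by (rule sum_pos) (use finT D_nz in \<open>auto simp: T_def\<close>)
  \<comment> \<open>\<open>D 0\<close> and \<open>D 1\<close> have the signs of
    \<open>(-1) ^ (r + 1)\<close> and \<open>(-1) ^ r\<close>, so the factor \<open>(-1) ^ r\<close>
    makes the weight at 0 nonpositive and the one at 1 nonnegative; \<open>W\<close> normalizes the
    total mass to 1.\<close>
  define \<phi> where "\<phi> = (\<lambda>k. if k \<in> T then (-1) ^ r / (W * D k) else 0)"
  have D0: "D 0 = (-1) ^ (r + 1) * (\<Prod>i=1..r. real (s i))"
  proof -
    have "T - {0} = insert 1 (s ` {1..r})" using s01 unfolding T_def by auto
    then have "D 0 = - (\<Prod>u\<in>s ` {1..r}. - real u)" unfolding D_def using s01 by simp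
    also have "(\<Prod>u\<in>s ` {1..r}. - real u) = (\<Prod>i=1..r. (-1) * real (s i))"
      by (subst prod.reindex[OF inj]) simp
    also have "\<dots> = (-1) ^ r * (\<Prod>i=1..r. real (s i))" by (subst prod.distrib) simp
    finally show ?thesis by simp
  qed
  have D1: "D 1 = (-1) ^ r * (\<Prod>i=1..r. real (s i) - 1)"
  proof -
    have "s ` {1..r} - {1} = s ` {1..r}" using s01(2) by blast
    then have "T - {1} = insert 0 (s ` {1..r})" unfolding T_def by (simp only: insert_Diff_if) simp
    then have "D 1 = (\<Prod>u\<in>s ` {1..r}. 1 - real u)" unfolding D_def using s01 by simp
    also have "\<dots> = (\<Prod>i=1..r. (-1) * (real (s i) - 1))"
      by (subst prod.reindex[OF inj]) simp
    also have "\<dots> = (-1) ^ r * (\<Prod>i=1..r. real (s i) - 1)" by (subst prod.distrib) simp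
    finally show ?thesis by simp
  qed
  have pos0: "(\<Prod>i=1..r. real (s i)) > 0" using s2 by (intro prod_pos) (auto intro!: Nat.gr0I simp: s_def)
  \<comment> \<open>Node 1 contributes \<open>s i - 1 \<ge> 49 * i\<^sup>2\<close> to the
    denominator at \<open>s i\<close>, but only a factor of modulus 1 to \<open>D 0\<close>. The
    factors from 0 and \<open>s i\<close> agree, and the other nodes cost at most a factor
    2.\<close>
  have Di: "1 / \<bar>D (s i)\<bar> \<le> 2 / 49 * (1 / (real i)\<^sup>2) * (1 / \<bar>D 0\<bar>)" if i: "1 \<le> i" "i \<le> r" for i
  proof -
    let ?J = "{1..r} - {i}"
    have e1: "T - {s i} = insert 0 (insert 1 (s ` ?J))"
    proof -
      have "s ` ?J = s ` {1..r} - {s i}" using inj[of UNIV] by (simp add: image_set_diff)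
      moreover have "T - {s i} = insert 0 (insert 1 (s ` {1..r} - {s i}))"
        using s2[OF i(1)] unfolding T_def by (simp add: insert_Diff_if)
      ultimately show ?thesis by simp
    qed
    have s01': "0 \<notin> s ` ?J" "1 \<notin> s ` ?J" using s01 by blast+
    have "\<bar>D (s i)\<bar> = (\<Prod>u\<in>T-{s i}. \<bar>real (s i) - real u\<bar>)" unfolding D_def by (simp add: abs_prod)
    also have "\<dots> = real (s i) * (real (s i) - 1) * (\<Prod>u\<in>s ` ?J. \<bar>real (s i) - real u\<bar>)"
      unfolding e1 using s01' s2[OF i(1)] by simp
    also have "(\<Prod>u\<in>s ` ?J. \<bar>real (s i) - real u\<bar>) = (\<Prod>j\<in>?J. 50 * \<bar>real (i\<^sup>2) - real (j\<^sup>2)\<bar>)"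
    proof (subst prod.reindex[OF inj], rule prod.cong[OF refl])
      fix j
      have "real (s i) - real (s j) = 50 * (real (i\<^sup>2) - real (j\<^sup>2))" unfolding s_def by simp
      then show "((\<lambda>u. \<bar>real (s i) - real u\<bar>) \<circ> s) j = 50 * \<bar>real (i\<^sup>2) - real (j\<^sup>2)\<bar>"
        by (simp only: comp_apply abs_mult abs_numeral)
    qed
    also have "\<dots> = 50 ^ card ?J * (\<Prod>j\<in>?J. \<bar>real (i\<^sup>2) - real (j\<^sup>2)\<bar>)"
      by (subst prod.distrib) simp
    finally have A: "\<bar>D (s i)\<bar> = real (s i) * (real (s i) - 1) * (50 ^ card ?J * (\<Prod>j\<in>?J. \<bar>real (i\<^sup>2) - real (j\<^sup>2)\<bar>))" .
    have "\<bar>D 0\<bar> = (\<Prod>j=1..r. real (s j))" unfolding D0 using pos0 by (simp add: abs_mult power_abs)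
    also have "\<dots> = real (s i) * (\<Prod>j\<in>?J. real (s j))" using i by (subst prod.remove[of _ i]) auto
    also have "(\<Prod>j\<in>?J. real (s j)) = 50 ^ card ?J * (\<Prod>j\<in>?J. real (j\<^sup>2))"
      unfolding s_def of_nat_mult by (subst prod.distrib) simp
    finally have "\<bar>D 0\<bar> \<le> real (s i) * (50 ^ card ?J * (2 * (\<Prod>j\<in>?J. \<bar>real (i\<^sup>2) - real (j\<^sup>2)\<bar>)))"
      using prod_squares_le_square_differences[OF i] by (simp add: mult_left_mono)
    then have "\<bar>D 0\<bar> * (real (s i) - 1) \<le> (real (s i) * (50 ^ card ?J * (2 * (\<Prod>j\<in>?J. \<bar>real (i\<^sup>2) - real (j\<^sup>2)\<bar>)))) * (real (s i) - 1)"
      using s2[OF i(1)] by (intro mult_right_mono) auto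
    also have "\<dots> = 2 * \<bar>D (s i)\<bar>" unfolding A by (simp only: mult_ac)
    finally have B: "\<bar>D 0\<bar> * (real (s i) - 1) \<le> 2 * \<bar>D (s i)\<bar>" .
    have "1 \<le> (real i)\<^sup>2" using i by simp
    then have "49 * (real i)\<^sup>2 \<le> real (s i) - 1" unfolding s_def by simp
    then have "\<bar>D 0\<bar> * (49 * (real i)\<^sup>2) \<le> \<bar>D 0\<bar> * (real (s i) - 1)" by (intro mult_left_mono) auto
    then have "\<bar>D 0\<bar> * (49 * (real i)\<^sup>2) \<le> 2 * \<bar>D (s i)\<bar>" using B by linarith
    then show ?thesis using D_nz[of 0] D_nz[of "s i"] i by (simp add: divide_simps mult_ac)
  qed
  have abs_phi: "\<bar>\<phi> k\<bar> = (if k \<in> T then 1 / \<bar>D k\<bar> / W else 0)" for k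
    unfolding \<phi>_def using W_pos by (simp add: abs_mult power_abs)
  have sumT: "(\<Sum>k\<le>m. \<phi> k * h k) = (\<Sum>k\<in>T. \<phi> k * h k)" for h
    by (rule sum.mono_neutral_right) (use Tm in \<open>auto simp: \<phi>_def\<close>)
  show ?thesis
  proof (rule that[of \<phi>])
    have "(-1) ^ r / (W * D 0) = - (1 / (W * (\<Prod>i=1..r. real (s i))))"
      unfolding D0 by (simp add: divide_simps)
    then show "\<phi> 0 \<le> 0" using W_pos pos0 unfolding \<phi>_def by (auto intro!: divide_nonneg_pos mult_pos_pos)
    have "(-1) ^ r / (W * D 1) = 1 / (W * (\<Prod>i=1..r. real (s i) - 1))"
      unfolding D1 by (simp add: divide_simps)
    moreover have "(\<Prod>i=1..r. real (s i) - 1) \<ge> 0" 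
    proof (intro prod_nonneg ballI)
      fix i assume "i \<in> {1..r}"
      then have "2 \<le> s i" using s2 by simp
      then show "0 \<le> real (s i) - 1" by simp
    qed
    ultimately show "0 \<le> \<phi> 1" using W_pos unfolding \<phi>_def by (auto intro!: divide_nonneg_nonneg mult_nonneg_nonneg)
    have "(\<Sum>k\<le>m. \<bar>\<phi> k\<bar>) = (\<Sum>k\<in>T. \<bar>\<phi> k\<bar>)"
      by (rule sum.mono_neutral_right) (use Tm in \<open>auto simp: \<phi>_def\<close>)
    also have "\<dots> = (\<Sum>k\<in>T. 1 / \<bar>D k\<bar> / W)" by (rule sum.cong[OF refl]) (simp add: abs_phi)
    also have "\<dots> = W / W" unfolding sum_divide_distrib[symmetric] W_def ..
    finally show "(\<Sum>k\<le>m. \<bar>\<phi> k\<bar>) = 1" using W_pos by simp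
    have "(\<Sum>k=2..m. \<bar>\<phi> k\<bar>) = (\<Sum>k\<in>s ` {1..r}. \<bar>\<phi> k\<bar>)"
    proof (rule sum.mono_neutral_right)
      show "s ` {1..r} \<subseteq> {2..m}" using Tm s2 unfolding T_def by auto
      show "\<forall>k\<in>{2..m} - s ` {1..r}. \<bar>\<phi> k\<bar> = 0" unfolding \<phi>_def T_def by auto
    qed simp
    also have "\<dots> = (\<Sum>i=1..r. 1 / \<bar>D (s i)\<bar> / W)"
      by (subst sum.reindex[OF inj]) (auto intro!: sum.cong simp: abs_phi T_def)
    also have "\<dots> \<le> (\<Sum>i=1..r. 2 / 49 * (1 / (real i)\<^sup>2) * (1 / \<bar>D 0\<bar>) / W)"
      using Di W_pos by (intro sum_mono divide_right_mono) auto
    also have "\<dots> = 2 / 49 * (1 / \<bar>D 0\<bar> / W) * (\<Sum>i=1..r. 1 / (real i)\<^sup>2)"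
      unfolding sum_distrib_left by (rule sum.cong[OF refl]) (simp add: mult_ac)
    also have "\<dots> \<le> 2 / 49 * (1 / \<bar>D 0\<bar> / W) * 2"
      using W_pos by (intro mult_left_mono sum_inverse_squares_le) auto
    \<comment> \<open>The constant 50 pays off here: the mass beyond weight 1 is at most
      \<open>4 / 49\<close>.\<close>
    also have "\<dots> \<le> 1 / 10"
    proof -
      have "1 / \<bar>D 0\<bar> \<le> W" unfolding W_def using finT by (intro member_le_sum) (auto simp: T_def)
      then have "1 / \<bar>D 0\<bar> / W \<le> 1" unfolding pos_divide_le_eq[OF W_pos] by simp
      then show ?thesis by linarith
    qed
    finally show "(\<Sum>k=2..m. \<bar>\<phi> k\<bar>) \<le> 1 / 10" .
    fix a assume a: "a \<le> r"
    \<comment> \<open>This is \<open>k choose a\<close> as a polynomial in \<open>k\<close>. As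
      \<open>T\<close> has \<open>r + 2\<close> nodes, all degrees up to \<open>r\<close> are
      annihilated.\<close>
    define q where "q = smult (1 / fact a) (\<Prod>i<a. [:- real i, 1:])"
    have "degree q \<le> a"
      unfolding q_def by (rule order_trans[OF degree_smult_le]) (simp add: degree_prod_eq_sum_degree)
    then have dq: "degree q + 1 < card (real ` T)" using a cardT by (simp add: card_image inj_on_def)
    have q: "poly q (real k) = real (k choose a)" for k
      unfolding q_def binomial_gbinomial gbinomial_prod_rev by (simp add: poly_prod atLeast0LessThan)
    have "(\<Sum>t\<in>real ` T. poly q t / (\<Prod>u\<in>real ` T - {t}. t - u)) = 0"
      by (rule divided_difference_eq_0[OF _ dq]) (use finT in simp)
    also have "(\<Sum>t\<in>real ` T. poly q t / (\<Prod>u\<in>real ` T - {t}. t - u)) = (\<Sum>k\<in>T. real (k choose a) / D k)"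
    proof (subst sum.reindex, simp add: inj_on_def, intro sum.cong refl)
      fix k assume "k \<in> T"
      have "real ` T - {real k} = real ` (T - {k})" by auto
      then have "(\<Prod>u\<in>real ` T - {real k}. real k - u) = D k"
        unfolding D_def by (simp add: prod.reindex inj_on_def)
      then show "((\<lambda>t. poly q t / (\<Prod>u\<in>real ` T - {t}. t - u)) \<circ> real) k = real (k choose a) / D k"
        using q by simp
    qed
    finally have "(-1) ^ r / W * (\<Sum>k\<in>T. real (k choose a) / D k) = 0" by simp
    then show "(\<Sum>k\<le>m. \<phi> k * real (k choose a)) = 0"
      unfolding sumT sum_distrib_left by (simp add: \<phi>_def mult_ac)
  qed
qed

section \<open>The selector matrix and unique disjointness\<close>

definition chi :: "'a set \<Rightarrow> 'a set \<Rightarrow> real" where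
  "chi S z = (-1) ^ card (S \<inter> z)"

lemma chi_commute: "chi S z = chi z S"
  unfolding chi_def by (simp add: Int_commute)

lemma chi_eq_prod: "finite S \<Longrightarrow> chi S z = (\<Prod>p\<in>S. if p \<in> z then -1 else 1)"
  unfolding chi_def by (simp add: prod.If_cases)

lemma chi_sym_diff: "finite S \<Longrightarrow> chi S (sym_diff u w) = chi S u * chi S w"
  unfolding chi_eq_prod prod.distrib[symmetric] by (intro prod.cong) auto

lemma abs_chi [simp]: "\<bar>chi S z\<bar> = 1"
  unfolding chi_def by (simp add: power_abs)

lemma chi_empty [simp]: "chi {} z = 1"
  unfolding chi_def by simp

lemma sym_diff_twice: "sym_diff (sym_diff x y) y = x"
  by blast

lemma sum_chi:
  assumes fin: "finite \<Omega>" and A: "A \<subseteq> \<Omega>"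
  shows "(\<Sum>x\<in>Pow \<Omega>. chi A x) = (if A = {} then 2 ^ card \<Omega> else 0)"
proof (cases "A = {}")
  case True then show ?thesis using fin by (simp add: card_Pow)
next
  case False
  then obtain e where e: "e \<in> A" by auto
  have finA: "finite A" using A fin finite_subset by blast
  have "A \<inter> {e} = {e}" using e by auto
  then have "chi A {e} = -1" unfolding chi_def by simp
  then have flip: "chi A (sym_diff x {e}) = - chi A x" for x
    using chi_sym_diff[OF finA, of x "{e}"] by simp
  have "(\<Sum>x\<in>Pow \<Omega>. chi A x) = (\<Sum>x\<in>Pow \<Omega>. chi A (sym_diff x {e}))"
    by (rule sum.reindex_bij_witness[of _ "\<lambda>x. sym_diff x {e}" "\<lambda>x. sym_diff x {e}"])
       (simp_all only: sym_diff_twice, use e A in auto)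
  also have "\<dots> = - (\<Sum>x\<in>Pow \<Omega>. chi A x)" unfolding flip by (rule sum_negf)
  finally show ?thesis using False by simp
qed

lemma sum_chi_chi:
  assumes fin: "finite \<Omega>" and A: "A \<subseteq> \<Omega>" and B: "B \<subseteq> \<Omega>"
  shows "(\<Sum>x\<in>Pow \<Omega>. chi A x * chi B x) = (if A = B then 2 ^ card \<Omega> else 0)"
proof -
  have "(\<Sum>x\<in>Pow \<Omega>. chi A x * chi B x) = (\<Sum>x\<in>Pow \<Omega>. chi (sym_diff A B) x)"
  proof (intro sum.cong refl)
    fix x assume "x \<in> Pow \<Omega>"
    then have "finite x" using fin finite_subset by blast
    then show "chi A x * chi B x = chi (sym_diff A B) x"
      using chi_sym_diff[of x A B] by (simp only: chi_commute[of _ x])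
  qed
  also have "\<dots> = (if sym_diff A B = {} then 2 ^ card \<Omega> else 0)"
    by (rule sum_chi[OF fin]) (use A B in blast)
  also have "sym_diff A B = {} \<longleftrightarrow> A = B" by blast
  finally show ?thesis .
qed

lemma parseval:
  fixes c :: "'a set \<Rightarrow> complex"
  assumes fin: "finite \<Omega>"
  shows "(\<Sum>x\<in>Pow \<Omega>. (cmod (\<Sum>R\<in>Pow \<Omega>. of_real (chi R x) * c R))\<^sup>2) = 2 ^ card \<Omega> * (\<Sum>R\<in>Pow \<Omega>. (cmod (c R))\<^sup>2)"
proof -
  have "complex_of_real (\<Sum>x\<in>Pow \<Omega>. (cmod (\<Sum>R\<in>Pow \<Omega>. of_real (chi R x) * c R))\<^sup>2)
      = (\<Sum>x\<in>Pow \<Omega>. \<Sum>R\<in>Pow \<Omega>. \<Sum>R'\<in>Pow \<Omega>. of_real (chi R x * chi R' x) * (c R * cnj (c R')))"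
    unfolding of_real_sum complex_norm_square cnj_sum sum_product by (simp add: mult_ac)
  also have "\<dots> = (\<Sum>R\<in>Pow \<Omega>. \<Sum>x\<in>Pow \<Omega>. \<Sum>R'\<in>Pow \<Omega>. of_real (chi R x * chi R' x) * (c R * cnj (c R')))"
    by (rule sum.swap)
  also have "\<dots> = (\<Sum>R\<in>Pow \<Omega>. \<Sum>R'\<in>Pow \<Omega>. \<Sum>x\<in>Pow \<Omega>. of_real (chi R x * chi R' x) * (c R * cnj (c R')))"
    by (rule sum.cong[OF refl], rule sum.swap)
  also have "\<dots> = (\<Sum>R\<in>Pow \<Omega>. \<Sum>R'\<in>Pow \<Omega>. of_real (\<Sum>x\<in>Pow \<Omega>. chi R x * chi R' x) * (c R * cnj (c R')))"
    unfolding of_real_sum sum_distrib_right ..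
  also have "\<dots> = (\<Sum>R\<in>Pow \<Omega>. \<Sum>R'\<in>Pow \<Omega>. if R = R' then 2 ^ card \<Omega> * (c R * cnj (c R)) else 0)"
    by (intro sum.cong refl) (simp add: sum_chi_chi[OF fin])
  also have "\<dots> = (\<Sum>R\<in>Pow \<Omega>. 2 ^ card \<Omega> * (c R * cnj (c R)))"
    using fin by simp
  also have "\<dots> = complex_of_real (2 ^ card \<Omega> * (\<Sum>R\<in>Pow \<Omega>. (cmod (c R))\<^sup>2))"
    unfolding of_real_mult of_real_sum complex_norm_square sum_distrib_left by simp
  finally show ?thesis by (simp only: of_real_eq_iff)
qed

lemma fourier_inversion:
  fixes \<psi> :: "'a set \<Rightarrow> real"
  assumes fin: "finite M" and z: "z \<subseteq> M"
  shows "\<psi> z = (\<Sum>S\<in>Pow M. (\<Sum>u\<in>Pow M. \<psi> u * chi S u) / 2 ^ card M * chi S z)"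
proof -
  have "(\<Sum>S\<in>Pow M. (\<Sum>u\<in>Pow M. \<psi> u * chi S u) / 2 ^ card M * chi S z)
      = (\<Sum>S\<in>Pow M. \<Sum>u\<in>Pow M. \<psi> u / 2 ^ card M * (chi u S * chi z S))"
    unfolding sum_divide_distrib sum_distrib_right by (intro sum.cong refl) (simp add: chi_commute mult_ac)
  also have "\<dots> = (\<Sum>u\<in>Pow M. \<Sum>S\<in>Pow M. \<psi> u / 2 ^ card M * (chi u S * chi z S))" by (rule sum.swap)
  also have "\<dots> = (\<Sum>u\<in>Pow M. \<psi> u / 2 ^ card M * (if u = z then 2 ^ card M else 0))"
    unfolding sum_distrib_left[symmetric] using sum_chi_chi[OF fin _ z] by (intro sum.cong refl) auto
  also have "\<dots> = (\<Sum>u\<in>Pow M. if u = z then \<psi> u else 0)" by (intro sum.cong refl) auto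
  also have "\<dots> = \<psi> z" using fin z by simp
  finally show ?thesis by simp
qed

lemma norm_sum_squared_le:
  fixes a :: "'i \<Rightarrow> complex"
  shows "(cmod (\<Sum>i\<in>A. a i))\<^sup>2 \<le> real (card A) * (\<Sum>i\<in>A. (cmod (a i))\<^sup>2)"
proof -
  have "(cmod (\<Sum>i\<in>A. a i))\<^sup>2 \<le> (\<Sum>i\<in>A. 1 * cmod (a i))\<^sup>2"
    by (intro power_mono) (auto intro: norm_sum)
  also have "\<dots> \<le> (\<Sum>i\<in>A. 1\<^sup>2) * (\<Sum>i\<in>A. (cmod (a i))\<^sup>2)" by (rule Cauchy_Schwarz_ineq_sum)
  finally show ?thesis by simp
qed

text \<open>Cauchy-Schwarz in each fibre of \<open>key\<close>. The fibre size stays attached to the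
  single terms because it will be played off against Fourier coefficients that vanish where the
  fibres are large.\<close>

lemma sum_fibre_norm_squared_le:
  fixes a :: "'i \<Rightarrow> complex"
  assumes "finite I" "finite K" "key ` I \<subseteq> K"
  shows "(\<Sum>R\<in>K. (cmod (\<Sum>i\<in>{i\<in>I. key i = R}. a i))\<^sup>2) \<le>
     (\<Sum>i\<in>I. real (card {j\<in>I. key j = key i}) * (cmod (a i))\<^sup>2)"
proof -
  have "(\<Sum>R\<in>K. (cmod (\<Sum>i\<in>{i\<in>I. key i = R}. a i))\<^sup>2)
      \<le> (\<Sum>R\<in>K. real (card {j\<in>I. key j = R}) * (\<Sum>i\<in>{i\<in>I. key i = R}. (cmod (a i))\<^sup>2))"
    by (intro sum_mono norm_sum_squared_le)
  also have "\<dots> = (\<Sum>R\<in>K. \<Sum>i\<in>{i\<in>I. key i = R}. real (card {j\<in>I. key j = key i}) * (cmod (a i))\<^sup>2)"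
    unfolding sum_distrib_left by (intro sum.cong refl) auto
  also have "\<dots> = (\<Sum>i\<in>I. real (card {j\<in>I. key j = key i}) * (cmod (a i))\<^sup>2)"
    by (rule sum.group[OF assms])
  finally show ?thesis .
qed

section \<open>The selector matrix and its norm\<close>

definition select :: "'a set \<Rightarrow> ('a \<times> 'b) set \<Rightarrow> ('a \<Rightarrow> 'b) \<Rightarrow> 'a set" where
  "select M x V = {p\<in>M. (p, V p) \<in> x}"

definition graph_on :: "('a \<Rightarrow> 'b) \<Rightarrow> 'a set \<Rightarrow> ('a \<times> 'b) set" where
  "graph_on V S = (\<lambda>p. (p, V p)) ` S"

text \<open>\<open>select M x V\<close> reads one bit, at position \<open>V p\<close>, from each
  block \<open>p\<close> of \<open>x\<close>. A character of the selected string is therefore a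
  character of \<open>x\<close>, indexed by the graph of \<open>V\<close> over
  \<open>S\<close>.\<close>

lemma chi_select:
  assumes "S \<subseteq> M"
  shows "chi S (select M x V) = chi (graph_on V S) x"
proof -
  have "graph_on V S \<inter> x = (\<lambda>p. (p, V p)) ` (S \<inter> select M x V)"
    using assms unfolding graph_on_def select_def by auto
  then have "card (graph_on V S \<inter> x) = card (S \<inter> select M x V)"
    by (simp add: card_image inj_on_def)
  then show ?thesis unfolding chi_def by simp
qed

text \<open>The graph determines \<open>S\<close> by projection and \<open>V\<close> on
  \<open>S\<close>; only the values of \<open>V\<close> on \<open>M - S\<close> remain free. So a
  character of \<open>x\<close> arises from few selections once \<open>S\<close> is large.\<close>

lemma card_graph_fibre:
  assumes finM: "finite M" and finB: "finite B" and S: "S \<subseteq> M" and V: "V \<in> M \<rightarrow>\<^sub>E B"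
  shows "card {\<pi>\<in>(M \<rightarrow>\<^sub>E B) \<times> Pow M. graph_on (fst \<pi>) (snd \<pi>) = graph_on V S} \<le> card B ^ (card M - card S)"
proof -
  let ?F = "PiE M (\<lambda>p. if p \<in> S then {V p} else B)"
  have finF: "finite ?F" using finM finB by (intro finite_PiE) auto
  have "{\<pi>\<in>(M \<rightarrow>\<^sub>E B) \<times> Pow M. graph_on (fst \<pi>) (snd \<pi>) = graph_on V S} \<subseteq> ?F \<times> {S}"
  proof clarify
    fix V' S' assume a: "V' \<in> M \<rightarrow>\<^sub>E B" "S' \<subseteq> M" "graph_on (fst (V', S')) (snd (V', S')) = graph_on V S"
    then have g: "graph_on V' S' = graph_on V S" by simp
    have "S' = fst ` graph_on V' S'" "S = fst ` graph_on V S" unfolding graph_on_def by (auto simp: image_image)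
    then have SS: "S' = S" using g by simp
    have "V' p = V p" if "p \<in> S" for p
    proof -
      have "(p, V' p) \<in> graph_on V S" using that g SS unfolding graph_on_def by auto
      then show ?thesis unfolding graph_on_def by auto
    qed
    then show "V' \<in> ?F \<and> S' \<in> {S}" using a(1) SS by (auto simp: PiE_iff)
  qed
  then have "card {\<pi>\<in>(M \<rightarrow>\<^sub>E B) \<times> Pow M. graph_on (fst \<pi>) (snd \<pi>) = graph_on V S} \<le> card (?F \<times> {S})"
    by (rule card_mono[rotated]) (use finF in simp)
  also have "\<dots> = (\<Prod>p\<in>M. card (if p \<in> S then {V p} else B))"
    using finM by (simp add: card_cartesian_product card_PiE)
  also have "\<dots> = (\<Prod>p\<in>M. if p \<in> S then 1 else card B)" by (intro prod.cong) auto
  also have "\<dots> = card B ^ card (M - S)"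
    using finM by (simp add: prod.If_cases Diff_eq)
  also have "card (M - S) = card M - card S" using S finM by (simp add: card_Diff_subset finite_subset)
  finally show ?thesis .
qed

text \<open>A bound on the squared spectral norm of the matrix with entries
  \<open>\<psi> (sym_diff (select M x V) w)\<close>. After Fourier expansion of
  \<open>\<psi>\<close>, the coefficient of a character of \<open>x\<close> collects the pairs
  \<open>(V, S)\<close> with the same graph. Orthogonality removes every \<open>S\<close> with fewer
  than \<open>d\<close> elements, so at most \<open>card B ^ card M / card B ^ d\<close> pairs meet;
  this is the gain. Parseval in \<open>x\<close> and again in the mask \<open>w\<close> does the
  rest.\<close>

lemma selector_matrix_bound:
  fixes \<psi> :: "'a set \<Rightarrow> real" and Y :: "('a \<Rightarrow> 'b) \<Rightarrow> 'a set \<Rightarrow> complex"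
  assumes finM: "finite M" and finB: "finite B" and B0: "card B > 0"
    and l1: "(\<Sum>z\<in>Pow M. \<bar>\<psi> z\<bar>) \<le> 1"
    and orth: "\<And>S. S \<subseteq> M \<Longrightarrow> card S < d \<Longrightarrow> (\<Sum>z\<in>Pow M. \<psi> z * chi S z) = 0"
  shows "(\<Sum>x\<in>Pow (M \<times> B). (cmod (\<Sum>V\<in>M \<rightarrow>\<^sub>E B. \<Sum>w\<in>Pow M. of_real (\<psi> (sym_diff (select M x V) w)) * Y V w))\<^sup>2)
    \<le> 2 ^ (card M * card B) / 2 ^ card M * (card B ^ card M / card B ^ d) *
       (\<Sum>V\<in>M \<rightarrow>\<^sub>E B. \<Sum>w\<in>Pow M. (cmod (Y V w))\<^sup>2)"
proof -
  let ?Vs = "M \<rightarrow>\<^sub>E B"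
  let ?I = "?Vs \<times> Pow M"
  let ?b = "real (card B)"
  define hat where "hat = (\<lambda>S. (\<Sum>u\<in>Pow M. \<psi> u * chi S u) / 2 ^ card M)"
  define Yh where "Yh = (\<lambda>V S. \<Sum>w\<in>Pow M. complex_of_real (chi w S) * Y V w)"
  define key where "key = (\<lambda>\<pi>::('a \<Rightarrow> 'b) \<times> 'a set. graph_on (fst \<pi>) (snd \<pi>))"
  define a where "a = (\<lambda>\<pi>::('a \<Rightarrow> 'b) \<times> 'a set. of_real (hat (snd \<pi>)) * Yh (fst \<pi>) (snd \<pi>))"
  have finV: "finite ?Vs" using finM finB by (intro finite_PiE) auto
  have finI: "finite ?I" using finV finM by simp
  have finO: "finite (M \<times> B)" using finM finB by simp
  have keyK: "key ` ?I \<subseteq> Pow (M \<times> B)" unfolding key_def graph_on_def by (auto simp: PiE_iff) 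
  have hat_le: "\<bar>hat S\<bar> \<le> 1 / 2 ^ card M" for S
  proof -
    have "\<bar>\<Sum>u\<in>Pow M. \<psi> u * chi S u\<bar> \<le> (\<Sum>u\<in>Pow M. \<bar>\<psi> u * chi S u\<bar>)" by (rule sum_abs)
    also have "\<dots> \<le> 1" using l1 by (simp add: abs_mult)
    finally show ?thesis unfolding hat_def by (simp add: abs_divide divide_right_mono)
  qed
  have G: "(\<Sum>V\<in>?Vs. \<Sum>w\<in>Pow M. of_real (\<psi> (sym_diff (select M x V) w)) * Y V w)
      = (\<Sum>R\<in>Pow (M \<times> B). of_real (chi R x) * (\<Sum>\<pi>\<in>{\<pi>\<in>?I. key \<pi> = R}. a \<pi>))" for x
  proof -
    have in_V: "(\<Sum>w\<in>Pow M. of_real (\<psi> (sym_diff (select M x V) w)) * Y V w)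
        = (\<Sum>S\<in>Pow M. of_real (chi (graph_on V S) x) * (of_real (hat S) * Yh V S))" for V
    proof -
      have "(\<Sum>w\<in>Pow M. complex_of_real (\<psi> (sym_diff (select M x V) w)) * Y V w)
        = (\<Sum>w\<in>Pow M. \<Sum>S\<in>Pow M. of_real (hat S * (chi (graph_on V S) x * chi w S)) * Y V w)"
      proof (intro sum.cong refl)
        fix w assume w: "w \<in> Pow M"
        have "sym_diff (select M x V) w \<subseteq> M" using w unfolding select_def by auto
        from fourier_inversion[OF finM this, of \<psi>]
        have "\<psi> (sym_diff (select M x V) w) = (\<Sum>S\<in>Pow M. hat S * chi S (sym_diff (select M x V) w))"
          unfolding hat_def .
        also have "\<dots> = (\<Sum>S\<in>Pow M. hat S * (chi (graph_on V S) x * chi w S))"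
        proof (intro sum.cong refl)
          fix S assume "S \<in> Pow M"
          then have "finite S" "S \<subseteq> M" using finM finite_subset by auto
          then show "hat S * chi S (sym_diff (select M x V) w) = hat S * (chi (graph_on V S) x * chi w S)"
            by (simp add: chi_sym_diff chi_select chi_commute[of w])
        qed
        finally show "complex_of_real (\<psi> (sym_diff (select M x V) w)) * Y V w =
            (\<Sum>S\<in>Pow M. of_real (hat S * (chi (graph_on V S) x * chi w S)) * Y V w)"
          by (simp only: of_real_sum sum_distrib_right)
      qed
      also have "\<dots> = (\<Sum>S\<in>Pow M. \<Sum>w\<in>Pow M. of_real (hat S * (chi (graph_on V S) x * chi w S)) * Y V w)"
        by (rule sum.swap)
      also have "\<dots> = (\<Sum>S\<in>Pow M. of_real (chi (graph_on V S) x) * (of_real (hat S) * Yh V S))"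
        unfolding Yh_def sum_distrib_left by (intro sum.cong refl) (simp add: mult_ac)
      finally show ?thesis .
    qed
    have "(\<Sum>V\<in>?Vs. \<Sum>w\<in>Pow M. of_real (\<psi> (sym_diff (select M x V) w)) * Y V w)
        = (\<Sum>\<pi>\<in>?I. of_real (chi (key \<pi>) x) * a \<pi>)"
      unfolding in_V key_def a_def by (simp add: sum.cartesian_product case_prod_unfold)
    also have "\<dots> = (\<Sum>R\<in>Pow (M \<times> B). \<Sum>\<pi>\<in>{\<pi>\<in>?I. key \<pi> = R}. of_real (chi (key \<pi>) x) * a \<pi>)"
      by (rule sum.group[symmetric, OF finI _ keyK]) (use finO in simp)
    also have "\<dots> = (\<Sum>R\<in>Pow (M \<times> B). of_real (chi R x) * (\<Sum>\<pi>\<in>{\<pi>\<in>?I. key \<pi> = R}. a \<pi>))"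
      unfolding sum_distrib_left by (intro sum.cong refl) auto
    finally show ?thesis .
  qed
  have card_le: "real (card {\<pi>'\<in>?I. key \<pi>' = key \<pi>}) * (cmod (a \<pi>))\<^sup>2
      \<le> ?b ^ card M / ?b ^ d * ((1 / 2 ^ card M)\<^sup>2 * (cmod (Yh (fst \<pi>) (snd \<pi>)))\<^sup>2)" if \<pi>: "\<pi> \<in> ?I" for \<pi>
  proof -
    obtain V S where VS: "\<pi> = (V, S)" "V \<in> ?Vs" "S \<subseteq> M" using \<pi> by auto
    have am: "(cmod (a \<pi>))\<^sup>2 = (hat S)\<^sup>2 * (cmod (Yh V S))\<^sup>2"
      unfolding a_def VS by (simp add: norm_mult power_mult_distrib)
    show ?thesis
    proof (cases "card S < d")
      case True
      then have "hat S = 0" unfolding hat_def using orth VS by simp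
      then show ?thesis unfolding am using B0 by (simp add: VS)
    next
      case False
      have Sm: "card S \<le> card M" using VS finM card_mono by blast
      have "real (card {\<pi>'\<in>?I. key \<pi>' = key \<pi>}) \<le> real (card B ^ (card M - card S))"
        using card_graph_fibre[OF finM finB VS(3,2)] unfolding key_def VS by (simp only: of_nat_le_iff fst_conv snd_conv)
      also have "\<dots> = ?b ^ card M / ?b ^ card S"
        unfolding of_nat_power using Sm B0 by (subst power_diff) auto
      also have "\<dots> \<le> ?b ^ card M / ?b ^ d"
        using False B0 by (intro divide_left_mono power_increasing) auto
      finally have 1: "real (card {\<pi>'\<in>?I. key \<pi>' = key \<pi>}) \<le> ?b ^ card M / ?b ^ d" .
      have "(hat S)\<^sup>2 \<le> (1 / 2 ^ card M)\<^sup>2"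
        using hat_le[of S] by (metis abs_ge_zero power2_abs power_mono)
      then have "(cmod (a \<pi>))\<^sup>2 \<le> (1 / 2 ^ card M)\<^sup>2 * (cmod (Yh V S))\<^sup>2"
        unfolding am by (intro mult_right_mono) auto
      then show ?thesis unfolding VS fst_conv snd_conv using 1 B0 VS(1)
        by (intro mult_mono) auto
    qed
  qed
  have "(\<Sum>x\<in>Pow (M \<times> B). (cmod (\<Sum>V\<in>?Vs. \<Sum>w\<in>Pow M. of_real (\<psi> (sym_diff (select M x V) w)) * Y V w))\<^sup>2)
     = 2 ^ card (M \<times> B) * (\<Sum>R\<in>Pow (M \<times> B). (cmod (\<Sum>\<pi>\<in>{\<pi>\<in>?I. key \<pi> = R}. a \<pi>))\<^sup>2)"
    unfolding G by (rule parseval[OF finO])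
  also have "\<dots> \<le> 2 ^ card (M \<times> B) * (\<Sum>\<pi>\<in>?I. real (card {\<pi>'\<in>?I. key \<pi>' = key \<pi>}) * (cmod (a \<pi>))\<^sup>2)"
    by (intro mult_left_mono sum_fibre_norm_squared_le finI keyK) (use finO in auto)
  also have "\<dots> \<le> 2 ^ card (M \<times> B) * (\<Sum>\<pi>\<in>?I. ?b ^ card M / ?b ^ d * ((1 / 2 ^ card M)\<^sup>2 * (cmod (Yh (fst \<pi>) (snd \<pi>)))\<^sup>2))"
    by (intro mult_left_mono sum_mono card_le) auto
  also have "\<dots> = 2 ^ card (M \<times> B) * (?b ^ card M / ?b ^ d * (1 / 2 ^ card M)\<^sup>2) * (\<Sum>V\<in>?Vs. \<Sum>S\<in>Pow M. (cmod (Yh V S))\<^sup>2)"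
    by (simp add: sum_distrib_left sum_divide_distrib sum.cartesian_product case_prod_unfold mult_ac)
  also have "(\<Sum>V\<in>?Vs. \<Sum>S\<in>Pow M. (cmod (Yh V S))\<^sup>2) = (\<Sum>V\<in>?Vs. 2 ^ card M * (\<Sum>w\<in>Pow M. (cmod (Y V w))\<^sup>2))"
    unfolding Yh_def parseval[OF finM] ..
  also have "\<dots> = 2 ^ card M * (\<Sum>V\<in>?Vs. \<Sum>w\<in>Pow M. (cmod (Y V w))\<^sup>2)" by (simp add: sum_distrib_left)
  finally show ?thesis by (simp add: card_cartesian_product power2_eq_square mult_ac)
qed

section \<open>Symmetric functions on the cube\<close>

lemma sum_card_supersets:
  fixes h :: "nat \<Rightarrow> real"
  assumes fin: "finite M" and A: "A \<subseteq> M"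
  shows "(\<Sum>z\<in>{z\<in>Pow M. A \<subseteq> z}. h (card z)) = (\<Sum>k\<in>{card A..card M}. real ((card M - card A) choose (k - card A)) * h k)"
proof -
  have finA: "finite A" using assms finite_subset by auto
  have "(\<Sum>z\<in>{z\<in>Pow M. A \<subseteq> z}. h (card z)) =
      (\<Sum>k\<in>{card A..card M}. \<Sum>z\<in>{z\<in>{z\<in>Pow M. A \<subseteq> z}. card z = k}. h (card z))"
    by (rule sum.group[symmetric]) (use fin in \<open>auto intro!: card_mono dest: finite_subset\<close>)
  also have "\<dots> = (\<Sum>k\<in>{card A..card M}. real ((card M - card A) choose (k - card A)) * h k)"
  proof (rule sum.cong[OF refl])
    fix k assume k: "k \<in> {card A..card M}"
    have "bij_betw (\<lambda>B. B \<union> A) {B. B \<subseteq> M - A \<and> card B = k - card A} {z\<in>{z\<in>Pow M. A \<subseteq> z}. card z = k}"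
    proof (rule bij_betw_byWitness[where f' = "\<lambda>z. z - A"])
      show "(\<lambda>B. B \<union> A) ` {B. B \<subseteq> M - A \<and> card B = k - card A} \<subseteq> {z\<in>{z\<in>Pow M. A \<subseteq> z}. card z = k}"
      proof clarify
        fix B assume B: "B \<subseteq> M - A" "card B = k - card A"
        have "card (B \<union> A) = card B + card A"
          by (rule card_Un_disjoint) (use B fin finA finite_subset[of B M] in auto)
        then show "B \<union> A \<in> {z\<in>Pow M. A \<subseteq> z} \<and> card (B \<union> A) = k" using B A k by auto
      qed
      show "(\<lambda>z. z - A) ` {z\<in>{z\<in>Pow M. A \<subseteq> z}. card z = k} \<subseteq> {B. B \<subseteq> M - A \<and> card B = k - card A}"
        using finA by (auto simp: card_Diff_subset)
    qed auto
    then have "card {z\<in>{z\<in>Pow M. A \<subseteq> z}. card z = k} = card {B. B \<subseteq> M - A \<and> card B = k - card A}"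
      by (rule bij_betw_same_card[symmetric])
    also have "\<dots> = card (M - A) choose (k - card A)" by (rule n_subsets) (use fin in simp)
    also have "card (M - A) = card M - card A" using finA A by (rule card_Diff_subset)
    finally show "(\<Sum>z\<in>{z\<in>{z\<in>Pow M. A \<subseteq> z}. card z = k}. h (card z)) = real ((card M - card A) choose (k - card A)) * h k"
      by simp
  qed
  finally show ?thesis .
qed

text \<open>Spreading \<open>\<phi> k\<close> evenly over the sets of size \<open>k\<close> turns
  orthogonality to \<open>k choose a\<close> into orthogonality to small characters, since a
  character of \<open>S\<close> is a combination of the indicators of \<open>A \<subseteq> z\<close>
  with \<open>A \<subseteq> S\<close>. The induction hence treats sums over the supersets of
  \<open>A\<close> and trades elements of \<open>S\<close> for elements of \<open>A\<close>.\<close>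

lemma symmetric_weights_orthogonal:
  fixes \<phi> :: "nat \<Rightarrow> real"
  assumes fin: "finite M"
    and orth: "\<And>a. a \<le> r \<Longrightarrow> (\<Sum>k\<le>card M. \<phi> k * real (k choose a)) = 0"
    and S: "S \<subseteq> M" "card S \<le> r"
  shows "(\<Sum>z\<in>Pow M. \<phi> (card z) / real (card M choose card z) * chi S z) = 0"
proof -
  have finS: "finite S" using S fin finite_subset by auto
  let ?g = "\<lambda>z. \<phi> (card z) / real (card M choose card z)"
  have "(\<Sum>z\<in>{z\<in>Pow M. A \<subseteq> z}. ?g z * chi S z) = 0"
    if "A \<subseteq> M" "A \<inter> S = {}" "card A + card S \<le> r" for A
    using finS S(1) that
  proof (induction S arbitrary: A rule: finite_induct)
    case empty
    have "(\<Sum>z\<in>{z\<in>Pow M. A \<subseteq> z}. ?g z * chi {} z) =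
        (\<Sum>k\<in>{card A..card M}. real ((card M - card A) choose (k - card A)) * (\<phi> k / real (card M choose k)))"
      using sum_card_supersets[OF fin empty(2), of "\<lambda>k. \<phi> k / real (card M choose k)"] by simp
    also have "\<dots> = (\<Sum>k\<in>{card A..card M}. (\<phi> k * real (k choose card A)) / real (card M choose card A))"
    proof (rule sum.cong[OF refl])
      fix k assume k: "k \<in> {card A..card M}"
      have "real (card M choose k) * real (k choose card A) = real (card M choose card A) * real ((card M - card A) choose (k - card A))"
        using choose_mult[of "card A" k "card M"] k unfolding of_nat_mult[symmetric] by simp
      moreover have "real (card M choose k) \<noteq> 0" "real (card M choose card A) \<noteq> 0" using k by auto
      ultimately show "real ((card M - card A) choose (k - card A)) * (\<phi> k / real (card M choose k)) = (\<phi> k * real (k choose card A)) / real (card M choose card A)"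
        by (simp add: frac_eq_eq mult_ac)
    qed
    also have "\<dots> = (\<Sum>k\<in>{card A..card M}. \<phi> k * real (k choose card A)) / real (card M choose card A)"
      by (rule sum_divide_distrib[symmetric])
    also have "(\<Sum>k\<in>{card A..card M}. \<phi> k * real (k choose card A)) = (\<Sum>k\<le>card M. \<phi> k * real (k choose card A))"
      by (rule sum.mono_neutral_left) (auto simp: not_le)
    finally show ?case using orth[of "card A"] empty by simp
  next
    case (insert e S)
    have eM: "e \<in> M" "e \<notin> A" using insert.prems by auto
    have fA: "finite A" using insert.prems fin finite_subset by auto
    have chi_ins: "chi (insert e S) z = chi S z - 2 * (if e \<in> z then chi S z else 0)" for z
      using insert.hyps by (simp add: chi_eq_prod)
    have "(\<Sum>z\<in>{z\<in>Pow M. A \<subseteq> z}. ?g z * chi (insert e S) z) =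
        (\<Sum>z\<in>{z\<in>Pow M. A \<subseteq> z}. ?g z * chi S z) - 2 * (\<Sum>z\<in>{z\<in>Pow M. A \<subseteq> z}. if e \<in> z then ?g z * chi S z else 0)"
      unfolding sum_distrib_left sum_subtractf[symmetric] by (rule sum.cong[OF refl]) (simp add: chi_ins algebra_simps)
    also have "(\<Sum>z\<in>{z\<in>Pow M. A \<subseteq> z}. ?g z * chi S z) = 0"
      by (rule insert.IH) (use insert in auto)
    also have "(\<Sum>z\<in>{z\<in>Pow M. A \<subseteq> z}. if e \<in> z then ?g z * chi S z else 0)
        = (\<Sum>z\<in>{z\<in>Pow M. insert e A \<subseteq> z}. ?g z * chi S z)"
      by (rule sum.mono_neutral_cong_right) (use fin in auto)
    also have "\<dots> = 0"
      by (rule insert.IH) (use insert eM fA in auto)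
    finally show ?case by simp
  qed
  from this[of "{}"] S(2) have "(\<Sum>z\<in>{z\<in>Pow M. {} \<subseteq> z}. ?g z * chi S z) = 0" by simp
  moreover have "{z\<in>Pow M. {} \<subseteq> z} = Pow M" by auto
  ultimately show ?thesis by (simp only:)
qed

lemma sum_card_symmetric:
  fixes h :: "nat \<Rightarrow> real"
  assumes fin: "finite M"
  shows "(\<Sum>z\<in>Pow M. h (card z) / real (card M choose card z)) = (\<Sum>k\<le>card M. h k)"
proof -
  have "{z\<in>Pow M. {} \<subseteq> z} = Pow M" by auto
  then have "(\<Sum>z\<in>Pow M. h (card z) / real (card M choose card z)) = (\<Sum>k\<in>{0..card M}. real (card M choose k) * (h k / real (card M choose k)))"
    using sum_card_supersets[OF fin, of "{}" "\<lambda>k. h k / real (card M choose k)"]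
    by (simp only: empty_subsetI card.empty diff_zero)
  also have "\<dots> = (\<Sum>k\<le>card M. h k)"
    by (rule sum.cong) auto
  finally show ?thesis .
qed

text \<open>The acceptance probabilities are correlated with \<open>\<psi>\<close>: from below
  because \<open>\<psi>\<close> is concentrated on weights 0 and 1 with the right signs, from above
  by the matrix norm, once for each of the \<open>card K\<close> inner products. The block size is a
  square because the norm contains the square root of \<open>card B\<close>.\<close>

theorem unique_disjointness_bound:
  fixes P :: "('a \<times> 'b) set \<Rightarrow> ('a \<Rightarrow> 'b) \<Rightarrow> 'a set \<Rightarrow> real"
    and X :: "'s \<Rightarrow> 'j \<Rightarrow> ('a \<times> 'b) set \<Rightarrow> complex" and Y :: "'s \<Rightarrow> 'j \<Rightarrow> ('a \<Rightarrow> 'b) \<Rightarrow> 'a set \<Rightarrow> complex"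
  assumes finM: "finite M" and finB: "finite B" and B: "card B = \<beta>\<^sup>2" "\<beta> > 0"
    and r: "50 * r\<^sup>2 \<le> card M" "1 \<le> card M"
    and P: "\<And>x V w. x \<subseteq> M \<times> B \<Longrightarrow> V \<in> M \<rightarrow>\<^sub>E B \<Longrightarrow> w \<subseteq> M \<Longrightarrow>
        of_real (P x V w) = (\<Sum>s\<in>K. \<Sum>j\<in>J. X s j x * Y s j V w)"
    and X: "\<And>s x. s \<in> K \<Longrightarrow> x \<subseteq> M \<times> B \<Longrightarrow> (\<Sum>j\<in>J. (cmod (X s j x))\<^sup>2) \<le> 1"
    and Y: "\<And>s V w. s \<in> K \<Longrightarrow> V \<in> M \<rightarrow>\<^sub>E B \<Longrightarrow> w \<subseteq> M \<Longrightarrow> (\<Sum>j\<in>J. (cmod (Y s j V w))\<^sup>2) \<le> 1"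
    and bounds: "\<And>x V w. x \<subseteq> M \<times> B \<Longrightarrow> V \<in> M \<rightarrow>\<^sub>E B \<Longrightarrow> w \<subseteq> M \<Longrightarrow> 0 \<le> P x V w \<and> P x V w \<le> 1"
    and zero: "\<And>x V w. x \<subseteq> M \<times> B \<Longrightarrow> V \<in> M \<rightarrow>\<^sub>E B \<Longrightarrow> w \<subseteq> M \<Longrightarrow>
        sym_diff (select M x V) w = {} \<Longrightarrow> P x V w \<le> 1 / 3"
    and one: "\<And>x V w. x \<subseteq> M \<times> B \<Longrightarrow> V \<in> M \<rightarrow>\<^sub>E B \<Longrightarrow> w \<subseteq> M \<Longrightarrow>
        card (sym_diff (select M x V) w) = 1 \<Longrightarrow> P x V w \<ge> 2 / 3"
  shows "real \<beta> ^ (r + 1) / 10 \<le> real (card K)"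
proof -
  let ?m = "card M"
  let ?Vs = "M \<rightarrow>\<^sub>E B"
  obtain \<phi> :: "nat \<Rightarrow> real" where phi: "\<phi> 0 \<le> 0" "0 \<le> \<phi> 1" "(\<Sum>k\<le>?m. \<bar>\<phi> k\<bar>) = 1"
    "(\<Sum>k=2..?m. \<bar>\<phi> k\<bar>) \<le> 1 / 10"
    "\<And>a. a \<le> r \<Longrightarrow> (\<Sum>k\<le>?m. \<phi> k * real (k choose a)) = 0"
    by (rule or_dual_weights[OF r]) blast
  define \<psi> where "\<psi> = (\<lambda>z::'a set. \<phi> (card z) / real (?m choose card z))"
  have l1: "(\<Sum>z\<in>Pow M. \<bar>\<psi> z\<bar>) \<le> 1"
    using sum_card_symmetric[OF finM, of "\<lambda>k. \<bar>\<phi> k\<bar>"] phi(3) unfolding \<psi>_def by (simp add: abs_divide)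
  have orth: "(\<Sum>z\<in>Pow M. \<psi> z * chi S z) = 0" if "S \<subseteq> M" "card S < r + 1" for S
    unfolding \<psi>_def by (rule symmetric_weights_orthogonal[OF finM phi(5)]) (use that in auto)
  have cardV: "card ?Vs = card B ^ ?m" using finM by (simp add: card_PiE)
  have finV: "finite ?Vs" using finM finB by (intro finite_PiE) auto
  have finMB: "finite (M \<times> B)" using finM finB by simp
  define b where "b = real \<beta>"
  have b: "b > 0" "real (card B) = b\<^sup>2" unfolding b_def using B by auto
  define N where "N = (2::real) ^ (?m * card B)"
  have N: "N > 0" "real (card (Pow (M \<times> B))) = N"
    unfolding N_def using finMB by (simp_all add: card_Pow card_cartesian_product)
  define q where "q = (2::real) ^ ?m"
  have q: "q > 0" "real (card (Pow M)) = q"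
    unfolding q_def using finM by (simp_all add: card_Pow)
  define bm where "bm = (b\<^sup>2) ^ ?m"
  have bm: "bm > 0" "real (card ?Vs) = bm" unfolding bm_def cardV using b by simp_all
  define d where "d = r + 1"
  define L where "L = N * bm / b ^ d"
  have L: "L > 0" unfolding L_def using N bm b by simp
  define corr where "corr = (\<Sum>x\<in>Pow (M \<times> B). \<Sum>V\<in>?Vs. \<Sum>w\<in>Pow M. \<psi> (sym_diff (select M x V) w) * P x V w)"
  \<comment> \<open>\<open>h\<close> is the advantage over the constant 1/2, which is free because
    \<open>\<psi>\<close> sums to 0: at least 1/6 on weights 0 and 1, and a loss of at most 1/2
    elsewhere. With at most 1/10 of the mass elsewhere, the total is at least
    \<open>1/6 - 2/3 * 1/10 = 1/10\<close>.\<close>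
  define h where "h = (\<lambda>k::nat. if k \<le> 1 then 1/6 else - (1/2) :: real)"
  have "(\<Sum>w\<in>Pow M. \<psi> (sym_diff (select M x V) w) * P x V w) \<ge> 1 / 10"
    if x: "x \<in> Pow (M \<times> B)" and V: "V \<in> ?Vs" for x V
  proof -
    let ?z = "\<lambda>w. sym_diff (select M x V) w"
    have selM: "select M x V \<subseteq> M" unfolding select_def by auto
    have ps: "\<psi> (?z w) * P x V w \<ge> \<psi> (?z w) / 2 + \<bar>\<psi> (?z w)\<bar> * h (card (?z w))" if w: "w \<in> Pow M" for w
    proof -
      have fz: "finite (?z w)" using selM w finM by (meson finite_Diff finite_UnI finite_subset PowD)
      have bd: "0 \<le> P x V w" "P x V w \<le> 1" using bounds x V w by auto
      consider "card (?z w) = 0" | "card (?z w) = 1" | "card (?z w) \<ge> 2" by linarith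
      then show ?thesis
      proof cases
        case 1
        then have "?z w = {}" using fz by (meson card_0_eq)
        then have "P x V w \<le> 1 / 3" by (rule zero[rotated -1]) (use x V w in auto)
        moreover have "\<psi> (?z w) \<le> 0" unfolding \<psi>_def 1 using phi(1) by simp
        moreover have "\<psi> (?z w) * P x V w \<ge> \<psi> (?z w) * (1/3)"
          using calculation by (intro mult_left_mono_neg) auto
        ultimately show ?thesis unfolding h_def 1 by simp
      next
        case 2
        then have "P x V w \<ge> 2 / 3" by (rule one[rotated -1]) (use x V w in auto)
        moreover have "\<psi> (?z w) \<ge> 0" unfolding \<psi>_def 2 using phi(2) by simp
        moreover have "\<psi> (?z w) * P x V w \<ge> \<psi> (?z w) * (2/3)"
          using calculation by (intro mult_left_mono) auto
        ultimately show ?thesis unfolding h_def 2 by simp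
      next
        case 3
        have "\<bar>\<psi> (?z w) * (P x V w - 1/2)\<bar> \<le> \<bar>\<psi> (?z w)\<bar> * (1/2)"
          unfolding abs_mult using bd by (intro mult_left_mono) (linarith, rule abs_ge_zero)
        then have "\<psi> (?z w) * P x V w - \<psi> (?z w) / 2 \<ge> - (\<bar>\<psi> (?z w)\<bar> * (1/2))"
          unfolding right_diff_distrib by linarith
        then show ?thesis using 3 unfolding h_def by simp
      qed
    qed
    have "(\<Sum>w\<in>Pow M. \<psi> (?z w) / 2 + \<bar>\<psi> (?z w)\<bar> * h (card (?z w))) = (\<Sum>z\<in>Pow M. \<psi> z / 2 + \<bar>\<psi> z\<bar> * h (card z))"
    proof (rule sum.reindex_bij_witness[of _ "?z" "?z"])
      fix w assume "w \<in> Pow M"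
      show "?z (?z w) = w" "?z (?z w) = w" by blast+
      show "?z w \<in> Pow M" "?z w \<in> Pow M" using \<open>w \<in> Pow M\<close> selM by blast+
    qed simp
    also have "\<dots> = (\<Sum>z\<in>Pow M. \<psi> z * chi {} z) / 2 + (\<Sum>z\<in>Pow M. \<bar>\<psi> z\<bar> * h (card z))"
      by (simp add: sum.distrib sum_divide_distrib)
    also have "(\<Sum>z\<in>Pow M. \<psi> z * chi {} z) = 0" by (rule orth) auto
    also have "(\<Sum>z\<in>Pow M. \<bar>\<psi> z\<bar> * h (card z)) = (\<Sum>k\<le>?m. \<bar>\<phi> k\<bar> * h k)"
      using sum_card_symmetric[OF finM, of "\<lambda>k. \<bar>\<phi> k\<bar> * h k"] unfolding \<psi>_def by (simp add: abs_divide)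
    also have "\<dots> = (\<Sum>k\<le>?m. \<bar>\<phi> k\<bar> * (1/6) - (if k \<in> {2..?m} then \<bar>\<phi> k\<bar> * (2/3) else 0))"
      by (rule sum.cong[OF refl]) (auto simp: h_def)
    also have "\<dots> = (\<Sum>k\<le>?m. \<bar>\<phi> k\<bar>) * (1/6) - (\<Sum>k=2..?m. \<bar>\<phi> k\<bar>) * (2/3)"
    proof -
      have "(\<Sum>k\<le>?m. if k \<in> {2..?m} then \<bar>\<phi> k\<bar> * (2/3) else 0) = (\<Sum>k=2..?m. \<bar>\<phi> k\<bar> * (2/3))"
        by (rule sum.mono_neutral_cong_right) auto
      then show ?thesis by (simp only: sum_subtractf sum_distrib_right)
    qed
    finally have "(\<Sum>w\<in>Pow M. \<psi> (?z w) / 2 + \<bar>\<psi> (?z w)\<bar> * h (card (?z w))) \<ge> 1 / 10" using phi(3,4) by simp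
    also have "(\<Sum>w\<in>Pow M. \<psi> (?z w) / 2 + \<bar>\<psi> (?z w)\<bar> * h (card (?z w))) \<le> (\<Sum>w\<in>Pow M. \<psi> (?z w) * P x V w)"
      by (rule sum_mono[OF ps])
    finally show ?thesis .
  qed
  then have "(\<Sum>x\<in>Pow (M \<times> B). \<Sum>V\<in>?Vs. 1 / 10) \<le> corr" unfolding corr_def by (intro sum_mono)
  then have lower: "N * bm / 10 \<le> corr" using N bm by simp
  \<comment> \<open>The inequality of arithmetic and geometric means replaces Cauchy-Schwarz,
    because its right-hand side is additive and can be summed over the coordinates \<open>j\<close>.
    The weight \<open>\<alpha>\<close> balances the two terms: each is at most \<open>L / 2\<close>
    for families of vectors of norm at most 1.\<close>
  have scalar: "cmod (\<Sum>x\<in>Pow (M \<times> B). X' x * (\<Sum>V\<in>?Vs. \<Sum>w\<in>Pow M. of_real (\<psi> (sym_diff (select M x V) w)) * Y' V w))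
      \<le> L / 2 * ((\<Sum>x\<in>Pow (M \<times> B). (cmod (X' x))\<^sup>2) / N + (\<Sum>V\<in>?Vs. \<Sum>w\<in>Pow M. (cmod (Y' V w))\<^sup>2) / (bm * q))"
    for X' :: "('a \<times> 'b) set \<Rightarrow> complex" and Y' :: "('a \<Rightarrow> 'b) \<Rightarrow> 'a set \<Rightarrow> complex"
  proof -
    define G where "G = (\<lambda>x. \<Sum>V\<in>?Vs. \<Sum>w\<in>Pow M. complex_of_real (\<psi> (sym_diff (select M x V) w)) * Y' V w)"
    define \<alpha> where "\<alpha> = bm / b ^ d"
    have \<alpha>: "\<alpha> > 0" unfolding \<alpha>_def using bm b by simp
    define sY where "sY = (\<Sum>V\<in>?Vs. \<Sum>w\<in>Pow M. (cmod (Y' V w))\<^sup>2)"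
    have "(\<Sum>x\<in>Pow (M \<times> B). (cmod (G x))\<^sup>2) \<le> 2 ^ (?m * card B) / 2 ^ ?m * (real (card B) ^ ?m / real (card B) ^ d) * sY"
      using selector_matrix_bound[where Y = Y' and d = "r + 1", OF finM finB _ l1 orth] B
      unfolding G_def sY_def d_def by (simp add: zero_less_power)
    also have "\<dots> = N / q * (bm / (b ^ d * b ^ d)) * sY"
      unfolding N_def q_def bm_def b(2) by (simp add: power_mult_distrib power2_eq_square)
    finally have G2: "(\<Sum>x\<in>Pow (M \<times> B). (cmod (G x))\<^sup>2) \<le> N / q * (bm / (b ^ d * b ^ d)) * sY" .
    have "cmod (\<Sum>x\<in>Pow (M \<times> B). X' x * G x) \<le> (\<Sum>x\<in>Pow (M \<times> B). (\<alpha> * (cmod (X' x))\<^sup>2 + (cmod (G x))\<^sup>2 / \<alpha>) / 2)"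
    proof (rule order_trans[OF norm_sum], rule sum_mono)
      fix x
      have "0 \<le> (sqrt \<alpha> * cmod (X' x) - cmod (G x) / sqrt \<alpha>)\<^sup>2" by simp
      also have "\<dots> = \<alpha> * (cmod (X' x))\<^sup>2 + (cmod (G x))\<^sup>2 / \<alpha> - 2 * (cmod (X' x) * cmod (G x))"
        using \<alpha> by (simp add: power2_diff power_mult_distrib power_divide)
      finally show "cmod (X' x * G x) \<le> (\<alpha> * (cmod (X' x))\<^sup>2 + (cmod (G x))\<^sup>2 / \<alpha>) / 2"
        by (simp add: norm_mult)
    qed
    also have "\<dots> = (\<alpha> * (\<Sum>x\<in>Pow (M \<times> B). (cmod (X' x))\<^sup>2) + (\<Sum>x\<in>Pow (M \<times> B). (cmod (G x))\<^sup>2) / \<alpha>) / 2"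
      by (simp only: sum_distrib_left sum_divide_distrib sum.distrib[symmetric])
    also have "\<dots> \<le> (\<alpha> * (\<Sum>x\<in>Pow (M \<times> B). (cmod (X' x))\<^sup>2) + N / q * (bm / (b ^ d * b ^ d)) * sY / \<alpha>) / 2"
      using G2 \<alpha> by (intro divide_right_mono add_left_mono) auto
    also have "\<alpha> * (\<Sum>x\<in>Pow (M \<times> B). (cmod (X' x))\<^sup>2) = L * ((\<Sum>x\<in>Pow (M \<times> B). (cmod (X' x))\<^sup>2) / N)"
      unfolding L_def \<alpha>_def using N by simp
    also have "N / q * (bm / (b ^ d * b ^ d)) * sY / \<alpha> = L * (sY / (bm * q))"
      unfolding L_def \<alpha>_def using N q bm b by simp
    finally show ?thesis unfolding G_def sY_def by (simp add: distrib_left)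
  qed
  have "complex_of_real corr = (\<Sum>s\<in>K. \<Sum>j\<in>J. \<Sum>x\<in>Pow (M \<times> B). X s j x * (\<Sum>V\<in>?Vs. \<Sum>w\<in>Pow M. of_real (\<psi> (sym_diff (select M x V) w)) * Y s j V w))"
  proof -
    have "complex_of_real corr = (\<Sum>x\<in>Pow (M \<times> B). \<Sum>V\<in>?Vs. \<Sum>w\<in>Pow M. \<Sum>s\<in>K. \<Sum>j\<in>J. X s j x * (of_real (\<psi> (sym_diff (select M x V) w)) * Y s j V w))"
      unfolding corr_def of_real_sum of_real_mult
    proof (intro sum.cong[OF refl])
      fix x V w assume "x \<in> Pow (M \<times> B)" "V \<in> ?Vs" "w \<in> Pow M"
      then have eq: "complex_of_real (P x V w) = (\<Sum>s\<in>K. \<Sum>j\<in>J. X s j x * Y s j V w)" using P by auto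
      then show "complex_of_real (\<psi> (sym_diff (select M x V) w)) * of_real (P x V w) =
          (\<Sum>s\<in>K. \<Sum>j\<in>J. X s j x * (of_real (\<psi> (sym_diff (select M x V) w)) * Y s j V w))"
        unfolding eq sum_distrib_left by (simp only: mult_ac)
    qed
    also have "\<dots> = (\<Sum>x\<in>Pow (M \<times> B). \<Sum>V\<in>?Vs. \<Sum>s\<in>K. \<Sum>w\<in>Pow M. \<Sum>j\<in>J. X s j x * (of_real (\<psi> (sym_diff (select M x V) w)) * Y s j V w))"
      by (intro sum.cong[OF refl], rule sum.swap)
    also have "\<dots> = (\<Sum>x\<in>Pow (M \<times> B). \<Sum>V\<in>?Vs. \<Sum>s\<in>K. \<Sum>j\<in>J. \<Sum>w\<in>Pow M. X s j x * (of_real (\<psi> (sym_diff (select M x V) w)) * Y s j V w))"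
      by (intro sum.cong[OF refl], rule sum.swap)
    also have "\<dots> = (\<Sum>x\<in>Pow (M \<times> B). \<Sum>s\<in>K. \<Sum>V\<in>?Vs. \<Sum>j\<in>J. \<Sum>w\<in>Pow M. X s j x * (of_real (\<psi> (sym_diff (select M x V) w)) * Y s j V w))"
      by (intro sum.cong[OF refl], rule sum.swap)
    also have "\<dots> = (\<Sum>x\<in>Pow (M \<times> B). \<Sum>s\<in>K. \<Sum>j\<in>J. \<Sum>V\<in>?Vs. \<Sum>w\<in>Pow M. X s j x * (of_real (\<psi> (sym_diff (select M x V) w)) * Y s j V w))"
      by (intro sum.cong[OF refl], rule sum.swap)
    also have "\<dots> = (\<Sum>s\<in>K. \<Sum>x\<in>Pow (M \<times> B). \<Sum>j\<in>J. \<Sum>V\<in>?Vs. \<Sum>w\<in>Pow M. X s j x * (of_real (\<psi> (sym_diff (select M x V) w)) * Y s j V w))"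
      by (rule sum.swap)
    also have "\<dots> = (\<Sum>s\<in>K. \<Sum>j\<in>J. \<Sum>x\<in>Pow (M \<times> B). \<Sum>V\<in>?Vs. \<Sum>w\<in>Pow M. X s j x * (of_real (\<psi> (sym_diff (select M x V) w)) * Y s j V w))"
      by (intro sum.cong[OF refl], rule sum.swap)
    finally show ?thesis by (simp only: sum_distrib_left)
  qed
  then have "\<bar>corr\<bar> = cmod (\<Sum>s\<in>K. \<Sum>j\<in>J. \<Sum>x\<in>Pow (M \<times> B). X s j x * (\<Sum>V\<in>?Vs. \<Sum>w\<in>Pow M. of_real (\<psi> (sym_diff (select M x V) w)) * Y s j V w))"
    by (metis norm_of_real)
  also have "\<dots> \<le> (\<Sum>s\<in>K. \<Sum>j\<in>J. L / 2 * ((\<Sum>x\<in>Pow (M \<times> B). (cmod (X s j x))\<^sup>2) / N + (\<Sum>V\<in>?Vs. \<Sum>w\<in>Pow M. (cmod (Y s j V w))\<^sup>2) / (bm * q)))"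
    by (intro order_trans[OF norm_sum] sum_mono scalar)
  also have "\<dots> \<le> (\<Sum>s\<in>K. L)"
  proof (rule sum_mono)
    fix s assume s: "s \<in> K"
    have "(\<Sum>j\<in>J. \<Sum>x\<in>Pow (M \<times> B). (cmod (X s j x))\<^sup>2) = (\<Sum>x\<in>Pow (M \<times> B). \<Sum>j\<in>J. (cmod (X s j x))\<^sup>2)"
      by (rule sum.swap)
    also have "\<dots> \<le> (\<Sum>x\<in>Pow (M \<times> B). 1)" by (rule sum_mono) (use X[OF s] in auto)
    finally have x1: "(\<Sum>j\<in>J. \<Sum>x\<in>Pow (M \<times> B). (cmod (X s j x))\<^sup>2) \<le> N" using N by simp
    have "(\<Sum>j\<in>J. \<Sum>V\<in>?Vs. \<Sum>w\<in>Pow M. (cmod (Y s j V w))\<^sup>2) = (\<Sum>V\<in>?Vs. \<Sum>j\<in>J. \<Sum>w\<in>Pow M. (cmod (Y s j V w))\<^sup>2)"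
      by (rule sum.swap)
    also have "\<dots> = (\<Sum>V\<in>?Vs. \<Sum>w\<in>Pow M. \<Sum>j\<in>J. (cmod (Y s j V w))\<^sup>2)"
      by (rule sum.cong[OF refl], rule sum.swap)
    also have "\<dots> \<le> (\<Sum>V\<in>?Vs. \<Sum>w\<in>Pow M. 1)" by (intro sum_mono) (use Y[OF s] in auto)
    finally have y1: "(\<Sum>j\<in>J. \<Sum>V\<in>?Vs. \<Sum>w\<in>Pow M. (cmod (Y s j V w))\<^sup>2) \<le> bm * q" using bm q by simp
    have "(\<Sum>j\<in>J. L / 2 * ((\<Sum>x\<in>Pow (M \<times> B). (cmod (X s j x))\<^sup>2) / N + (\<Sum>V\<in>?Vs. \<Sum>w\<in>Pow M. (cmod (Y s j V w))\<^sup>2) / (bm * q)))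
      = L / 2 * ((\<Sum>j\<in>J. \<Sum>x\<in>Pow (M \<times> B). (cmod (X s j x))\<^sup>2) / N + (\<Sum>j\<in>J. \<Sum>V\<in>?Vs. \<Sum>w\<in>Pow M. (cmod (Y s j V w))\<^sup>2) / (bm * q))"
      by (simp only: sum_distrib_left[symmetric] sum.distrib sum_divide_distrib[symmetric])
    also have "\<dots> \<le> L / 2 * (1 + 1)"
      using x1 y1 N bm q L by (intro mult_left_mono add_mono) auto
    finally show "(\<Sum>j\<in>J. L / 2 * ((\<Sum>x\<in>Pow (M \<times> B). (cmod (X s j x))\<^sup>2) / N + (\<Sum>V\<in>?Vs. \<Sum>w\<in>Pow M. (cmod (Y s j V w))\<^sup>2) / (bm * q))) \<le> L"
      by simp
  qed
  finally have "corr \<le> real (card K) * L" by simp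
  then have "N * bm / 10 \<le> real (card K) * (N * bm / b ^ d)" using lower unfolding L_def by linarith
  then have "(N * bm) * (b ^ d / 10) \<le> (N * bm) * real (card K)" using b by (simp add: field_simps)
  then have "b ^ d / 10 \<le> real (card K)" using N bm by (simp only: mult_le_cancel_left_pos mult_pos_pos)
  then show ?thesis unfolding b_def d_def by simp
qed

section \<open>Quantum protocols as sums of contractions\<close>

text \<open>Operator norm at most 1, and an isometry if \<open>e\<close> holds, expressed by the
  action on vectors since the matrices are rectangular. The flag serves protocols without
  communication, where an isometry of one party is invisible to the other.\<close>

definition norm_bounded :: "bool \<Rightarrow> 'i set \<Rightarrow> 'j set \<Rightarrow> ('i \<Rightarrow> 'j \<Rightarrow> complex) \<Rightarrow> bool" where
  "norm_bounded e I J A \<longleftrightarrow> (\<forall>f. (\<Sum>i\<in>I. (cmod (\<Sum>j\<in>J. A i j * f j))\<^sup>2) \<le> (\<Sum>j\<in>J. (cmod (f j))\<^sup>2) \<and>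
     (e \<longrightarrow> (\<Sum>i\<in>I. (cmod (\<Sum>j\<in>J. A i j * f j))\<^sup>2) = (\<Sum>j\<in>J. (cmod (f j))\<^sup>2)))"

lemma norm_boundedD:
  "norm_bounded e I J A \<Longrightarrow> (\<Sum>i\<in>I. (cmod (\<Sum>j\<in>J. A i j * f j))\<^sup>2) \<le> (\<Sum>j\<in>J. (cmod (f j))\<^sup>2)"
  "norm_bounded True I J A \<Longrightarrow> (\<Sum>i\<in>I. (cmod (\<Sum>j\<in>J. A i j * f j))\<^sup>2) = (\<Sum>j\<in>J. (cmod (f j))\<^sup>2)"
  unfolding norm_bounded_def by blast+

lemma norm_bounded_weaken: "norm_bounded e I J A \<Longrightarrow> (e' \<Longrightarrow> e) \<Longrightarrow> norm_bounded e' I J A"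
  unfolding norm_bounded_def by blast

lemma norm_bounded_rows:
  assumes "norm_bounded e I J A" "I' \<subseteq> I" "finite I"
  shows "norm_bounded False I' J A"
  unfolding norm_bounded_def
proof (intro allI conjI)
  fix f
  have "(\<Sum>i\<in>I'. (cmod (\<Sum>j\<in>J. A i j * f j))\<^sup>2) \<le> (\<Sum>i\<in>I. (cmod (\<Sum>j\<in>J. A i j * f j))\<^sup>2)"
    using assms by (intro sum_mono2) auto
  also have "\<dots> \<le> (\<Sum>j\<in>J. (cmod (f j))\<^sup>2)" by (rule norm_boundedD(1)[OF assms(1)])
  finally show "(\<Sum>i\<in>I'. (cmod (\<Sum>j\<in>J. A i j * f j))\<^sup>2) \<le> (\<Sum>j\<in>J. (cmod (f j))\<^sup>2)" .
qed auto

lemma norm_bounded_comp: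
  assumes A: "norm_bounded e I J A" and B: "norm_bounded e J L B"
  shows "norm_bounded e I L (\<lambda>i l. \<Sum>j\<in>J. A i j * B j l)"
proof -
  have eq: "(\<Sum>l\<in>L. (\<Sum>j\<in>J. A i j * B j l) * f l) = (\<Sum>j\<in>J. A i j * (\<Sum>l\<in>L. B j l * f l))" for i f
    unfolding sum_distrib_left sum_distrib_right by (subst sum.swap) (simp only: mult.assoc)
  show ?thesis unfolding norm_bounded_def eq
  proof (intro allI conjI impI)
    fix f
    show "(\<Sum>i\<in>I. (cmod (\<Sum>j\<in>J. A i j * (\<Sum>l\<in>L. B j l * f l)))\<^sup>2) \<le> (\<Sum>l\<in>L. (cmod (f l))\<^sup>2)"
      by (rule order_trans[OF norm_boundedD(1)[OF A] norm_boundedD(1)[OF B]])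
    assume e
    then have A': "norm_bounded True I J A" and B': "norm_bounded True J L B" using A B by simp_all
    show "(\<Sum>i\<in>I. (cmod (\<Sum>j\<in>J. A i j * (\<Sum>l\<in>L. B j l * f l)))\<^sup>2) = (\<Sum>l\<in>L. (cmod (f l))\<^sup>2)"
      by (simp only: norm_boundedD(2)[OF A'] norm_boundedD(2)[OF B'])
  qed
qed

lemma norm_bounded_cnj:
  assumes "norm_bounded e I J A"
  shows "norm_bounded e I J (\<lambda>i j. cnj (A i j))"
proof -
  have "cmod (\<Sum>j\<in>J. cnj (A i j) * f j) = cmod (\<Sum>j\<in>J. A i j * cnj (f j))" for i f
    using complex_mod_cnj[of "\<Sum>j\<in>J. A i j * cnj (f j)"] by simp
  note eq = this
  show ?thesis unfolding norm_bounded_def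
  proof
    fix f
    show "(\<Sum>i\<in>I. (cmod (\<Sum>j\<in>J. cnj (A i j) * f j))\<^sup>2) \<le> (\<Sum>j\<in>J. (cmod (f j))\<^sup>2) \<and>
     (e \<longrightarrow> (\<Sum>i\<in>I. (cmod (\<Sum>j\<in>J. cnj (A i j) * f j))\<^sup>2) = (\<Sum>j\<in>J. (cmod (f j))\<^sup>2))"
      using spec[OF assms[unfolded norm_bounded_def], of "\<lambda>j. cnj (f j)"] unfolding eq by simp
  qed
qed

text \<open>If \<open>u\<close> is the image of \<open>f\<close>, its squared norm \<open>U\<close>
  is a pairing of \<open>f\<close> with the image of \<open>cnj u\<close> under \<open>A\<close>, so
  Cauchy-Schwarz gives \<open>U\<^sup>2 \<le> F * U\<close>.\<close>

lemma norm_bounded_transpose: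
  assumes A: "norm_bounded e I J A" and fin: "finite I" "finite J"
  shows "norm_bounded False J I (\<lambda>j i. A i j)"
  unfolding norm_bounded_def
proof (intro allI conjI)
  fix f
  define u where "u = (\<lambda>j. \<Sum>i\<in>I. A i j * f i)"
  define U where "U = (\<Sum>j\<in>J. (cmod (u j))\<^sup>2)"
  define F where "F = (\<Sum>i\<in>I. (cmod (f i))\<^sup>2)"
  have U0: "0 \<le> U" unfolding U_def by (intro sum_nonneg) simp
  have "complex_of_real U = (\<Sum>j\<in>J. \<Sum>i\<in>I. A i j * f i * cnj (u j))"
    unfolding U_def of_real_sum complex_norm_square u_def sum_distrib_right ..
  also have "\<dots> = (\<Sum>i\<in>I. f i * (\<Sum>j\<in>J. A i j * cnj (u j)))"
    unfolding sum_distrib_left by (subst sum.swap) (simp only: mult_ac)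
  finally have "cmod (complex_of_real U) = cmod (\<Sum>i\<in>I. f i * (\<Sum>j\<in>J. A i j * cnj (u j)))" by (rule arg_cong)
  also have "\<dots> \<le> (\<Sum>i\<in>I. cmod (f i) * cmod (\<Sum>j\<in>J. A i j * cnj (u j)))"
    by (rule order_trans[OF norm_sum]) (simp add: norm_mult)
  finally have "U \<le> (\<Sum>i\<in>I. cmod (f i) * cmod (\<Sum>j\<in>J. A i j * cnj (u j)))"
    by (simp only: norm_of_real abs_of_nonneg[OF U0])
  then have "U\<^sup>2 \<le> (\<Sum>i\<in>I. cmod (f i) * cmod (\<Sum>j\<in>J. A i j * cnj (u j)))\<^sup>2"
    using U0 by (rule power_mono)
  also have "\<dots> \<le> F * (\<Sum>i\<in>I. (cmod (\<Sum>j\<in>J. A i j * cnj (u j)))\<^sup>2)"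
    unfolding F_def by (rule Cauchy_Schwarz_ineq_sum)
  also have "\<dots> \<le> F * (\<Sum>j\<in>J. (cmod (cnj (u j)))\<^sup>2)"
    unfolding F_def by (intro mult_left_mono norm_boundedD(1)[OF A] sum_nonneg) auto
  also have "\<dots> = F * U" unfolding U_def by simp
  finally have "U * U \<le> F * U" by (simp add: power2_eq_square)
  moreover have "U \<ge> 0" "F \<ge> 0" unfolding U_def F_def by (auto intro: sum_nonneg)
  ultimately have "U \<le> F" by (cases "U = 0") auto
  then show "(\<Sum>j\<in>J. (cmod (\<Sum>i\<in>I. A i j * f i))\<^sup>2) \<le> (\<Sum>i\<in>I. (cmod (f i))\<^sup>2)"
    unfolding U_def F_def u_def .
qed auto

lemma norm_bounded_id: "finite I \<Longrightarrow> norm_bounded e I I (\<lambda>i j. if j = i then 1 else 0)"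
  unfolding norm_bounded_def by (simp add: if_distrib[of "\<lambda>c. c * _"] cong: if_cong)

lemma unitary_norm_bounded:
  assumes U: "unitary_on J U" and fin: "finite J"
  shows "norm_bounded True J J U"
proof -
  have "(\<Sum>p\<in>J. (cmod (\<Sum>q\<in>J. U p q * f q))\<^sup>2) = (\<Sum>q\<in>J. (cmod (f q))\<^sup>2)" for f
  proof -
    have "complex_of_real (\<Sum>p\<in>J. (cmod (\<Sum>q\<in>J. U p q * f q))\<^sup>2)
        = (\<Sum>p\<in>J. \<Sum>q\<in>J. \<Sum>q'\<in>J. U p q * f q * cnj (U p q' * f q'))"
      unfolding of_real_sum complex_norm_square cnj_sum sum_product ..
    also have "\<dots> = (\<Sum>q\<in>J. \<Sum>p\<in>J. \<Sum>q'\<in>J. U p q * f q * cnj (U p q' * f q'))" by (rule sum.swap)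
    also have "\<dots> = (\<Sum>q\<in>J. \<Sum>q'\<in>J. \<Sum>p\<in>J. U p q * f q * cnj (U p q' * f q'))"
      by (rule sum.cong[OF refl], rule sum.swap)
    also have "\<dots> = (\<Sum>q\<in>J. \<Sum>q'\<in>J. (\<Sum>p\<in>J. cnj (U p q') * U p q) * (f q * cnj (f q')))"
      unfolding sum_distrib_right by (intro sum.cong refl) simp
    also have "\<dots> = (\<Sum>q\<in>J. \<Sum>q'\<in>J. if q' = q then f q * cnj (f q) else 0)"
      using U unfolding unitary_on_def by (intro sum.cong refl) auto
    also have "\<dots> = (\<Sum>q\<in>J. f q * cnj (f q))" using fin by simp
    also have "\<dots> = complex_of_real (\<Sum>q\<in>J. (cmod (f q))\<^sup>2)"
      unfolding of_real_sum complex_norm_square ..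
    finally show ?thesis by (simp only: of_real_eq_iff)
  qed
  then show ?thesis unfolding norm_bounded_def by simp
qed

lemma finite_local_basis [simp]: "finite H \<Longrightarrow> finite (local_basis d H)"
  unfolding local_basis_def by simp

lemma norm_bounded_reindex:
  assumes A: "norm_bounded e I J A" and inj: "inj_on h I'" and im: "h ` I' \<subseteq> I" and e: "e' \<Longrightarrow> e \<and> h ` I' = I"
    and fin: "finite I"
  shows "norm_bounded e' I' J (\<lambda>i. A (h i))"
proof -
  have eq: "(\<Sum>i\<in>I'. (cmod (\<Sum>j\<in>J. A (h i) j * f j))\<^sup>2) = (\<Sum>i\<in>h ` I'. (cmod (\<Sum>j\<in>J. A i j * f j))\<^sup>2)" for f
    by (simp add: sum.reindex[OF inj])
  have le: "(\<Sum>i\<in>h ` I'. (cmod (\<Sum>j\<in>J. A i j * f j))\<^sup>2) \<le> (\<Sum>i\<in>I. (cmod (\<Sum>j\<in>J. A i j * f j))\<^sup>2)" for f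
    using im fin by (intro sum_mono2) auto
  show ?thesis unfolding norm_bounded_def eq
  proof (intro allI conjI impI)
    fix f
    show "(\<Sum>i\<in>h ` I'. (cmod (\<Sum>j\<in>J. A i j * f j))\<^sup>2) \<le> (\<Sum>j\<in>J. (cmod (f j))\<^sup>2)"
      by (rule order_trans[OF le norm_boundedD(1)[OF A]])
    assume e'
    then have "e" "h ` I' = I" using e by auto
    then show "(\<Sum>i\<in>h ` I'. (cmod (\<Sum>j\<in>J. A i j * f j))\<^sup>2) = (\<Sum>j\<in>J. (cmod (f j))\<^sup>2)"
      using A unfolding norm_bounded_def by auto
  qed
qed

text \<open>In the branch where the qubits handed over have the value \<open>T\<close>, the sender's
  factor consists of the rows of its unitary with \<open>T\<close> in these places.\<close>

lemma norm_bounded_send: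
  assumes U: "norm_bounded True (local_basis a H) (local_basis a H) U" and S: "S \<subseteq> H" "T \<subseteq> S" and fin: "finite H"
  shows "norm_bounded (S = {}) (local_basis a (H - S)) (local_basis a H) (\<lambda>\<alpha>. U (fst \<alpha>, snd \<alpha> \<union> T))"
proof (rule norm_bounded_reindex[OF U, where h = "\<lambda>\<alpha>. (fst \<alpha>, snd \<alpha> \<union> T)"])
  show "inj_on (\<lambda>\<alpha>. (fst \<alpha>, snd \<alpha> \<union> T)) (local_basis a (H - S))"
  proof (rule inj_onI)
    fix \<alpha> \<beta> assume ab: "\<alpha> \<in> local_basis a (H - S)" "\<beta> \<in> local_basis a (H - S)"
      and e: "(fst \<alpha>, snd \<alpha> \<union> T) = (fst \<beta>, snd \<beta> \<union> T)"
    have "snd \<alpha> \<inter> T = {}" "snd \<beta> \<inter> T = {}" using ab S unfolding local_basis_def by auto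
    then have "snd \<alpha> = snd \<beta>" using e by blast
    then show "\<alpha> = \<beta>" using e by (simp add: prod_eq_iff)
  qed
  show "(\<lambda>\<alpha>. (fst \<alpha>, snd \<alpha> \<union> T)) ` local_basis a (H - S) \<subseteq> local_basis a H"
    using S unfolding local_basis_def by auto
  assume "S = {}"
  then show "True \<and> (\<lambda>\<alpha>. (fst \<alpha>, snd \<alpha> \<union> T)) ` local_basis a (H - S) = local_basis a H"
    using S by simp
qed (use fin in simp)

lemma norm_bounded_receive:
  assumes S: "S \<inter> G = {}" "T \<subseteq> S" and fin: "finite G" "finite S"
  shows "norm_bounded (S = {}) (local_basis b (G \<union> S)) (local_basis b G)
     (\<lambda>\<beta> q. if snd \<beta> \<inter> S = T \<and> q = (fst \<beta>, snd \<beta> - S) then 1 else 0)"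
proof -
  let ?A = "\<lambda>\<beta> q. if snd \<beta> \<inter> S = T \<and> q = (fst \<beta>, snd \<beta> - S) then 1 else 0 :: complex"
  let ?I = "{\<beta>\<in>local_basis b (G \<union> S). snd \<beta> \<inter> S = T}"
  have "(\<Sum>\<beta>\<in>local_basis b (G \<union> S). (cmod (\<Sum>q\<in>local_basis b G. ?A \<beta> q * f q))\<^sup>2) = (\<Sum>q\<in>local_basis b G. (cmod (f q))\<^sup>2)" for f
  proof -
    have in1: "(fst \<beta>, snd \<beta> - S) \<in> local_basis b G" if "\<beta> \<in> local_basis b (G \<union> S)" for \<beta>
      using that unfolding local_basis_def by auto
    have "(\<Sum>q\<in>local_basis b G. ?A \<beta> q * f q) = (if snd \<beta> \<inter> S = T then f (fst \<beta>, snd \<beta> - S) else 0)"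
      if "\<beta> \<in> local_basis b (G \<union> S)" for \<beta>
      using in1[OF that] fin by (cases "snd \<beta> \<inter> S = T") (simp_all add: if_distrib[of "\<lambda>c. c * _"] cong: if_cong)
    then have "(\<Sum>\<beta>\<in>local_basis b (G \<union> S). (cmod (\<Sum>q\<in>local_basis b G. ?A \<beta> q * f q))\<^sup>2)
       = (\<Sum>\<beta>\<in>local_basis b (G \<union> S). if snd \<beta> \<inter> S = T then (cmod (f (fst \<beta>, snd \<beta> - S)))\<^sup>2 else 0)"
      by (intro sum.cong refl) simp
    also have "\<dots> = (\<Sum>\<beta>\<in>?I. (cmod (f (fst \<beta>, snd \<beta> - S)))\<^sup>2)"
      by (rule sum.mono_neutral_cong_right) (use fin in auto)
    also have "\<dots> = (\<Sum>q\<in>local_basis b G. (cmod (f q))\<^sup>2)"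
    proof (rule sum.reindex_bij_witness[of _ "\<lambda>q. (fst q, snd q \<union> T)" "\<lambda>\<beta>. (fst \<beta>, snd \<beta> - S)"])
      fix \<beta> assume "\<beta> \<in> ?I"
      then show "(fst (fst \<beta>, snd \<beta> - S), snd (fst \<beta>, snd \<beta> - S) \<union> T) = \<beta>" by (auto simp: prod_eq_iff)
      show "(fst \<beta>, snd \<beta> - S) \<in> local_basis b G" using in1 \<open>\<beta> \<in> ?I\<close> by simp
    next
      fix q assume q: "q \<in> local_basis b G"
      then have "snd q \<inter> S = {}" using S unfolding local_basis_def by auto
      then show "(fst (fst q, snd q \<union> T), snd (fst q, snd q \<union> T) - S) = q"
        "(fst q, snd q \<union> T) \<in> ?I" using S q unfolding local_basis_def by (auto simp: prod_eq_iff)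
    qed simp
    finally show ?thesis .
  qed
  then show ?thesis unfolding norm_bounded_def by (simp only:) simp
qed

text \<open>The indicator singles out the actual value of the transmitted qubits. The sum over
  \<open>T\<close> is introduced because, for fixed \<open>T\<close>, the sender's factor no longer
  refers to the receiver's index.\<close>

lemma send_decomposition:
  assumes u: "u \<subseteq> G \<union> S" and j: "j < b" and S: "S \<inter> G = {}" and fin: "finite S" "finite G"
  shows "(\<Sum>p\<in>P. U (i, v \<union> (u \<inter> S)) p * \<Phi> p (j, u - S)) =
    (\<Sum>T\<in>Pow S. \<Sum>p\<in>P. \<Sum>q\<in>local_basis b G. U (i, v \<union> T) p * \<Phi> p q *
       (if u \<inter> S = T \<and> q = (j, u - S) then 1 else (0::complex)))"
proof -
  have q0: "(j, u - S) \<in> local_basis b G" using u j unfolding local_basis_def by auto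
  have "(\<Sum>q\<in>local_basis b G. U (i, v \<union> T) p * \<Phi> p q * (if u \<inter> S = T \<and> q = (j, u - S) then 1 else 0))
     = (if T = u \<inter> S then U (i, v \<union> T) p * \<Phi> p (j, u - S) else 0)" for T p
    using q0 fin by (cases "u \<inter> S = T") (auto simp: if_distrib[of "\<lambda>c. _ * c"] cong: if_cong)
  then have "(\<Sum>T\<in>Pow S. \<Sum>p\<in>P. \<Sum>q\<in>local_basis b G. U (i, v \<union> T) p * \<Phi> p q * (if u \<inter> S = T \<and> q = (j, u - S) then 1 else 0))
     = (\<Sum>T\<in>Pow S. if T = u \<inter> S then (\<Sum>p\<in>P. U (i, v \<union> T) p * \<Phi> p (j, u - S)) else 0)"
    by (intro sum.cong refl) auto
  also have "\<dots> = (\<Sum>p\<in>P. U (i, v \<union> (u \<inter> S)) p * \<Phi> p (j, u - S))" using fin by simp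
  finally show ?thesis by simp
qed

lemma compose_decomposition:
  fixes A2 :: "'i \<Rightarrow> complex"
  shows "(\<Sum>\<alpha>\<in>I1. \<Sum>\<beta>\<in>J1. A2 \<alpha> * (\<Sum>T\<in>K. \<Sum>p\<in>I. \<Sum>q\<in>J. A1 T \<alpha> p * M p q * B1 T \<beta> q) * B2 \<beta>) =
   (\<Sum>T\<in>K. \<Sum>p\<in>I. \<Sum>q\<in>J. (\<Sum>\<alpha>\<in>I1. A2 \<alpha> * A1 T \<alpha> p) * M p q * (\<Sum>\<beta>\<in>J1. B2 \<beta> * B1 T \<beta> q :: complex))"
proof -
  let ?f = "\<lambda>\<alpha> \<beta> T p q. A2 \<alpha> * A1 T \<alpha> p * M p q * (B2 \<beta> * B1 T \<beta> q)"
  have "(\<Sum>\<alpha>\<in>I1. \<Sum>\<beta>\<in>J1. A2 \<alpha> * (\<Sum>T\<in>K. \<Sum>p\<in>I. \<Sum>q\<in>J. A1 T \<alpha> p * M p q * B1 T \<beta> q) * B2 \<beta>)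
     = (\<Sum>\<alpha>\<in>I1. \<Sum>\<beta>\<in>J1. \<Sum>T\<in>K. \<Sum>p\<in>I. \<Sum>q\<in>J. ?f \<alpha> \<beta> T p q)"
    unfolding sum_distrib_left sum_distrib_right by (intro sum.cong refl) (simp only: mult_ac)
  also have "\<dots> = (\<Sum>\<alpha>\<in>I1. \<Sum>T\<in>K. \<Sum>\<beta>\<in>J1. \<Sum>p\<in>I. \<Sum>q\<in>J. ?f \<alpha> \<beta> T p q)"
    by (intro sum.cong[OF refl], rule sum.swap)
  also have "\<dots> = (\<Sum>T\<in>K. \<Sum>\<alpha>\<in>I1. \<Sum>\<beta>\<in>J1. \<Sum>p\<in>I. \<Sum>q\<in>J. ?f \<alpha> \<beta> T p q)"
    by (rule sum.swap)
  also have "\<dots> = (\<Sum>T\<in>K. \<Sum>\<alpha>\<in>I1. \<Sum>p\<in>I. \<Sum>\<beta>\<in>J1. \<Sum>q\<in>J. ?f \<alpha> \<beta> T p q)"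
    by (intro sum.cong[OF refl], rule sum.swap)
  also have "\<dots> = (\<Sum>T\<in>K. \<Sum>p\<in>I. \<Sum>\<alpha>\<in>I1. \<Sum>\<beta>\<in>J1. \<Sum>q\<in>J. ?f \<alpha> \<beta> T p q)"
    by (intro sum.cong[OF refl], rule sum.swap)
  also have "\<dots> = (\<Sum>T\<in>K. \<Sum>p\<in>I. \<Sum>\<alpha>\<in>I1. \<Sum>q\<in>J. \<Sum>\<beta>\<in>J1. ?f \<alpha> \<beta> T p q)"
    by (intro sum.cong[OF refl], rule sum.swap)
  also have "\<dots> = (\<Sum>T\<in>K. \<Sum>p\<in>I. \<Sum>q\<in>J. \<Sum>\<alpha>\<in>I1. \<Sum>\<beta>\<in>J1. ?f \<alpha> \<beta> T p q)"
    by (intro sum.cong[OF refl], rule sum.swap)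
  also have "\<dots> = (\<Sum>T\<in>K. \<Sum>p\<in>I. \<Sum>q\<in>J. (\<Sum>\<alpha>\<in>I1. A2 \<alpha> * A1 T \<alpha> p) * M p q * (\<Sum>\<beta>\<in>J1. B2 \<beta> * B1 T \<beta> q))"
    unfolding sum_distrib_left sum_distrib_right by (intro sum.cong[OF refl], rule sum.swap)
  finally show ?thesis .
qed

section \<open>Decomposition of a run by the values of the transmitted qubits\<close>

definition entry :: "qstate \<Rightarrow> nat \<times> nat set \<Rightarrow> nat \<times> nat set \<Rightarrow> complex" where
  "entry \<psi> p q = \<psi> (fst p, snd p \<union> snd q, fst q)"

text \<open>A map on states, read as matrices with rows for Alice and columns for Bob, is a sum of maps
  \<open>\<Psi> \<mapsto> A\<^sub>s \<Psi> B\<^sub>s\<^sup>T\<close> over \<open>s \<in> K\<close>; all factors are contractions, and isometries if \<open>e\<close> holds.\<close>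

definition decomposes :: "'x set \<Rightarrow> 'y set \<Rightarrow> bool \<Rightarrow> (nat \<times> nat set) set \<Rightarrow> (nat \<times> nat set) set \<Rightarrow>
    (nat \<times> nat set) set \<Rightarrow> (nat \<times> nat set) set \<Rightarrow> 's set \<Rightarrow> ('s \<Rightarrow> 'x \<Rightarrow> local_op) \<Rightarrow> ('s \<Rightarrow> 'y \<Rightarrow> local_op) \<Rightarrow>
    ('x \<Rightarrow> 'y \<Rightarrow> qstate \<Rightarrow> qstate) \<Rightarrow> bool" where
  "decomposes X Y e I J I' J' K A B step \<longleftrightarrow> finite K \<and>
     (\<forall>s\<in>K. \<forall>x\<in>X. norm_bounded e I' I (A s x)) \<and> (\<forall>s\<in>K. \<forall>y\<in>Y. norm_bounded e J' J (B s y)) \<and>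
     (\<forall>x\<in>X. \<forall>y\<in>Y. \<forall>\<psi>. \<forall>\<alpha>\<in>I'. \<forall>\<beta>\<in>J'. entry (step x y \<psi>) \<alpha> \<beta> =
        (\<Sum>s\<in>K. \<Sum>p\<in>I. \<Sum>q\<in>J. A s x \<alpha> p * entry \<psi> p q * B s y \<beta> q))"

lemma decomposes_compose:
  fixes K1 :: "'s set" and K2 :: "'s list set"
  assumes d1: "decomposes X Y e I J I1 J1 K1 A1 B1 step1"
    and d2: "decomposes X Y e I1 J1 I2 J2 K2 A2 B2 step2"
  shows "decomposes X Y e I J I2 J2 ((\<lambda>(T, t). T # t) ` (K1 \<times> K2))
    (\<lambda>s x \<gamma> p. \<Sum>\<alpha>\<in>I1. A2 (tl s) x \<gamma> \<alpha> * A1 (hd s) x \<alpha> p)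
    (\<lambda>s y \<delta> q. \<Sum>\<beta>\<in>J1. B2 (tl s) y \<delta> \<beta> * B1 (hd s) y \<beta> q)
    (\<lambda>x y \<psi>. step2 x y (step1 x y \<psi>))"
  unfolding decomposes_def
proof (intro conjI ballI allI)
  show "finite ((\<lambda>(T, t). T # t) ` (K1 \<times> K2))" using d1 d2 unfolding decomposes_def by simp
next
  fix s x assume "s \<in> (\<lambda>(T, t). T # t) ` (K1 \<times> K2)" "x \<in> X"
  then show "norm_bounded e I2 I (\<lambda>\<gamma> p. \<Sum>\<alpha>\<in>I1. A2 (tl s) x \<gamma> \<alpha> * A1 (hd s) x \<alpha> p)"
    using d1 d2 unfolding decomposes_def by (intro norm_bounded_comp) auto
next
  fix s y assume "s \<in> (\<lambda>(T, t). T # t) ` (K1 \<times> K2)" "y \<in> Y"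
  then show "norm_bounded e J2 J (\<lambda>\<delta> q. \<Sum>\<beta>\<in>J1. B2 (tl s) y \<delta> \<beta> * B1 (hd s) y \<beta> q)"
    using d1 d2 unfolding decomposes_def by (intro norm_bounded_comp) auto
next
  fix x y \<psi> \<gamma> \<delta> assume xy: "x \<in> X" "y \<in> Y" and g: "\<gamma> \<in> I2" "\<delta> \<in> J2"
  have e1: "entry (step1 x y \<psi>) \<alpha> \<beta> = (\<Sum>T\<in>K1. \<Sum>p\<in>I. \<Sum>q\<in>J. A1 T x \<alpha> p * entry \<psi> p q * B1 T y \<beta> q)"
    if "\<alpha> \<in> I1" "\<beta> \<in> J1" for \<alpha> \<beta> using d1 xy that unfolding decomposes_def by blast
  have "entry (step2 x y (step1 x y \<psi>)) \<gamma> \<delta> =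
      (\<Sum>t\<in>K2. \<Sum>\<alpha>\<in>I1. \<Sum>\<beta>\<in>J1. A2 t x \<gamma> \<alpha> * entry (step1 x y \<psi>) \<alpha> \<beta> * B2 t y \<delta> \<beta>)"
    using d2 xy g unfolding decomposes_def by blast
  also have "\<dots> = (\<Sum>t\<in>K2. \<Sum>\<alpha>\<in>I1. \<Sum>\<beta>\<in>J1. A2 t x \<gamma> \<alpha> *
      (\<Sum>T\<in>K1. \<Sum>p\<in>I. \<Sum>q\<in>J. A1 T x \<alpha> p * entry \<psi> p q * B1 T y \<beta> q) * B2 t y \<delta> \<beta>)"
    by (intro sum.cong refl) (simp add: e1)
  also have "\<dots> = (\<Sum>t\<in>K2. \<Sum>T\<in>K1. \<Sum>p\<in>I. \<Sum>q\<in>J. (\<Sum>\<alpha>\<in>I1. A2 t x \<gamma> \<alpha> * A1 T x \<alpha> p) * entry \<psi> p q *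
      (\<Sum>\<beta>\<in>J1. B2 t y \<delta> \<beta> * B1 T y \<beta> q))"
    unfolding compose_decomposition ..
  also have "\<dots> = (\<Sum>T\<in>K1. \<Sum>t\<in>K2. \<Sum>p\<in>I. \<Sum>q\<in>J. (\<Sum>\<alpha>\<in>I1. A2 t x \<gamma> \<alpha> * A1 T x \<alpha> p) * entry \<psi> p q *
      (\<Sum>\<beta>\<in>J1. B2 t y \<delta> \<beta> * B1 T y \<beta> q))"
    by (rule sum.swap)
  also have "\<dots> = (\<Sum>s\<in>(\<lambda>(T, t). T # t) ` (K1 \<times> K2). \<Sum>p\<in>I. \<Sum>q\<in>J.
      (\<Sum>\<alpha>\<in>I1. A2 (tl s) x \<gamma> \<alpha> * A1 (hd s) x \<alpha> p) * entry \<psi> p q * (\<Sum>\<beta>\<in>J1. B2 (tl s) y \<delta> \<beta> * B1 (hd s) y \<beta> q))"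
    by (subst sum.reindex, force simp: inj_on_def, subst sum.cartesian_product, rule sum.cong[OF refl],
      simp add: case_prod_unfold)
  finally show "entry (step2 x y (step1 x y \<psi>)) \<gamma> \<delta> = (\<Sum>s\<in>(\<lambda>(T, t). T # t) ` (K1 \<times> K2). \<Sum>p\<in>I. \<Sum>q\<in>J.
      (\<Sum>\<alpha>\<in>I1. A2 (tl s) x \<gamma> \<alpha> * A1 (hd s) x \<alpha> p) * entry \<psi> p q * (\<Sum>\<beta>\<in>J1. B2 (tl s) y \<delta> \<beta> * B1 (hd s) y \<beta> q))" .
qed

lemma Alice_step_decomposes:
  assumes U: "\<forall>x\<in>X. unitary_on (local_basis a H) (U x)" and H: "H \<subseteq> {..<m}" and S: "S \<subseteq> H"
  shows "decomposes X Y (S = {}) (local_basis a H) (local_basis b ({..<m} - H))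
    (local_basis a (H - S)) (local_basis b ({..<m} - (H - S))) (Pow S)
    (\<lambda>T x \<alpha>. U x (fst \<alpha>, snd \<alpha> \<union> T))
    (\<lambda>T y \<beta> q. if snd \<beta> \<inter> S = T \<and> q = (fst \<beta>, snd \<beta> - S) then 1 else 0)
    (\<lambda>x y. apply_Alice a H (U x))"
proof -
  have "finite H" using finite_subset[OF H] by simp
  then have fin: "finite H" "finite S" "finite ({..<m} - H)" using finite_subset[OF S] by simp_all
  have eq: "{..<m} - (H - S) = ({..<m} - H) \<union> S" using H S by blast
  show ?thesis unfolding decomposes_def eq
  proof (intro conjI ballI allI)
    show "finite (Pow S)" using fin by simp
  next
    fix T x assume "T \<in> Pow S" "x \<in> X"
    then show "norm_bounded (S = {}) (local_basis a (H - S)) (local_basis a H) (\<lambda>\<alpha>. U x (fst \<alpha>, snd \<alpha> \<union> T))"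
      using U S fin by (intro norm_bounded_send unitary_norm_bounded) auto
  next
    fix T y assume "T \<in> Pow S" "y \<in> Y"
    then show "norm_bounded (S = {}) (local_basis b ({..<m} - H \<union> S)) (local_basis b ({..<m} - H))
      (\<lambda>\<beta> q. if snd \<beta> \<inter> S = T \<and> q = (fst \<beta>, snd \<beta> - S) then 1 else 0)"
      using S fin by (intro norm_bounded_receive) auto
  next
    fix x y \<psi> \<alpha> \<beta>
    assume a: "\<alpha> \<in> local_basis a (H - S)" and b: "\<beta> \<in> local_basis b ({..<m} - H \<union> S)"
    obtain i v where iv: "\<alpha> = (i, v)" "v \<subseteq> H - S" using a unfolding local_basis_def by auto
    obtain j u where ju: "\<beta> = (j, u)" "u \<subseteq> {..<m} - H \<union> S" "j < b" using b unfolding local_basis_def by auto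
    have s: "(v \<union> u) \<inter> H = v \<union> (u \<inter> S)" "(v \<union> u) - H = u - S" using iv(2) ju(2) S by blast+
    have "entry (apply_Alice a H (U x) \<psi>) \<alpha> \<beta> = (\<Sum>p\<in>local_basis a H. U x (i, v \<union> (u \<inter> S)) p * entry \<psi> p (j, u - S))"
      unfolding entry_def apply_Alice_def iv(1) ju(1) by (simp add: s case_prod_unfold)
    also have "\<dots> = (\<Sum>T\<in>Pow S. \<Sum>p\<in>local_basis a H. \<Sum>q\<in>local_basis b ({..<m} - H).
        U x (i, v \<union> T) p * entry \<psi> p q * (if u \<inter> S = T \<and> q = (j, u - S) then 1 else 0))"
      by (rule send_decomposition) (use ju S fin in auto)
    finally show "entry (apply_Alice a H (U x) \<psi>) \<alpha> \<beta> = (\<Sum>T\<in>Pow S. \<Sum>p\<in>local_basis a H. \<Sum>q\<in>local_basis b ({..<m} - H).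
        U x (fst \<alpha>, snd \<alpha> \<union> T) p * entry \<psi> p q * (if snd \<beta> \<inter> S = T \<and> q = (fst \<beta>, snd \<beta> - S) then 1 else 0))"
      unfolding iv(1) ju(1) by simp
  qed
qed

lemma Bob_step_decomposes:
  assumes V: "\<forall>y\<in>Y. unitary_on (local_basis b ({..<m} - H)) (V y)" and H: "H \<subseteq> {..<m}" and S: "S \<subseteq> {..<m} - H"
  shows "decomposes X Y (S = {}) (local_basis a H) (local_basis b ({..<m} - H))
    (local_basis a (H \<union> S)) (local_basis b ({..<m} - (H \<union> S))) (Pow S)
    (\<lambda>T x \<alpha> p. if snd \<alpha> \<inter> S = T \<and> p = (fst \<alpha>, snd \<alpha> - S) then 1 else 0)
    (\<lambda>T y \<beta>. V y (fst \<beta>, snd \<beta> \<union> T))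
    (\<lambda>x y. apply_Bob b ({..<m} - H) (V y))"
proof -
  let ?G = "{..<m} - H"
  have fin: "finite H" "finite S" "finite ?G" using finite_subset[OF H] finite_subset[OF S] by auto
  have eq: "{..<m} - (H \<union> S) = ?G - S" by blast
  show ?thesis unfolding decomposes_def eq
  proof (intro conjI ballI allI)
    show "finite (Pow S)" using fin by simp
  next
    fix T y assume "T \<in> Pow S" "y \<in> Y"
    then show "norm_bounded (S = {}) (local_basis b (?G - S)) (local_basis b ?G) (\<lambda>\<beta>. V y (fst \<beta>, snd \<beta> \<union> T))"
      using V S fin by (intro norm_bounded_send unitary_norm_bounded) auto
  next
    fix T x assume "T \<in> Pow S" "x \<in> X"
    then show "norm_bounded (S = {}) (local_basis a (H \<union> S)) (local_basis a H)
      (\<lambda>\<alpha> p. if snd \<alpha> \<inter> S = T \<and> p = (fst \<alpha>, snd \<alpha> - S) then 1 else 0)"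
      using S fin by (intro norm_bounded_receive) auto
  next
    fix x y \<psi> \<alpha> \<beta>
    assume a: "\<alpha> \<in> local_basis a (H \<union> S)" and b: "\<beta> \<in> local_basis b (?G - S)"
    obtain i v where iv: "\<alpha> = (i, v)" "v \<subseteq> H \<union> S" "i < a" using a unfolding local_basis_def by auto
    obtain j u where ju: "\<beta> = (j, u)" "u \<subseteq> ?G - S" using b unfolding local_basis_def by auto
    have s: "(v \<union> u) \<inter> ?G = u \<union> (v \<inter> S)" "(v \<union> u) - ?G = v - S" using iv(2) ju(2) S by blast+
    have "entry (apply_Bob b ?G (V y) \<psi>) \<alpha> \<beta> = (\<Sum>q\<in>local_basis b ?G. V y (j, u \<union> (v \<inter> S)) q * entry \<psi> (i, v - S) q)"
      unfolding entry_def apply_Bob_def iv(1) ju(1) by (simp add: s case_prod_unfold Un_commute[of "v - S"])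
    also have "\<dots> = (\<Sum>T\<in>Pow S. \<Sum>q\<in>local_basis b ?G. \<Sum>p\<in>local_basis a H.
        V y (j, u \<union> T) q * entry \<psi> p q * (if v \<inter> S = T \<and> p = (i, v - S) then 1 else 0))"
      by (rule send_decomposition[where \<Phi> = "\<lambda>q p. entry \<psi> p q"]) (use iv S fin in auto)
    also have "\<dots> = (\<Sum>T\<in>Pow S. \<Sum>p\<in>local_basis a H. \<Sum>q\<in>local_basis b ?G.
        V y (j, u \<union> T) q * entry \<psi> p q * (if v \<inter> S = T \<and> p = (i, v - S) then 1 else 0))"
      by (rule sum.cong[OF refl], rule sum.swap)
    also have "\<dots> = (\<Sum>T\<in>Pow S. \<Sum>p\<in>local_basis a H. \<Sum>q\<in>local_basis b ?G.
        (if snd \<alpha> \<inter> S = T \<and> p = (fst \<alpha>, snd \<alpha> - S) then 1 else 0) * entry \<psi> p q * V y (fst \<beta>, snd \<beta> \<union> T) q)"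
      unfolding iv(1) ju(1) by (intro sum.cong refl) (simp add: mult_ac)
    finally show "entry (apply_Bob b ?G (V y) \<psi>) \<alpha> \<beta> = (\<Sum>T\<in>Pow S. \<Sum>p\<in>local_basis a H. \<Sum>q\<in>local_basis b ?G.
        (if snd \<alpha> \<inter> S = T \<and> p = (fst \<alpha>, snd \<alpha> - S) then 1 else 0) * entry \<psi> p q * V y (fst \<beta>, snd \<beta> \<union> T) q)" .
  qed
qed

lemma decomposes_weaken: "decomposes X Y e I J I' J' K A B step \<Longrightarrow> (e' \<Longrightarrow> e) \<Longrightarrow> decomposes X Y e' I J I' J' K A B step"
  unfolding decomposes_def by (meson norm_bounded_weaken)

text \<open>A branch is the list of the values of the qubits sent in the successive steps. There are
  \<open>2 ^ c\<close> branches for total cost \<open>c\<close>, whatever the dimensions are, since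
  a step that sends nothing does not multiply them. At cost 0 all factors are isometries.\<close>

lemma run_steps_decomposes:
  assumes "valid_steps X Y a m b H ss" "H \<subseteq> {..<m}"
  shows "\<exists>H' (K :: nat set list set) A B. H' \<subseteq> {..<m} \<and> card K = 2 ^ sum_list (map qubits_sent ss) \<and>
    (\<forall>x y \<psi>. fst (run_steps a m b x y ss (H, \<psi>)) = H') \<and>
    decomposes X Y (sum_list (map qubits_sent ss) = 0) (local_basis a H) (local_basis b ({..<m} - H))
      (local_basis a H') (local_basis b ({..<m} - H')) K A B (\<lambda>x y \<psi>. snd (run_steps a m b x y ss (H, \<psi>)))"
  using assms
proof (induction ss arbitrary: H)
  case Nil
  have fin: "finite H" "finite ({..<m} - H)" using finite_subset[OF Nil(2)] by simp_all
  have "decomposes X Y True (local_basis a H) (local_basis b ({..<m} - H)) (local_basis a H) (local_basis b ({..<m} - H))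
     {[]::nat set list} (\<lambda>s x \<alpha> p. if p = \<alpha> then 1 else 0) (\<lambda>s y \<beta> q. if q = \<beta> then 1 else 0) (\<lambda>x y \<psi>. \<psi>)"
    unfolding decomposes_def
    using fin by (auto intro!: norm_bounded_id simp: if_distrib[of "\<lambda>c. c * _"] if_distrib[of "\<lambda>c. _ * c"] cong: if_cong)
  then show ?case using Nil by (intro exI[of _ H] exI[of _ "{[]}"]) auto
next
  case (Cons st ss)
  have card_K: "card ((\<lambda>(T, t). T # t) ` (Pow S \<times> K)) = 2 ^ (card S + c)"
    if "finite S" "card K = 2 ^ c" for S :: "nat set" and K :: "nat set list set" and c
    using that by (subst card_image) (auto simp: inj_on_def card_cartesian_product card_Pow power_add)
  show ?case
  proof (cases st)
    case (Alice_Step U S)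
    have v: "\<forall>x\<in>X. unitary_on (local_basis a H) (U x)" "S \<subseteq> H" "valid_steps X Y a m b (H - S) ss"
      using Cons.prems(1) unfolding Alice_Step by simp_all
    have finS: "finite S" using finite_subset[OF v(2)] finite_subset[OF Cons.prems(2)] by simp
    have "H - S \<subseteq> {..<m}" using Cons.prems(2) by blast
    then obtain H' K A B where IH: "H' \<subseteq> {..<m}" "card (K :: nat set list set) = 2 ^ sum_list (map qubits_sent ss)"
      "\<forall>x y \<psi>. fst (run_steps a m b x y ss (H - S, \<psi>)) = H'"
      "decomposes X Y (sum_list (map qubits_sent ss) = 0) (local_basis a (H - S)) (local_basis b ({..<m} - (H - S)))
      (local_basis a H') (local_basis b ({..<m} - H')) K A B (\<lambda>x y \<psi>. snd (run_steps a m b x y ss (H - S, \<psi>)))"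
      using Cons.IH[OF v(3)] by blast
    let ?e = "sum_list (map qubits_sent (st # ss)) = 0"
    have e: "?e \<Longrightarrow> S = {}" "?e \<Longrightarrow> sum_list (map qubits_sent ss) = 0" using finS unfolding Alice_Step by simp_all
    note D = decomposes_compose[OF decomposes_weaken[OF Alice_step_decomposes[OF v(1) Cons.prems(2) v(2)] e(1)]
        decomposes_weaken[OF IH(4) e(2)]]
    have run: "run_steps a m b x y (st # ss) (H, \<psi>) = run_steps a m b x y ss (H - S, apply_Alice a H (U x) \<psi>)" for x y \<psi>
      by (simp add: Alice_Step)
    have c: "sum_list (map qubits_sent (st # ss)) = card S + sum_list (map qubits_sent ss)" by (simp add: Alice_Step)
    show ?thesis unfolding run
    proof (rule exI[of _ H'], rule exI[of _ "(\<lambda>(T, t). T # t) ` (Pow S \<times> K)"], rule exI, rule exI, intro conjI)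
      show "card ((\<lambda>(T, t). T # t) ` (Pow S \<times> K)) = 2 ^ sum_list (map qubits_sent (st # ss))"
        unfolding c by (rule card_K[OF finS IH(2)])
      show "\<forall>x y \<psi>. fst (run_steps a m b x y ss (H - S, apply_Alice a H (U x) \<psi>)) = H'" using IH(3) by blast
    qed (rule IH(1), rule D)
  next
    case (Bob_Step V S)
    have v: "\<forall>y\<in>Y. unitary_on (local_basis b ({..<m} - H)) (V y)" "S \<subseteq> {..<m} - H" "valid_steps X Y a m b (H \<union> S) ss"
      using Cons.prems(1) unfolding Bob_Step by simp_all
    have finS: "finite S" using finite_subset[OF v(2)] by simp
    have "H \<union> S \<subseteq> {..<m}" using Cons.prems(2) v(2) by blast
    then obtain H' K A B where IH: "H' \<subseteq> {..<m}" "card (K :: nat set list set) = 2 ^ sum_list (map qubits_sent ss)"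
      "\<forall>x y \<psi>. fst (run_steps a m b x y ss (H \<union> S, \<psi>)) = H'"
      "decomposes X Y (sum_list (map qubits_sent ss) = 0) (local_basis a (H \<union> S)) (local_basis b ({..<m} - (H \<union> S)))
      (local_basis a H') (local_basis b ({..<m} - H')) K A B (\<lambda>x y \<psi>. snd (run_steps a m b x y ss (H \<union> S, \<psi>)))"
      using Cons.IH[OF v(3)] by blast
    let ?e = "sum_list (map qubits_sent (st # ss)) = 0"
    have e: "?e \<Longrightarrow> S = {}" "?e \<Longrightarrow> sum_list (map qubits_sent ss) = 0" using finS unfolding Bob_Step by simp_all
    note D = decomposes_compose[OF decomposes_weaken[OF Bob_step_decomposes[OF v(1) Cons.prems(2) v(2)] e(1)]
        decomposes_weaken[OF IH(4) e(2)]]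
    have run: "run_steps a m b x y (st # ss) (H, \<psi>) = run_steps a m b x y ss (H \<union> S, apply_Bob b ({..<m} - H) (V y) \<psi>)" for x y \<psi>
      by (simp add: Bob_Step)
    have c: "sum_list (map qubits_sent (st # ss)) = card S + sum_list (map qubits_sent ss)" by (simp add: Bob_Step)
    show ?thesis unfolding run
    proof (rule exI[of _ H'], rule exI[of _ "(\<lambda>(T, t). T # t) ` (Pow S \<times> K)"], rule exI, rule exI, intro conjI)
      show "card ((\<lambda>(T, t). T # t) ` (Pow S \<times> K)) = 2 ^ sum_list (map qubits_sent (st # ss))"
        unfolding c by (rule card_K[OF finS IH(2)])
      show "\<forall>x y \<psi>. fst (run_steps a m b x y ss (H \<union> S, apply_Bob b ({..<m} - H) (V y) \<psi>)) = H'" using IH(3) by blast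
    qed (rule IH(1), rule D)
  qed
qed

section \<open>Acceptance probabilities as sums of inner products\<close>

lemma sum_global_basis:
  assumes H: "H \<subseteq> {..<m}"
  shows "(\<Sum>g\<in>global_basis a m b. F g) =
    (\<Sum>\<alpha>\<in>local_basis a H. \<Sum>\<beta>\<in>local_basis b ({..<m} - H). F (fst \<alpha>, snd \<alpha> \<union> snd \<beta>, fst \<beta>))"
proof -
  have "(\<Sum>g\<in>global_basis a m b. F g) =
      (\<Sum>(\<alpha>, \<beta>)\<in>local_basis a H \<times> local_basis b ({..<m} - H). F (fst \<alpha>, snd \<alpha> \<union> snd \<beta>, fst \<beta>))"
  proof (rule sum.reindex_bij_witness[of _ "\<lambda>(\<alpha>, \<beta>). (fst \<alpha>, snd \<alpha> \<union> snd \<beta>, fst \<beta>)"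
        "\<lambda>(i, w, j). ((i, w \<inter> H), (j, w - H))"])
    fix g assume "g \<in> global_basis a m b"
    then obtain i w j where g: "g = (i, w, j)" "i < a" "w \<subseteq> {..<m}" "j < b" unfolding global_basis_def by auto
    have w: "w \<inter> H \<union> (w - H) = w" by blast
    show "(case (case g of (i, w, j) \<Rightarrow> ((i, w \<inter> H), j, w - H)) of (\<alpha>, \<beta>) \<Rightarrow> (fst \<alpha>, snd \<alpha> \<union> snd \<beta>, fst \<beta>)) = g"
      "(case (case g of (i, w, j) \<Rightarrow> ((i, w \<inter> H), j, w - H)) of (\<alpha>, \<beta>) \<Rightarrow> F (fst \<alpha>, snd \<alpha> \<union> snd \<beta>, fst \<beta>)) = F g"
      unfolding g(1) using w by simp_all
    show "(case g of (i, w, j) \<Rightarrow> ((i, w \<inter> H), j, w - H)) \<in> local_basis a H \<times> local_basis b ({..<m} - H)"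
      using g unfolding local_basis_def by auto
  next
    fix \<pi> assume "\<pi> \<in> local_basis a H \<times> local_basis b ({..<m} - H)"
    then obtain i v j u where p: "\<pi> = ((i, v), (j, u))" "i < a" "v \<subseteq> H" "j < b" "u \<subseteq> {..<m} - H"
      unfolding local_basis_def by auto
    have "(v \<union> u) \<inter> H = v" "(v \<union> u) - H = u" using p by blast+
    then show "(case (case \<pi> of (\<alpha>, \<beta>) \<Rightarrow> (fst \<alpha>, snd \<alpha> \<union> snd \<beta>, fst \<beta>)) of (i, w, j) \<Rightarrow> ((i, w \<inter> H), j, w - H)) = \<pi>"
      unfolding p(1) by simp
    show "(case \<pi> of (\<alpha>, \<beta>) \<Rightarrow> (fst \<alpha>, snd \<alpha> \<union> snd \<beta>, fst \<beta>)) \<in> global_basis a m b"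
      using p H unfolding global_basis_def by auto
  qed
  then show ?thesis by (simp only: sum.cartesian_product)
qed

lemma correlation_rearrange:
  fixes \<Psi> :: "'p \<Rightarrow> 'q \<Rightarrow> complex"
  shows "(\<Sum>\<alpha>\<in>DA. \<Sum>\<beta>\<in>DB. (\<Sum>p\<in>I. \<Sum>q\<in>J. A \<alpha> p * \<Psi> p q * B \<beta> q) * cnj (\<Sum>p\<in>I. \<Sum>q\<in>J. A' \<alpha> p * \<Psi> p q * B' \<beta> q))
   = (\<Sum>p'\<in>I. \<Sum>q\<in>J. (\<Sum>\<alpha>\<in>DA. cnj (A' \<alpha> p') * (\<Sum>p\<in>I. A \<alpha> p * \<Psi> p q)) *
        (\<Sum>\<beta>\<in>DB. B \<beta> q * (\<Sum>q'\<in>J. cnj (B' \<beta> q') * cnj (\<Psi> p' q'))))"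
proof -
  let ?a = "\<lambda>\<alpha> q. \<Sum>p\<in>I. A \<alpha> p * \<Psi> p q"
  let ?c = "\<lambda>p' \<beta>. \<Sum>q'\<in>J. cnj (B' \<beta> q') * cnj (\<Psi> p' q')"
  let ?f = "\<lambda>\<alpha> \<beta> q p'. (?a \<alpha> q * B \<beta> q) * (cnj (A' \<alpha> p') * ?c p' \<beta>)"
  have 1: "(\<Sum>p\<in>I. \<Sum>q\<in>J. A \<alpha> p * \<Psi> p q * B \<beta> q) = (\<Sum>q\<in>J. ?a \<alpha> q * B \<beta> q)" for \<alpha> \<beta>
    unfolding sum_distrib_right by (rule sum.swap)
  have 2: "cnj (\<Sum>p\<in>I. \<Sum>q\<in>J. A' \<alpha> p * \<Psi> p q * B' \<beta> q) = (\<Sum>p'\<in>I. cnj (A' \<alpha> p') * ?c p' \<beta>)" for \<alpha> \<beta>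
    unfolding cnj_sum complex_cnj_mult sum_distrib_left by (intro sum.cong refl) (simp only: mult_ac)
  have "(\<Sum>\<alpha>\<in>DA. \<Sum>\<beta>\<in>DB. (\<Sum>p\<in>I. \<Sum>q\<in>J. A \<alpha> p * \<Psi> p q * B \<beta> q) * cnj (\<Sum>p\<in>I. \<Sum>q\<in>J. A' \<alpha> p * \<Psi> p q * B' \<beta> q))
     = (\<Sum>\<alpha>\<in>DA. \<Sum>\<beta>\<in>DB. \<Sum>q\<in>J. \<Sum>p'\<in>I. ?f \<alpha> \<beta> q p')"
    unfolding 1 2 sum_product ..
  also have "\<dots> = (\<Sum>\<alpha>\<in>DA. \<Sum>\<beta>\<in>DB. \<Sum>p'\<in>I. \<Sum>q\<in>J. ?f \<alpha> \<beta> q p')"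
    by (rule sum.cong[OF refl], rule sum.cong[OF refl], rule sum.swap)
  also have "\<dots> = (\<Sum>\<alpha>\<in>DA. \<Sum>p'\<in>I. \<Sum>\<beta>\<in>DB. \<Sum>q\<in>J. ?f \<alpha> \<beta> q p')"
    by (rule sum.cong[OF refl], rule sum.swap)
  also have "\<dots> = (\<Sum>p'\<in>I. \<Sum>\<alpha>\<in>DA. \<Sum>\<beta>\<in>DB. \<Sum>q\<in>J. ?f \<alpha> \<beta> q p')"
    by (rule sum.swap)
  also have "\<dots> = (\<Sum>p'\<in>I. \<Sum>\<alpha>\<in>DA. \<Sum>q\<in>J. \<Sum>\<beta>\<in>DB. ?f \<alpha> \<beta> q p')"
    by (rule sum.cong[OF refl], rule sum.cong[OF refl], rule sum.swap)
  also have "\<dots> = (\<Sum>p'\<in>I. \<Sum>q\<in>J. \<Sum>\<alpha>\<in>DA. \<Sum>\<beta>\<in>DB. ?f \<alpha> \<beta> q p')"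
    by (rule sum.cong[OF refl], rule sum.swap)
  also have "\<dots> = (\<Sum>p'\<in>I. \<Sum>q\<in>J. (\<Sum>\<alpha>\<in>DA. cnj (A' \<alpha> p') * ?a \<alpha> q) * (\<Sum>\<beta>\<in>DB. B \<beta> q * ?c p' \<beta>))"
    unfolding sum_product by (rule sum.cong[OF refl], rule sum.cong[OF refl], rule sum.cong[OF refl], rule sum.cong[OF refl], simp only: mult_ac)
  finally show ?thesis .
qed

text \<open>Together with \<open>accept_Bob\<close> this writes the event of output \<open>v\<close>
  as a product set: the measurer's registers are restricted, those of the other party range over
  everything.\<close>

definition accept_Alice :: "('x, 'y) qprotocol \<Rightarrow> nat set \<Rightarrow> bool \<Rightarrow> (nat \<times> nat set) set" where
  "accept_Alice P H v = {\<alpha>\<in>local_basis (dimA P) H. measurer P = Alice \<longrightarrow> (\<alpha> \<in> accept P) = v}"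

definition accept_Bob :: "('x, 'y) qprotocol \<Rightarrow> nat set \<Rightarrow> bool \<Rightarrow> (nat \<times> nat set) set" where
  "accept_Bob P H v = {\<beta>\<in>local_basis (dimB P) ({..<qubits P} - H). measurer P = Bob \<longrightarrow> (\<beta> \<in> accept P) = v}"

lemma qoutput_prob_eq_sum:
  assumes H: "H \<subseteq> {..<qubits P}" and run: "run_steps (dimA P) (qubits P) (dimB P) x y (steps P) (alice_init P, initial P) = (H, \<psi>)"
  shows "qoutput_prob P x y v = (\<Sum>\<alpha>\<in>accept_Alice P H v. \<Sum>\<beta>\<in>accept_Bob P H v. (cmod (entry \<psi> \<alpha> \<beta>))\<^sup>2)"
proof -
  let ?I = "local_basis (dimA P) H" and ?J = "local_basis (dimB P) ({..<qubits P} - H)"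
  have fin: "finite ?I" "finite ?J" using finite_subset[OF H] by simp_all
  have finG: "finite (global_basis (dimA P) (qubits P) (dimB P))" unfolding global_basis_def by simp
  have acc: "accepting P H (fst \<alpha>, snd \<alpha> \<union> snd \<beta>, fst \<beta>) = v \<longleftrightarrow> \<alpha> \<in> accept_Alice P H v \<and> \<beta> \<in> accept_Bob P H v"
    if "\<alpha> \<in> ?I" "\<beta> \<in> ?J" for \<alpha> \<beta>
  proof -
    have "(snd \<alpha> \<union> snd \<beta>) \<inter> H = snd \<alpha>" "(snd \<alpha> \<union> snd \<beta>) - H = snd \<beta>"
      using that unfolding local_basis_def by auto
    then show ?thesis using that unfolding accepting_def accept_Alice_def accept_Bob_def
      by (cases "measurer P") simp_all
  qed
  have "qoutput_prob P x y v = (\<Sum>p\<in>{p \<in> global_basis (dimA P) (qubits P) (dimB P). accepting P H p = v}. (cmod (\<psi> p))\<^sup>2)"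
    unfolding qoutput_prob_def run by simp
  also have "\<dots> = (\<Sum>p\<in>global_basis (dimA P) (qubits P) (dimB P). if accepting P H p = v then (cmod (\<psi> p))\<^sup>2 else 0)"
    by (rule sum.mono_neutral_cong_left) (use finG in auto)
  also have "\<dots> = (\<Sum>\<alpha>\<in>?I. \<Sum>\<beta>\<in>?J. if \<alpha> \<in> accept_Alice P H v \<and> \<beta> \<in> accept_Bob P H v then (cmod (entry \<psi> \<alpha> \<beta>))\<^sup>2 else 0)"
    unfolding sum_global_basis[OF H] by (intro sum.cong refl) (simp add: acc entry_def)
  also have "\<dots> = (\<Sum>\<alpha>\<in>?I. if \<alpha> \<in> accept_Alice P H v then (\<Sum>\<beta>\<in>accept_Bob P H v. (cmod (entry \<psi> \<alpha> \<beta>))\<^sup>2) else 0)"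
  proof (rule sum.cong[OF refl])
    fix \<alpha>
    show "(\<Sum>\<beta>\<in>?J. if \<alpha> \<in> accept_Alice P H v \<and> \<beta> \<in> accept_Bob P H v then (cmod (entry \<psi> \<alpha> \<beta>))\<^sup>2 else 0)
       = (if \<alpha> \<in> accept_Alice P H v then (\<Sum>\<beta>\<in>accept_Bob P H v. (cmod (entry \<psi> \<alpha> \<beta>))\<^sup>2) else 0)"
    proof (cases "\<alpha> \<in> accept_Alice P H v")
      case True
      have "(\<Sum>\<beta>\<in>?J. if \<beta> \<in> accept_Bob P H v then (cmod (entry \<psi> \<alpha> \<beta>))\<^sup>2 else 0) = (\<Sum>\<beta>\<in>accept_Bob P H v. (cmod (entry \<psi> \<alpha> \<beta>))\<^sup>2)"
        by (rule sum.mono_neutral_cong_right) (use fin in \<open>auto simp: accept_Bob_def\<close>)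
      then show ?thesis using True by simp
    qed simp
  qed
  also have "\<dots> = (\<Sum>\<alpha>\<in>accept_Alice P H v. \<Sum>\<beta>\<in>accept_Bob P H v. (cmod (entry \<psi> \<alpha> \<beta>))\<^sup>2)"
    by (rule sum.mono_neutral_cong_right) (use fin in \<open>auto simp: accept_Alice_def\<close>)
  finally show ?thesis .
qed

lemma valid_qprotocol_decomposes:
  assumes "valid_qprotocol X Y P"
  obtains H' and K :: "nat set list set" and A B where "H' \<subseteq> {..<qubits P}" "card K = 2 ^ qcost P" "finite K"
    "decomposes X Y (qcost P = 0) (local_basis (dimA P) (alice_init P)) (local_basis (dimB P) ({..<qubits P} - alice_init P))
       (local_basis (dimA P) H') (local_basis (dimB P) ({..<qubits P} - H')) K A B
       (\<lambda>x y \<psi>. snd (run_steps (dimA P) (qubits P) (dimB P) x y (steps P) (alice_init P, \<psi>)))"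
    "\<And>x y v. qoutput_prob P x y v = (\<Sum>\<alpha>\<in>accept_Alice P H' v. \<Sum>\<beta>\<in>accept_Bob P H' v.
       (cmod (entry (snd (run_steps (dimA P) (qubits P) (dimB P) x y (steps P) (alice_init P, initial P))) \<alpha> \<beta>))\<^sup>2)"
proof -
  have v: "alice_init P \<subseteq> {..<qubits P}" "valid_steps X Y (dimA P) (qubits P) (dimB P) (alice_init P) (steps P)"
    using assms unfolding valid_qprotocol_def by auto
  obtain H' K A B where *: "H' \<subseteq> {..<qubits P}" "card (K :: nat set list set) = 2 ^ qcost P"
    "\<forall>x y \<psi>. fst (run_steps (dimA P) (qubits P) (dimB P) x y (steps P) (alice_init P, \<psi>)) = H'"
    "decomposes X Y (qcost P = 0) (local_basis (dimA P) (alice_init P)) (local_basis (dimB P) ({..<qubits P} - alice_init P))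
       (local_basis (dimA P) H') (local_basis (dimB P) ({..<qubits P} - H')) K A B
       (\<lambda>x y \<psi>. snd (run_steps (dimA P) (qubits P) (dimB P) x y (steps P) (alice_init P, \<psi>)))"
    using run_steps_decomposes[OF v(2,1)] unfolding qcost_def by blast
  have "run_steps (dimA P) (qubits P) (dimB P) x y (steps P) (alice_init P, initial P)
      = (H', snd (run_steps (dimA P) (qubits P) (dimB P) x y (steps P) (alice_init P, initial P)))" for x y
    using *(3) by (simp add: prod_eq_iff)
  note q = qoutput_prob_eq_sum[OF *(1) this]
  have "finite K" using *(2) by (intro card_ge_0_finite) simp
  then show ?thesis using *(1,2) *(4) q by (intro that[of H' K A B]) 
qed

lemma initial_norm:
  assumes "valid_qprotocol X Y P"
  shows "(\<Sum>p\<in>local_basis (dimA P) (alice_init P). \<Sum>q\<in>local_basis (dimB P) ({..<qubits P} - alice_init P).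
     (cmod (entry (initial P) p q))\<^sup>2) = 1"
  using assms sum_global_basis[of "alice_init P" "qubits P" "\<lambda>g. (cmod (initial P g))\<^sup>2" "dimA P" "dimB P"]
  unfolding valid_qprotocol_def entry_def by simp

text \<open>A probability is a sum over pairs of branches, hence \<open>4 ^ c\<close> terms. Each
  vector arises from the normalized initial state by two contractions, so its norm is at most 1
  irrespective of the entanglement.\<close>

lemma qoutput_prob_factorization:
  assumes V: "valid_qprotocol X Y P"
  shows "\<exists>(K :: (nat set list \<times> nat set list) set) (J :: ((nat \<times> nat set) \<times> (nat \<times> nat set)) set) XX YY.
    card K = 4 ^ qcost P \<and>
    (\<forall>x\<in>X. \<forall>y\<in>Y. complex_of_real (qoutput_prob P x y v) = (\<Sum>s\<in>K. \<Sum>j\<in>J. XX s j x * YY s j y)) \<and>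
    (\<forall>s\<in>K. \<forall>x\<in>X. (\<Sum>j\<in>J. (cmod (XX s j x))\<^sup>2) \<le> 1) \<and> (\<forall>s\<in>K. \<forall>y\<in>Y. (\<Sum>j\<in>J. (cmod (YY s j y))\<^sup>2) \<le> 1)"
proof -
  let ?I = "local_basis (dimA P) (alice_init P)" and ?J = "local_basis (dimB P) ({..<qubits P} - alice_init P)"
  let ?run = "\<lambda>x y \<psi>. snd (run_steps (dimA P) (qubits P) (dimB P) x y (steps P) (alice_init P, \<psi>))"
  obtain H' K A B where D: "H' \<subseteq> {..<qubits P}" "card (K :: nat set list set) = 2 ^ qcost P" "finite K"
    "decomposes X Y (qcost P = 0) ?I ?J (local_basis (dimA P) H') (local_basis (dimB P) ({..<qubits P} - H')) K A B ?run"
    "\<And>x y v. qoutput_prob P x y v = (\<Sum>\<alpha>\<in>accept_Alice P H' v. \<Sum>\<beta>\<in>accept_Bob P H' v. (cmod (entry (?run x y (initial P)) \<alpha> \<beta>))\<^sup>2)"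
    by (rule valid_qprotocol_decomposes[OF V], rule that, assumption+)
  let ?DA = "accept_Alice P H' v" and ?DB = "accept_Bob P H' v"
  have finI: "finite ?I" "finite ?J" using V finite_subset[of "alice_init P" "{..<qubits P}"] unfolding valid_qprotocol_def by auto
  have finI': "finite (local_basis (dimA P) H')" "finite (local_basis (dimB P) ({..<qubits P} - H'))"
    using finite_subset[OF D(1)] by simp_all
  have DAB: "?DA \<subseteq> local_basis (dimA P) H'" "?DB \<subseteq> local_basis (dimB P) ({..<qubits P} - H')"
    unfolding accept_Alice_def accept_Bob_def by auto
  have finD: "finite ?DA" "finite ?DB" using finite_subset[OF DAB(1) finI'(1)] finite_subset[OF DAB(2) finI'(2)] by auto
  define \<Psi> where "\<Psi> = entry (initial P)"
  have norm1: "(\<Sum>p\<in>?I. \<Sum>q\<in>?J. (cmod (\<Psi> p q))\<^sup>2) = 1" unfolding \<Psi>_def by (rule initial_norm[OF V])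
  have nA: "norm_bounded False ?DA ?I (A s x)" if "s \<in> K" "x \<in> X" for s x
    by (rule norm_bounded_rows[OF _ DAB(1) finI'(1)]) (use D(4) that in \<open>auto simp: decomposes_def\<close>)
  have nB: "norm_bounded False ?DB ?J (B s y)" if "s \<in> K" "y \<in> Y" for s y
    by (rule norm_bounded_rows[OF _ DAB(2) finI'(2)]) (use D(4) that in \<open>auto simp: decomposes_def\<close>)
  define XX where "XX = (\<lambda>(s, s') (p', q) x. \<Sum>\<alpha>\<in>?DA. cnj (A s' x \<alpha> p') * (\<Sum>p\<in>?I. A s x \<alpha> p * \<Psi> p q))"
  define YY where "YY = (\<lambda>(s, s') (p', q) y. \<Sum>\<beta>\<in>?DB. B s y \<beta> q * (\<Sum>q'\<in>?J. cnj (B s' y \<beta> q') * cnj (\<Psi> p' q')))"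
  show ?thesis
  proof (rule exI[of _ "K \<times> K"], rule exI[of _ "?I \<times> ?J"], rule exI[of _ XX], rule exI[of _ YY], intro conjI ballI)
    have "(4::nat) ^ qcost P = 2 ^ qcost P * 2 ^ qcost P" by (simp flip: power_mult_distrib)
    then show "card (K \<times> K) = 4 ^ qcost P" using D(2) by (simp add: card_cartesian_product)
  next
    fix x y assume xy: "x \<in> X" "y \<in> Y"
    let ?M = "\<lambda>s \<alpha> \<beta>. \<Sum>p\<in>?I. \<Sum>q\<in>?J. A s x \<alpha> p * \<Psi> p q * B s y \<beta> q"
    have M: "entry (?run x y (initial P)) \<alpha> \<beta> = (\<Sum>s\<in>K. ?M s \<alpha> \<beta>)" if "\<alpha> \<in> ?DA" "\<beta> \<in> ?DB" for \<alpha> \<beta>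
      using D(4) xy DAB that unfolding decomposes_def \<Psi>_def by blast
    have "complex_of_real (qoutput_prob P x y v) = (\<Sum>\<alpha>\<in>?DA. \<Sum>\<beta>\<in>?DB. \<Sum>s\<in>K. \<Sum>s'\<in>K. ?M s \<alpha> \<beta> * cnj (?M s' \<alpha> \<beta>))"
    proof -
      have "complex_of_real (qoutput_prob P x y v) = (\<Sum>\<alpha>\<in>?DA. \<Sum>\<beta>\<in>?DB. (\<Sum>s\<in>K. ?M s \<alpha> \<beta>) * cnj (\<Sum>s\<in>K. ?M s \<alpha> \<beta>))"
        unfolding D(5) of_real_sum complex_norm_square by (intro sum.cong refl) (simp only: M)
      then show ?thesis unfolding cnj_sum[of _ K] sum_product .
    qed
    also have "\<dots> = (\<Sum>\<alpha>\<in>?DA. \<Sum>s\<in>K. \<Sum>\<beta>\<in>?DB. \<Sum>s'\<in>K. ?M s \<alpha> \<beta> * cnj (?M s' \<alpha> \<beta>))"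
      by (rule sum.cong[OF refl], rule sum.swap)
    also have "\<dots> = (\<Sum>s\<in>K. \<Sum>\<alpha>\<in>?DA. \<Sum>\<beta>\<in>?DB. \<Sum>s'\<in>K. ?M s \<alpha> \<beta> * cnj (?M s' \<alpha> \<beta>))"
      by (rule sum.swap)
    also have "\<dots> = (\<Sum>s\<in>K. \<Sum>\<alpha>\<in>?DA. \<Sum>s'\<in>K. \<Sum>\<beta>\<in>?DB. ?M s \<alpha> \<beta> * cnj (?M s' \<alpha> \<beta>))"
      by (rule sum.cong[OF refl], rule sum.cong[OF refl], rule sum.swap)
    also have "\<dots> = (\<Sum>s\<in>K. \<Sum>s'\<in>K. \<Sum>\<alpha>\<in>?DA. \<Sum>\<beta>\<in>?DB. ?M s \<alpha> \<beta> * cnj (?M s' \<alpha> \<beta>))"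
      by (rule sum.cong[OF refl], rule sum.swap)
    also have "\<dots> = (\<Sum>s\<in>K. \<Sum>s'\<in>K. \<Sum>p'\<in>?I. \<Sum>q\<in>?J. XX (s, s') (p', q) x * YY (s, s') (p', q) y)"
      unfolding correlation_rearrange XX_def YY_def by simp
    finally show "complex_of_real (qoutput_prob P x y v) = (\<Sum>s\<in>K \<times> K. \<Sum>j\<in>?I \<times> ?J. XX s j x * YY s j y)"
      by (simp only: sum.cartesian_product') 
  next
    fix s x assume "s \<in> K \<times> K" "x \<in> X"
    then obtain s1 s2 where s: "s = (s1, s2)" "s1 \<in> K" "s2 \<in> K" by auto
    have "(\<Sum>j\<in>?I \<times> ?J. (cmod (XX s j x))\<^sup>2) = (\<Sum>q\<in>?J. \<Sum>p'\<in>?I. (cmod (\<Sum>\<alpha>\<in>?DA. cnj (A s2 x \<alpha> p') * (\<Sum>p\<in>?I. A s1 x \<alpha> p * \<Psi> p q)))\<^sup>2)"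
      unfolding sum.cartesian_product' XX_def s(1) by (subst sum.swap) simp
    \<comment> \<open>Column by column: first the adjoint of one restricted contraction is removed,
      then the other contraction itself.\<close>
    also have "\<dots> \<le> (\<Sum>q\<in>?J. \<Sum>\<alpha>\<in>?DA. (cmod (\<Sum>p\<in>?I. A s1 x \<alpha> p * \<Psi> p q))\<^sup>2)"
      by (rule sum_mono, rule norm_boundedD(1)[OF norm_bounded_transpose[OF norm_bounded_cnj[OF nA]]])
         (use s \<open>x \<in> X\<close> finI finD in auto)
    also have "\<dots> \<le> (\<Sum>q\<in>?J. \<Sum>p\<in>?I. (cmod (\<Psi> p q))\<^sup>2)"
      by (rule sum_mono, rule norm_boundedD(1)[OF nA]) (use s \<open>x \<in> X\<close> in auto)
    also have "\<dots> = 1" using norm1 by (subst sum.swap)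
    finally show "(\<Sum>j\<in>?I \<times> ?J. (cmod (XX s j x))\<^sup>2) \<le> 1" .
  next
    fix s y assume "s \<in> K \<times> K" "y \<in> Y"
    then obtain s1 s2 where s: "s = (s1, s2)" "s1 \<in> K" "s2 \<in> K" by auto
    have "(\<Sum>j\<in>?I \<times> ?J. (cmod (YY s j y))\<^sup>2) = (\<Sum>p'\<in>?I. \<Sum>q\<in>?J. (cmod (\<Sum>\<beta>\<in>?DB. B s1 y \<beta> q * (\<Sum>q'\<in>?J. cnj (B s2 y \<beta> q') * cnj (\<Psi> p' q'))))\<^sup>2)"
      unfolding sum.cartesian_product' YY_def s(1) by simp
    also have "\<dots> \<le> (\<Sum>p'\<in>?I. \<Sum>\<beta>\<in>?DB. (cmod (\<Sum>q'\<in>?J. cnj (B s2 y \<beta> q') * cnj (\<Psi> p' q')))\<^sup>2)"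
      by (rule sum_mono, rule norm_boundedD(1)[OF norm_bounded_transpose[OF nB]])
         (use s \<open>y \<in> Y\<close> finI finD in auto)
    also have "\<dots> \<le> (\<Sum>p'\<in>?I. \<Sum>q\<in>?J. (cmod (cnj (\<Psi> p' q)))\<^sup>2)"
      by (rule sum_mono, rule norm_boundedD(1)[OF norm_bounded_cnj[OF nB]]) (use s \<open>y \<in> Y\<close> in auto)
    also have "\<dots> = 1" using norm1 by simp
    finally show "(\<Sum>j\<in>?I \<times> ?J. (cmod (YY s j y))\<^sup>2) \<le> 1" .
  qed
qed

text \<open>No signalling: with a single branch both factors are isometries, and the one of the
  party that does not measure drops out of the output distribution. This excludes cost 0 in the
  lower bound.\<close>

lemma qoutput_prob_no_communication:
  assumes V: "valid_qprotocol X Y P" and c: "qcost P = 0"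
  shows "(\<forall>x\<in>X. \<forall>y\<in>Y. \<forall>y'\<in>Y. qoutput_prob P x y v = qoutput_prob P x y' v) \<or>
         (\<forall>x\<in>X. \<forall>x'\<in>X. \<forall>y\<in>Y. qoutput_prob P x y v = qoutput_prob P x' y v)"
proof -
  let ?I = "local_basis (dimA P) (alice_init P)" and ?J = "local_basis (dimB P) ({..<qubits P} - alice_init P)"
  let ?run = "\<lambda>x y \<psi>. snd (run_steps (dimA P) (qubits P) (dimB P) x y (steps P) (alice_init P, \<psi>))"
  obtain H' K A B where D: "H' \<subseteq> {..<qubits P}" "card (K :: nat set list set) = 2 ^ qcost P" "finite K"
    "decomposes X Y (qcost P = 0) ?I ?J (local_basis (dimA P) H') (local_basis (dimB P) ({..<qubits P} - H')) K A B ?run"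
    "\<And>x y v. qoutput_prob P x y v = (\<Sum>\<alpha>\<in>accept_Alice P H' v. \<Sum>\<beta>\<in>accept_Bob P H' v. (cmod (entry (?run x y (initial P)) \<alpha> \<beta>))\<^sup>2)"
    by (rule valid_qprotocol_decomposes[OF V], rule that, assumption+)
  let ?I' = "local_basis (dimA P) H'" and ?J' = "local_basis (dimB P) ({..<qubits P} - H')"
  let ?DA = "accept_Alice P H' v" and ?DB = "accept_Bob P H' v"
  obtain s where s: "K = {s}" using D(2) c by (auto simp: card_1_singleton_iff)
  have nA: "norm_bounded True ?I' ?I (A s x)" if "x \<in> X" for x using D(4) that c s unfolding decomposes_def by auto
  have nB: "norm_bounded True ?J' ?J (B s y)" if "y \<in> Y" for y using D(4) that c s unfolding decomposes_def by auto
  define \<Psi> where "\<Psi> = entry (initial P)"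
  have M: "entry (?run x y (initial P)) \<alpha> \<beta> = (\<Sum>p\<in>?I. \<Sum>q\<in>?J. A s x \<alpha> p * \<Psi> p q * B s y \<beta> q)"
    if "x \<in> X" "y \<in> Y" "\<alpha> \<in> ?I'" "\<beta> \<in> ?J'" for x y \<alpha> \<beta>
    using D(4) that unfolding decomposes_def \<Psi>_def s by simp
  have DAB: "?DA \<subseteq> ?I'" "?DB \<subseteq> ?J'" unfolding accept_Alice_def accept_Bob_def by auto
  show ?thesis
  proof (cases "measurer P")
    case Alice
    then have DB: "?DB = ?J'" unfolding accept_Bob_def by auto
    have "qoutput_prob P x y v = (\<Sum>\<alpha>\<in>?DA. \<Sum>q\<in>?J. (cmod (\<Sum>p\<in>?I. A s x \<alpha> p * \<Psi> p q))\<^sup>2)" if xy: "x \<in> X" "y \<in> Y" for x y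
      unfolding D(5) DB
    proof (rule sum.cong[OF refl])
      fix \<alpha> assume "\<alpha> \<in> ?DA"
      then have al: "\<alpha> \<in> ?I'" using DAB by auto
      have "entry (?run x y (initial P)) \<alpha> \<beta> = (\<Sum>q\<in>?J. B s y \<beta> q * (\<Sum>p\<in>?I. A s x \<alpha> p * \<Psi> p q))" if "\<beta> \<in> ?J'" for \<beta>
        unfolding M[OF xy al that] sum_distrib_left by (subst sum.swap) (simp only: mult_ac)
      then have "(\<Sum>\<beta>\<in>?J'. (cmod (entry (?run x y (initial P)) \<alpha> \<beta>))\<^sup>2) = (\<Sum>\<beta>\<in>?J'. (cmod (\<Sum>q\<in>?J. B s y \<beta> q * (\<Sum>p\<in>?I. A s x \<alpha> p * \<Psi> p q)))\<^sup>2)"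
        by (intro sum.cong refl) simp
      also have "\<dots> = (\<Sum>q\<in>?J. (cmod (\<Sum>p\<in>?I. A s x \<alpha> p * \<Psi> p q))\<^sup>2)" by (rule norm_boundedD(2)[OF nB[OF xy(2)]])
      finally show "(\<Sum>\<beta>\<in>?J'. (cmod (entry (?run x y (initial P)) \<alpha> \<beta>))\<^sup>2) = (\<Sum>q\<in>?J. (cmod (\<Sum>p\<in>?I. A s x \<alpha> p * \<Psi> p q))\<^sup>2)" .
    qed
    then show ?thesis by auto
  next
    case Bob
    then have DA: "?DA = ?I'" unfolding accept_Alice_def by auto
    have "qoutput_prob P x y v = (\<Sum>\<beta>\<in>?DB. \<Sum>p\<in>?I. (cmod (\<Sum>q\<in>?J. \<Psi> p q * B s y \<beta> q))\<^sup>2)" if xy: "x \<in> X" "y \<in> Y" for x y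
      unfolding D(5) DA
    proof (subst sum.swap, rule sum.cong[OF refl])
      fix \<beta> assume "\<beta> \<in> ?DB"
      then have be: "\<beta> \<in> ?J'" using DAB by auto
      have "entry (?run x y (initial P)) \<alpha> \<beta> = (\<Sum>p\<in>?I. A s x \<alpha> p * (\<Sum>q\<in>?J. \<Psi> p q * B s y \<beta> q))" if "\<alpha> \<in> ?I'" for \<alpha>
        unfolding M[OF xy that be] sum_distrib_left by (simp only: mult_ac)
      then have "(\<Sum>\<alpha>\<in>?I'. (cmod (entry (?run x y (initial P)) \<alpha> \<beta>))\<^sup>2) = (\<Sum>\<alpha>\<in>?I'. (cmod (\<Sum>p\<in>?I. A s x \<alpha> p * (\<Sum>q\<in>?J. \<Psi> p q * B s y \<beta> q)))\<^sup>2)"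
        by (intro sum.cong refl) simp
      also have "\<dots> = (\<Sum>p\<in>?I. (cmod (\<Sum>q\<in>?J. \<Psi> p q * B s y \<beta> q))\<^sup>2)" by (rule norm_boundedD(2)[OF nA[OF xy(1)]])
      finally show "(\<Sum>\<alpha>\<in>?I'. (cmod (entry (?run x y (initial P)) \<alpha> \<beta>))\<^sup>2) = (\<Sum>p\<in>?I. (cmod (\<Sum>q\<in>?J. \<Psi> p q * B s y \<beta> q))\<^sup>2)" .
    qed
    then show ?thesis by auto
  qed
qed

section \<open>Conservation of total probability\<close>

lemma apply_Alice_norm:
  assumes U: "unitary_on (local_basis a H) U" and H: "H \<subseteq> {..<m}"
  shows "(\<Sum>g\<in>global_basis a m b. (cmod (apply_Alice a H U \<psi> g))\<^sup>2) = (\<Sum>g\<in>global_basis a m b. (cmod (\<psi> g))\<^sup>2)"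
proof -
  let ?I = "local_basis a H" and ?J = "local_basis b ({..<m} - H)"
  have "finite H" using finite_subset[OF H] by simp
  then have nU: "norm_bounded True ?I ?I U" by (intro unitary_norm_bounded U) simp
  have e: "apply_Alice a H U \<psi> (fst \<alpha>, snd \<alpha> \<union> snd \<beta>, fst \<beta>) = (\<Sum>p\<in>?I. U \<alpha> p * \<psi> (fst p, snd p \<union> snd \<beta>, fst \<beta>))"
    if "\<alpha> \<in> ?I" "\<beta> \<in> ?J" for \<alpha> \<beta>
  proof -
    have "(snd \<alpha> \<union> snd \<beta>) \<inter> H = snd \<alpha>" "(snd \<alpha> \<union> snd \<beta>) - H = snd \<beta>"
      using that unfolding local_basis_def by auto
    then show ?thesis unfolding apply_Alice_def by (simp add: case_prod_unfold)
  qed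
  have "(\<Sum>g\<in>global_basis a m b. (cmod (apply_Alice a H U \<psi> g))\<^sup>2)
     = (\<Sum>\<alpha>\<in>?I. \<Sum>\<beta>\<in>?J. (cmod (\<Sum>p\<in>?I. U \<alpha> p * \<psi> (fst p, snd p \<union> snd \<beta>, fst \<beta>)))\<^sup>2)"
    unfolding sum_global_basis[OF H] by (intro sum.cong refl) (simp only: e)
  also have "\<dots> = (\<Sum>\<beta>\<in>?J. \<Sum>\<alpha>\<in>?I. (cmod (\<Sum>p\<in>?I. U \<alpha> p * \<psi> (fst p, snd p \<union> snd \<beta>, fst \<beta>)))\<^sup>2)" by (rule sum.swap)
  also have "\<dots> = (\<Sum>\<beta>\<in>?J. \<Sum>p\<in>?I. (cmod (\<psi> (fst p, snd p \<union> snd \<beta>, fst \<beta>)))\<^sup>2)"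
    by (rule sum.cong[OF refl], rule norm_boundedD(2)[OF nU])
  also have "\<dots> = (\<Sum>p\<in>?I. \<Sum>\<beta>\<in>?J. (cmod (\<psi> (fst p, snd p \<union> snd \<beta>, fst \<beta>)))\<^sup>2)" by (rule sum.swap)
  finally show ?thesis unfolding sum_global_basis[OF H] .
qed

lemma apply_Bob_norm:
  assumes U: "unitary_on (local_basis b ({..<m} - H)) V" and H: "H \<subseteq> {..<m}"
  shows "(\<Sum>g\<in>global_basis a m b. (cmod (apply_Bob b ({..<m} - H) V \<psi> g))\<^sup>2) = (\<Sum>g\<in>global_basis a m b. (cmod (\<psi> g))\<^sup>2)"
proof -
  let ?I = "local_basis a H" and ?J = "local_basis b ({..<m} - H)"
  have nV: "norm_bounded True ?J ?J V" by (intro unitary_norm_bounded U) simp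
  have e: "apply_Bob b ({..<m} - H) V \<psi> (fst \<alpha>, snd \<alpha> \<union> snd \<beta>, fst \<beta>) = (\<Sum>q\<in>?J. V \<beta> q * \<psi> (fst \<alpha>, snd \<alpha> \<union> snd q, fst q))"
    if "\<alpha> \<in> ?I" "\<beta> \<in> ?J" for \<alpha> \<beta>
  proof -
    have "(snd \<alpha> \<union> snd \<beta>) \<inter> ({..<m} - H) = snd \<beta>" "(snd \<alpha> \<union> snd \<beta>) - ({..<m} - H) = snd \<alpha>"
      using that unfolding local_basis_def by auto
    then show ?thesis unfolding apply_Bob_def by (simp add: case_prod_unfold Un_commute[of "snd \<alpha>"])
  qed
  have "(\<Sum>g\<in>global_basis a m b. (cmod (apply_Bob b ({..<m} - H) V \<psi> g))\<^sup>2)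
     = (\<Sum>\<alpha>\<in>?I. \<Sum>\<beta>\<in>?J. (cmod (\<Sum>q\<in>?J. V \<beta> q * \<psi> (fst \<alpha>, snd \<alpha> \<union> snd q, fst q)))\<^sup>2)"
    unfolding sum_global_basis[OF H] by (intro sum.cong refl) (simp only: e)
  also have "\<dots> = (\<Sum>\<alpha>\<in>?I. \<Sum>q\<in>?J. (cmod (\<psi> (fst \<alpha>, snd \<alpha> \<union> snd q, fst q)))\<^sup>2)"
    by (rule sum.cong[OF refl], rule norm_boundedD(2)[OF nV])
  finally show ?thesis unfolding sum_global_basis[OF H] .
qed

lemma run_steps_norm:
  assumes "valid_steps X Y a m b H ss" "H \<subseteq> {..<m}" "x \<in> X" "y \<in> Y"
  shows "(\<Sum>g\<in>global_basis a m b. (cmod (snd (run_steps a m b x y ss (H, \<psi>)) g))\<^sup>2) = (\<Sum>g\<in>global_basis a m b. (cmod (\<psi> g))\<^sup>2)"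
  using assms(1,2)
proof (induction ss arbitrary: H \<psi>)
  case (Cons st ss)
  show ?case
  proof (cases st)
    case (Alice_Step U S)
    have "valid_steps X Y a m b (H - S) ss" "H - S \<subseteq> {..<m}" "unitary_on (local_basis a H) (U x)"
      using Cons.prems assms(3) unfolding Alice_Step by auto
    then show ?thesis unfolding Alice_Step using Cons.IH[of "H - S"] Cons.prems(2) by (simp add: apply_Alice_norm)
  next
    case (Bob_Step V S)
    have "valid_steps X Y a m b (H \<union> S) ss" "H \<union> S \<subseteq> {..<m}" "unitary_on (local_basis b ({..<m} - H)) (V y)"
      using Cons.prems assms(4) unfolding Bob_Step by auto
    then show ?thesis unfolding Bob_Step using Cons.IH[of "H \<union> S"] Cons.prems(2) by (simp add: apply_Bob_norm)
  qed
qed simp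

lemma qoutput_prob_total:
  assumes V: "valid_qprotocol X Y P" and xy: "x \<in> X" "y \<in> Y"
  shows "qoutput_prob P x y v + qoutput_prob P x y (\<not> v) = 1"
proof -
  let ?G = "global_basis (dimA P) (qubits P) (dimB P)"
  obtain H \<psi> where r: "run_steps (dimA P) (qubits P) (dimB P) x y (steps P) (alice_init P, initial P) = (H, \<psi>)"
    by (metis surj_pair)
  have finG: "finite ?G" unfolding global_basis_def by simp
  have "(\<Sum>g\<in>?G. (cmod (\<psi> g))\<^sup>2) = 1"
    using run_steps_norm[of X Y "dimA P" "qubits P" "dimB P" "alice_init P" "steps P" x y "initial P"] V xy
    unfolding valid_qprotocol_def r by simp
  moreover have "?G = {p \<in> ?G. accepting P H p = v} \<union> {p \<in> ?G. accepting P H p = (\<not> v)}" by auto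
  moreover have "(\<Sum>g\<in>{p \<in> ?G. accepting P H p = v} \<union> {p \<in> ?G. accepting P H p = (\<not> v)}. (cmod (\<psi> g))\<^sup>2) =
     (\<Sum>g\<in>{p \<in> ?G. accepting P H p = v}. (cmod (\<psi> g))\<^sup>2) + (\<Sum>g\<in>{p \<in> ?G. accepting P H p = (\<not> v)}. (cmod (\<psi> g))\<^sup>2)"
    by (rule sum.union_disjoint) (use finG in auto)
  ultimately show ?thesis unfolding qoutput_prob_def r by simp
qed

lemma qoutput_prob_nonneg: "qoutput_prob P x y v \<ge> 0"
  unfolding qoutput_prob_def by (auto simp: case_prod_unfold Let_def intro!: sum_nonneg)

section \<open>Randomized protocols\<close>

lemma prob_space_coin_flips: "prob_space coin_flips"
  unfolding coin_flips_def by (rule prob_space_PiM) (rule prob_space_measure_pmf)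

lemma space_coin_flips: "space coin_flips = UNIV"
  unfolding coin_flips_def space_PiM by (simp add: PiE_def extensional_def)

lemma measure_coin_flips_UNIV: "measure coin_flips UNIV = 1"
  using prob_space.prob_space[OF prob_space_coin_flips] by (simp add: space_coin_flips)

definition randomized_protocol_cost :: "real \<Rightarrow> 'x set \<Rightarrow> 'y set \<Rightarrow> ('x \<Rightarrow> 'y \<Rightarrow> bool) \<Rightarrow> nat \<Rightarrow> bool" where
  "randomized_protocol_cost \<epsilon> X Y F c \<longleftrightarrow> (\<exists>P :: (nat \<Rightarrow> bool) \<Rightarrow> ('x, 'y) protocol.
      \<forall>x\<in>X. \<forall>y\<in>Y. measure coin_flips {r. protocol_output (P r) x y = F x y} \<ge> 1 - \<epsilon> \<and>
        (\<forall>r. bits_exchanged (P r) x y \<le> c))"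

lemma randomized_of_deterministic:
  assumes "\<forall>x\<in>X. \<forall>y\<in>Y. protocol_output P x y = F x y \<and> bits_exchanged P x y \<le> c" "\<epsilon> \<ge> 0"
  shows "randomized_protocol_cost \<epsilon> X Y F c"
  unfolding randomized_protocol_cost_def using assms
  by (intro exI[of _ "\<lambda>_. P"]) (auto simp: measure_coin_flips_UNIV)

lemma randomized_cc_witness:
  assumes "randomized_protocol_cost \<epsilon> X Y F c"
  shows "randomized_protocol_cost \<epsilon> X Y F (randomized_cc \<epsilon> X Y F)" "randomized_cc \<epsilon> X Y F \<le> c"
  using assms LeastI[of "randomized_protocol_cost \<epsilon> X Y F" c] Least_le[of "randomized_protocol_cost \<epsilon> X Y F" c]
  unfolding randomized_cc_def randomized_protocol_cost_def by auto

lemma deterministic_cc_witness: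
  fixes P :: "('x, 'y) protocol"
  assumes "\<forall>x\<in>X. \<forall>y\<in>Y. protocol_output P x y = F x y \<and> bits_exchanged P x y \<le> c"
  shows "\<exists>P :: ('x, 'y) protocol. \<forall>x\<in>X. \<forall>y\<in>Y. protocol_output P x y = F x y \<and> bits_exchanged P x y \<le> deterministic_cc X Y F"
    "deterministic_cc X Y F \<le> c"
proof -
  let ?Q = "\<lambda>c. \<exists>P :: ('x, 'y) protocol. \<forall>x\<in>X. \<forall>y\<in>Y. protocol_output P x y = F x y \<and> bits_exchanged P x y \<le> c"
  have Q: "?Q c" using assms by blast
  show "?Q (deterministic_cc X Y F)" unfolding deterministic_cc_def by (rule LeastI[of ?Q, OF Q])
  show "deterministic_cc X Y F \<le> c" unfolding deterministic_cc_def by (rule Least_le[of ?Q, OF Q])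
qed

lemma randomized_cc_le_deterministic_cc:
  fixes P :: "('x, 'y) protocol"
  assumes "\<forall>x\<in>X. \<forall>y\<in>Y. protocol_output P x y = F x y \<and> bits_exchanged P x y \<le> c" "\<epsilon> \<ge> 0"
  shows "randomized_cc \<epsilon> X Y F \<le> deterministic_cc X Y F"
  using deterministic_cc_witness(1)[OF assms(1)] randomized_of_deterministic[OF _ assms(2)] randomized_cc_witness(2)
  by metis

text \<open>Only finitely many sets of correctly answered inputs can occur, so the infinite sequence of
  coin flips can be replaced by a random element of a finite set.\<close>

lemma randomized_finite_seeds:
  fixes X :: "'x set" and Y :: "'y set"
  assumes R: "randomized_protocol_cost \<epsilon> X Y F c" and fin: "finite X" "finite Y" and \<epsilon>: "\<epsilon> < 1"
  obtains E :: "('x \<times> 'y) set set" and p :: "('x \<times> 'y) set \<Rightarrow> real" and Q :: "('x \<times> 'y) set \<Rightarrow> ('x, 'y) protocol"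
  where "finite E" "\<And>e. p e \<ge> 0" "(\<Sum>e\<in>E. p e) = 1"
    "\<And>x y. x \<in> X \<Longrightarrow> y \<in> Y \<Longrightarrow> (\<Sum>e\<in>{e\<in>E. protocol_output (Q e) x y = F x y}. p e) \<ge> 1 - \<epsilon>"
    "\<And>e x y. x \<in> X \<Longrightarrow> y \<in> Y \<Longrightarrow> bits_exchanged (Q e) x y \<le> c"
proof -
  interpret prob_space coin_flips by (rule prob_space_coin_flips)
  obtain P :: "(nat \<Rightarrow> bool) \<Rightarrow> ('x, 'y) protocol" where P:
    "\<And>x y. x \<in> X \<Longrightarrow> y \<in> Y \<Longrightarrow> measure coin_flips {r. protocol_output (P r) x y = F x y} \<ge> 1 - \<epsilon>"
    "\<And>x y r. x \<in> X \<Longrightarrow> y \<in> Y \<Longrightarrow> bits_exchanged (P r) x y \<le> c"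
    using R unfolding randomized_protocol_cost_def by blast
  define good where "good = (\<lambda>\<pi>. {r. protocol_output (P r) (fst \<pi>) (snd \<pi>) = F (fst \<pi>) (snd \<pi>)})"
  \<comment> \<open>A set that is not measurable would have measure 0, which is less than
    \<open>1 - \<epsilon>\<close>.\<close>
  have meas: "good \<pi> \<in> events" if "\<pi> \<in> X \<times> Y" for \<pi>
  proof (rule ccontr)
    assume "good \<pi> \<notin> events"
    then have "measure coin_flips (good \<pi>) = 0" by (rule measure_notin_sets)
    then show False using P(1)[of "fst \<pi>" "snd \<pi>"] that \<epsilon> unfolding good_def by auto
  qed
  define pat where "pat = (\<lambda>r. {\<pi>\<in>X \<times> Y. r \<in> good \<pi>})"
  define E where "E = Pow (X \<times> Y)"
  define atom where "atom = (\<lambda>G. {r. pat r = G})"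
  have finE: "finite E" unfolding E_def using fin by simp
  have patE: "pat r \<in> E" for r unfolding E_def pat_def by blast
  have atom_eq: "atom G = {r \<in> space coin_flips. \<forall>\<pi>\<in>X \<times> Y. r \<in> good \<pi> \<longleftrightarrow> \<pi> \<in> G}" if "G \<in> E" for G
    using that unfolding atom_def pat_def E_def space_coin_flips by blast
  have atom_meas: "atom G \<in> events" if "G \<in> E" for G
    unfolding atom_eq[OF that]
  proof (rule sets.sets_Collect_finite_All)
    fix \<pi> assume pi: "\<pi> \<in> X \<times> Y"
    have "{r \<in> space coin_flips. (r \<in> good \<pi>) = (\<pi> \<in> G)} = (if \<pi> \<in> G then good \<pi> else space coin_flips - good \<pi>)"
      unfolding space_coin_flips by auto
    then show "{r \<in> space coin_flips. (r \<in> good \<pi>) = (\<pi> \<in> G)} \<in> events" using meas[OF pi] by auto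
  qed (rule finite_cartesian_product[OF fin])
  have disj: "disjoint_family_on atom E'" for E' unfolding disjoint_family_on_def atom_def by auto
  have sum_atoms: "(\<Sum>G\<in>E'. measure coin_flips (atom G)) = measure coin_flips (\<Union>G\<in>E'. atom G)" if "E' \<subseteq> E" for E'
    by (rule finite_measure_finite_Union[symmetric]) (use that finE finite_subset atom_meas disj in auto)
  define p where "p = (\<lambda>G. measure coin_flips (atom G))"
  define Q where "Q = (\<lambda>G. P (SOME r. pat r = G))"
  show ?thesis
  proof (rule that[of E p Q])
    show "finite E" by (rule finE)
    show "p e \<ge> 0" for e unfolding p_def by simp
    have "r \<in> (\<Union>G\<in>E. atom G)" for r by (rule UN_I[OF patE]) (simp add: atom_def)
    then have "(\<Union>G\<in>E. atom G) = UNIV" by blast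
    then show "(\<Sum>e\<in>E. p e) = 1" unfolding p_def using sum_atoms[of E] measure_coin_flips_UNIV by simp
    show "bits_exchanged (Q e) x y \<le> c" if "x \<in> X" "y \<in> Y" for e x y
      unfolding Q_def using P(2) that by blast
    fix x y assume xy: "x \<in> X" "y \<in> Y"
    let ?E1 = "{G\<in>E. (x, y) \<in> G}"
    have pat_xy: "(x, y) \<in> pat r \<longleftrightarrow> r \<in> good (x, y)" for r using xy unfolding pat_def by simp
    have "good (x, y) = (\<Union>G\<in>?E1. atom G)"
    proof (intro set_eqI iffI)
      fix r assume "r \<in> good (x, y)"
      then have "pat r \<in> ?E1" using patE pat_xy by simp
      then show "r \<in> (\<Union>G\<in>?E1. atom G)" by (rule UN_I) (simp add: atom_def)
    next
      fix r assume "r \<in> (\<Union>G\<in>?E1. atom G)"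
      then show "r \<in> good (x, y)" using pat_xy[of r] unfolding atom_def by auto
    qed
    then have "1 - \<epsilon> \<le> measure coin_flips (\<Union>G\<in>?E1. atom G)"
      using P(1)[OF xy] unfolding good_def by simp
    also have "\<dots> = (\<Sum>G\<in>?E1. p G)" unfolding p_def by (rule sum_atoms[symmetric]) auto
    \<comment> \<open>For a pattern that never occurs the representative in \<open>Q\<close> is
      arbitrary; such patterns have weight 0 and are dropped first.\<close>
    also have "\<dots> = (\<Sum>G\<in>{G\<in>?E1. atom G \<noteq> {}}. p G)"
      by (rule sum.mono_neutral_right) (use finE in \<open>auto simp: p_def\<close>)
    also have "\<dots> \<le> (\<Sum>e\<in>{e\<in>E. protocol_output (Q e) x y = F x y}. p e)"
    proof (rule sum_mono2)
      show "finite {e\<in>E. protocol_output (Q e) x y = F x y}" using finE by simp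
      show "{G\<in>?E1. atom G \<noteq> {}} \<subseteq> {e\<in>E. protocol_output (Q e) x y = F x y}"
      proof
        fix G assume "G \<in> {G\<in>?E1. atom G \<noteq> {}}"
        then have G: "G \<in> E" "(x, y) \<in> G" "\<exists>r. pat r = G" unfolding atom_def by auto
        then have "pat (SOME r. pat r = G) = G" by (metis (mono_tags) someI_ex)
        then have "(SOME r. pat r = G) \<in> good (x, y)" using G(2) unfolding pat_def by blast
        then show "G \<in> {e\<in>E. protocol_output (Q e) x y = F x y}" using G(1) unfolding good_def Q_def by simp
      qed
      show "p b \<ge> 0" for b unfolding p_def by simp
    qed
    finally show "1 - \<epsilon> \<le> (\<Sum>e\<in>{e\<in>E. protocol_output (Q e) x y = F x y}. p e)" .
  qed
qed

text \<open>With two bits, a party answers for the root and its own next node on the path; if the root belongs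
  to the other party, it answers for both children of the root instead. One such message of each
  party removes two levels of the tree, whoever speaks first.\<close>

fun answer_A :: "'x \<Rightarrow> ('x, 'y) protocol \<Rightarrow> bool" where
  "answer_A x (Alice_Sends \<alpha> t u) = \<alpha> x"
| "answer_A x t = False"

fun descend_A :: "bool \<Rightarrow> ('x, 'y) protocol \<Rightarrow> ('x, 'y) protocol" where
  "descend_A b (Alice_Sends \<alpha> t u) = (if b then t else u)"
| "descend_A b t = t"

fun answer_B :: "'y \<Rightarrow> ('x, 'y) protocol \<Rightarrow> bool" where
  "answer_B y (Bob_Sends \<beta> t u) = \<beta> y"
| "answer_B y t = False"

fun descend_B :: "bool \<Rightarrow> ('x, 'y) protocol \<Rightarrow> ('x, 'y) protocol" where
  "descend_B b (Bob_Sends \<beta> t u) = (if b then t else u)"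
| "descend_B b t = t"

fun message_A :: "'x \<Rightarrow> ('x, 'y) protocol \<Rightarrow> bool \<times> bool" where
  "message_A x (Output v) = (False, False)"
| "message_A x (Alice_Sends \<alpha> t u) = (\<alpha> x, answer_A x (if \<alpha> x then t else u))"
| "message_A x (Bob_Sends \<beta> t u) = (answer_A x t, answer_A x u)"

fun update_A :: "bool \<times> bool \<Rightarrow> ('x, 'y) protocol \<Rightarrow> ('x, 'y) protocol" where
  "update_A m (Output v) = Output v"
| "update_A m (Alice_Sends \<alpha> t u) = descend_A (snd m) (if fst m then t else u)"
| "update_A m (Bob_Sends \<beta> t u) = Bob_Sends \<beta> (descend_A (fst m) t) (descend_A (snd m) u)"

fun message_B :: "'y \<Rightarrow> ('x, 'y) protocol \<Rightarrow> bool \<times> bool" where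
  "message_B y (Output v) = (False, False)"
| "message_B y (Bob_Sends \<beta> t u) = (\<beta> y, answer_B y (if \<beta> y then t else u))"
| "message_B y (Alice_Sends \<alpha> t u) = (answer_B y t, answer_B y u)"

fun update_B :: "bool \<times> bool \<Rightarrow> ('x, 'y) protocol \<Rightarrow> ('x, 'y) protocol" where
  "update_B m (Output v) = Output v"
| "update_B m (Bob_Sends \<beta> t u) = descend_B (snd m) (if fst m then t else u)"
| "update_B m (Alice_Sends \<alpha> t u) = Alice_Sends \<alpha> (descend_B (fst m) t) (descend_B (snd m) u)"

lemma descend_output:
  "protocol_output (descend_A (answer_A x T) T) x y = protocol_output T x y"
  "protocol_output (descend_B (answer_B y T) T) x y = protocol_output T x y"
  by (cases T; simp)+

lemma update_output:
  "protocol_output (update_A (message_A x T) T) x y = protocol_output T x y"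
  "protocol_output (update_B (message_B y T) T) x y = protocol_output T x y"
  by (cases T; simp add: descend_output)+

lemma descend_bits:
  "bits_exchanged (descend_A (answer_A x T) T) x y \<le> bits_exchanged T x y"
  "bits_exchanged (descend_B (answer_B y T) T) x y \<le> bits_exchanged T x y"
  by (cases T; simp)+

lemma update_bits_le:
  "bits_exchanged (update_A (message_A x T) T) x y \<le> bits_exchanged T x y"
  "bits_exchanged (update_B (message_B y T) T) x y \<le> bits_exchanged T x y"
  by (cases T; simp add: descend_bits le_SucI)+

lemma update_update_bits:
  "bits_exchanged (update_B (message_B y (update_A (message_A x T) T)) (update_A (message_A x T) T)) x y \<le> bits_exchanged T x y - 2"
proof (cases T)
  case (Alice_Sends \<alpha> t u)
  define c where "c = (if \<alpha> x then t else u)"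
  have b: "bits_exchanged T x y = Suc (bits_exchanged c x y)" and u: "update_A (message_A x T) T = descend_A (answer_A x c) c"
    unfolding Alice_Sends c_def by simp_all
  show ?thesis
  proof (cases c)
    case (Alice_Sends \<alpha>' t' u')
    then have "bits_exchanged (descend_A (answer_A x c) c) x y = bits_exchanged T x y - 2" unfolding b by simp
    then show ?thesis unfolding u using update_bits_le(2)[of y "descend_A (answer_A x c) c" x] by simp
  next
    case (Bob_Sends \<beta> t' u')
    have "bits_exchanged (descend_B (answer_B y (if \<beta> y then t' else u')) (if \<beta> y then t' else u')) x y \<le> bits_exchanged (if \<beta> y then t' else u') x y"
      by (rule descend_bits(2))
    then show ?thesis unfolding u b Bob_Sends by (cases "\<beta> y") simp_all
  qed (simp add: u)
next
  case (Bob_Sends \<beta> t u)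
  define c where "c = (if \<beta> y then t else u)"
  define c' where "c' = descend_A (answer_A x c) c"
  have b: "bits_exchanged T x y = Suc (bits_exchanged c x y)" unfolding Bob_Sends c_def by simp
  have u: "update_B (message_B y (update_A (message_A x T) T)) (update_A (message_A x T) T) = descend_B (answer_B y c') c'"
    unfolding Bob_Sends c_def c'_def by simp
  \<comment> \<open>If the node below the root is Alice's, her message has already removed it; if it
    is Bob's, his second bit does.\<close>
  have "bits_exchanged (descend_B (answer_B y c') c') x y \<le> bits_exchanged c x y - 1"
  proof (cases c)
    case (Alice_Sends \<alpha>' t' u')
    then have "bits_exchanged c' x y = bits_exchanged c x y - 1" unfolding c'_def by simp
    then show ?thesis using descend_bits(2)[of y c' x] by simp
  qed (simp_all add: c'_def)
  then show ?thesis unfolding u b by simp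
qed simp

section \<open>Superdense coding\<close>

text \<open>\<open>J\<close> is a product in disguise, with coordinates \<open>rest\<close> and
  \<open>bits\<close> and inverse \<open>mk\<close>. The operator acts on \<open>bits\<close> and is
  controlled by \<open>rest\<close>, so its action is a sum over the few values of
  \<open>bits\<close> only. All gates of the simulation have this block diagonal form.\<close>

lemma lift_apply:
  fixes bits :: "'k \<Rightarrow> 'b::finite"
  assumes k: "rest k \<in> R" and fin: "finite J"
    and A: "\<And>l. l \<in> J \<Longrightarrow> rest l \<in> R \<and> mk (rest l) (bits l) = l"
    and B: "\<And>r b. r \<in> R \<Longrightarrow> mk r b \<in> J \<and> rest (mk r b) = r \<and> bits (mk r b) = b"
  shows "(\<Sum>l\<in>J. (if rest k = rest l then g (rest k) (bits k) (bits l) else 0) * f l)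
     = (\<Sum>b\<in>UNIV. g (rest k) (bits k) b * (f (mk (rest k) b) :: complex))"
proof -
  have "(\<Sum>l\<in>J. (if rest k = rest l then g (rest k) (bits k) (bits l) else 0) * f l)
     = (\<Sum>l\<in>mk (rest k) ` UNIV. (if rest k = rest l then g (rest k) (bits k) (bits l) else 0) * f l)"
  proof (rule sum.mono_neutral_right[OF fin])
    show "mk (rest k) ` UNIV \<subseteq> J" using B[OF k] by auto
    show "\<forall>l\<in>J - mk (rest k) ` UNIV. (if rest k = rest l then g (rest k) (bits k) (bits l) else 0) * f l = 0"
    proof
      fix l assume l: "l \<in> J - mk (rest k) ` UNIV"
      have "rest k \<noteq> rest l"
      proof
        assume "rest k = rest l"
        then have "l = mk (rest k) (bits l)" using A l by simp
        then show False using l by blast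
      qed
      then show "(if rest k = rest l then g (rest k) (bits k) (bits l) else 0) * f l = 0" by simp
    qed
  qed
  also have "\<dots> = (\<Sum>b\<in>UNIV. g (rest k) (bits k) b * f (mk (rest k) b))"
  proof -
    have "inj (mk (rest k))" using B[OF k] by (metis injI)
    then show ?thesis using B[OF k] by (simp add: sum.reindex)
  qed
  finally show ?thesis .
qed

lemma lift_unitary:
  fixes bits :: "'k \<Rightarrow> 'b::finite"
  assumes fin: "finite J"
    and A: "\<And>l. l \<in> J \<Longrightarrow> rest l \<in> R \<and> mk (rest l) (bits l) = l"
    and B: "\<And>r b. r \<in> R \<Longrightarrow> mk r b \<in> J \<and> rest (mk r b) = r \<and> bits (mk r b) = b"
    and g: "\<And>r. r \<in> R \<Longrightarrow> unitary_on UNIV (g r)"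
  shows "unitary_on J (\<lambda>k l. if rest k = rest l then g (rest k) (bits k) (bits l) else 0)"
  unfolding unitary_on_def
proof (intro ballI conjI)
  let ?U = "\<lambda>k l. if rest k = rest l then g (rest k) (bits k) (bits l) else 0"
  fix p q assume p: "p \<in> J" and q: "q \<in> J"
  have pR: "rest p \<in> R" using A p by blast
  have eq: "p = q \<longleftrightarrow> rest p = rest q \<and> bits p = bits q" using A p q by metis
  have "(\<Sum>k\<in>J. cnj (?U k p) * ?U k q) = (\<Sum>k\<in>J. (if rest p = rest k then cnj (g (rest p) (bits k) (bits p)) else 0) * ?U k q)"
    by (intro sum.cong refl) auto
  also have "\<dots> = (\<Sum>b\<in>UNIV. cnj (g (rest p) b (bits p)) * ?U (mk (rest p) b) q)"
    by (rule lift_apply[OF pR fin A B, where g = "\<lambda>r b b'. cnj (g r b' b)"])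
  also have "\<dots> = (\<Sum>b\<in>UNIV. if rest p = rest q then cnj (g (rest p) b (bits p)) * g (rest p) b (bits q) else 0)"
    using B[OF pR] by (intro sum.cong refl) auto
  also have "\<dots> = (if p = q then 1 else 0)"
    using g[OF pR] eq unfolding unitary_on_def by (cases "rest p = rest q") auto
  finally show "(\<Sum>k\<in>J. cnj (?U k p) * ?U k q) = (if p = q then 1 else 0)" .
  have "(\<Sum>k\<in>J. ?U p k * cnj (?U q k)) = (\<Sum>b\<in>UNIV. g (rest p) (bits p) b * cnj (?U q (mk (rest p) b)))"
    by (rule lift_apply[OF pR fin A B])
  also have "\<dots> = (\<Sum>b\<in>UNIV. if rest p = rest q then g (rest p) (bits p) b * cnj (g (rest p) (bits q) b) else 0)"
    using B[OF pR] by (intro sum.cong refl) auto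
  also have "\<dots> = (if p = q then 1 else 0)"
    using g[OF pR] eq unfolding unitary_on_def by (cases "rest p = rest q") auto
  finally show "(\<Sum>k\<in>J. ?U p k * cnj (?U q k)) = (if p = q then 1 else 0)" .
qed

section \<open>Encoding and decoding one message on a Bell pair\<close>

definition set_bit_to :: "nat \<Rightarrow> bool \<Rightarrow> nat set \<Rightarrow> nat set" where
  "set_bit_to s b v = (if b then insert s v else v - {s})"

lemma mem_set_bit_to [simp]: "t \<in> set_bit_to s b v \<longleftrightarrow> (if t = s then b else t \<in> v)"
  unfolding set_bit_to_def by auto

lemma set_bit_to_same [simp]: "set_bit_to s (s \<in> v) v = v" "set_bit_to s (s \<in> v) (v - {s}) = v"
  unfolding set_bit_to_def by auto

definition root_half :: complex where "root_half = of_real (1 / sqrt 2)"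

lemma root_half_square: "root_half * root_half = 1 / 2" "cnj root_half = root_half"
  unfolding root_half_def by (simp_all flip: of_real_mult)

text \<open>Superdense coding: \<open>pauli_gate m\<close> flips the bit if the first message bit is set and then changes
  the sign if the second one is; \<open>bell_gate\<close>, acting on the pair of the received qubit and its
  entangled partner, turns this into the second and the first message bit.\<close>

definition pauli_gate :: "bool \<times> bool \<Rightarrow> bool \<Rightarrow> bool \<Rightarrow> complex" where
  "pauli_gate m q b = (if snd m \<and> q then -1 else 1) * of_bool (b = (q \<noteq> fst m))"

definition bell_gate :: "bool \<times> bool \<Rightarrow> bool \<times> bool \<Rightarrow> complex" where
  "bell_gate k l = root_half * (if fst k \<and> fst l then -1 else 1) * of_bool (snd k = (fst l \<noteq> snd l))"

lemma unitary_pauli_gate: "unitary_on UNIV (pauli_gate m)"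
  unfolding unitary_on_def pauli_gate_def UNIV_bool by (cases m) auto

lemma sum_bool_pair: "(\<Sum>b\<in>(UNIV :: (bool \<times> bool) set). h b) = h (False, False) + h (False, True) + h (True, False) + h (True, True)"
  for h :: "bool \<times> bool \<Rightarrow> complex"
  unfolding UNIV_Times_UNIV[symmetric] sum.cartesian_product' UNIV_bool by (simp add: add_ac)

lemma unitary_bell_gate: "unitary_on UNIV bell_gate"
  unfolding unitary_on_def sum_bool_pair bell_gate_def by (auto simp: root_half_square)

text \<open>The joint amplitude of channel qubit \<open>t\<close> and its partner in the three
  phases of message \<open>t\<close>: once decoded, the pair is the basis state that holds the
  message; while encoded, it is the Bell state labelled by the message; before that, it is a fresh
  pair of maximally entangled qubits.\<close>

definition amplitude :: "nat \<Rightarrow> bool \<Rightarrow> (nat \<Rightarrow> bool \<times> bool) \<Rightarrow> nat \<Rightarrow> bool \<Rightarrow> bool \<Rightarrow> complex" where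
  "amplitude s k m t ch pt = (if t < s then of_bool (pt = fst (m t) \<and> ch = snd (m t))
     else if t = s \<and> k then root_half * (if snd (m t) \<and> ch then -1 else 1) * of_bool (ch = (pt \<noteq> fst (m t)))
     else root_half * of_bool (ch = pt))"

definition qubit_factor :: "bool \<Rightarrow> nat \<Rightarrow> bool \<Rightarrow> (nat \<Rightarrow> bool \<times> bool) \<Rightarrow> nat set \<Rightarrow> nat set \<Rightarrow> nat set \<Rightarrow> nat \<Rightarrow> complex" where
  "qubit_factor \<pi> s k m u w u' t = (if even t = \<pi> then of_bool (t \<notin> u) * amplitude s k m t (t \<in> w) (t \<in> u')
     else of_bool (t \<notin> u') * amplitude s k m t (t \<in> w) (t \<in> u))"

text \<open>Message \<open>t\<close> is sent by the party with \<open>even t = \<pi>\<close>, where \<open>\<pi>\<close> is \<open>True\<close> for Alice. The receiver's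
  workspace contains the seed and, as bit \<open>t\<close>, the partner of channel qubit \<open>t\<close>; bit \<open>c\<close> is reserved
  for the output. The argument \<open>s\<close> counts the messages already decoded, and \<open>k\<close> says that
  message \<open>s\<close> is encoded. In \<open>joint_state\<close>, the first workspace belongs to the party \<open>\<pi>\<close>.\<close>

definition joint_state :: "('e \<Rightarrow> real) \<Rightarrow> nat \<Rightarrow> bool \<Rightarrow> nat \<Rightarrow> bool \<Rightarrow> ('e \<Rightarrow> nat \<Rightarrow> bool \<times> bool) \<Rightarrow>
    'e \<times> nat set \<Rightarrow> nat set \<Rightarrow> 'e \<times> nat set \<Rightarrow> complex" where
  "joint_state p c \<pi> s k mm A w B = (if fst A = fst B \<and> c \<notin> snd A \<and> c \<notin> snd B
     then of_real (sqrt (p (fst A))) * (\<Prod>t<c. qubit_factor \<pi> s k (mm (fst A)) (snd A) w (snd B) t) else 0)"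

lemma joint_state_swap: "joint_state p c \<pi> s k mm A w B = joint_state p c (\<not> \<pi>) s k mm B w A"
proof -
  have "qubit_factor \<pi> s k m u w u' t = qubit_factor (\<not> \<pi>) s k m u' w u t" for m u u' t
    unfolding qubit_factor_def by auto
  then show ?thesis unfolding joint_state_def by auto
qed

text \<open>The message depends on earlier ones, which the sender knows only through its own
  registers. Wherever these registers do not show the true messages the amplitude vanishes, so the
  gate has to be the right one only on the support of the state.\<close>

lemma joint_state_encode:
  assumes s: "s < c" "even s = \<pi>"
    and M: "(\<And>t. t < s \<Longrightarrow> even t \<noteq> \<pi> \<Longrightarrow> (t \<in> u, t \<in> w) = mm e t) \<Longrightarrow> M = mm e s"
  shows "(\<Sum>b\<in>UNIV. pauli_gate M (s \<in> w) b * joint_state p c \<pi> s False mm (e, u) (set_bit_to s b w) B)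
     = joint_state p c \<pi> s True mm (e, u) w B"
proof -
  obtain e' u' where B: "B = (e', u')" by fastforce
  define Q where "Q = (\<Prod>t\<in>{..<c}-{s}. qubit_factor \<pi> s True (mm e) u w u' t)"
  have split: "(\<Prod>t<c. F t) = F s * (\<Prod>t\<in>{..<c}-{s}. F t)" for F :: "nat \<Rightarrow> complex"
    using s by (simp add: prod.remove)
  have Qb: "(\<Prod>t\<in>{..<c}-{s}. qubit_factor \<pi> s False (mm e) u (set_bit_to s b w) u' t) = Q" for b
    unfolding Q_def by (rule prod.cong[OF refl]) (auto simp: qubit_factor_def amplitude_def)
  have F0: "qubit_factor \<pi> s False (mm e) u (set_bit_to s b w) u' s = of_bool (s \<notin> u) * (root_half * of_bool (b = (s \<in> u')))" for b
    using s unfolding qubit_factor_def amplitude_def by auto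
  have F1: "qubit_factor \<pi> s True (mm e) u w u' s =
      of_bool (s \<notin> u) * (root_half * (if snd (mm e s) \<and> s \<in> w then -1 else 1) * of_bool ((s \<in> w) = ((s \<in> u') \<noteq> fst (mm e s))))"
    using s unfolding qubit_factor_def amplitude_def by auto
  show ?thesis
  proof (cases "e = e' \<and> c \<notin> u \<and> c \<notin> u' \<and> Q \<noteq> 0")
    case False
    then show ?thesis unfolding joint_state_def B fst_conv snd_conv split Qb Q_def[symmetric] by auto
  next
    case True
    have "M = mm e s"
    proof (rule M)
      fix t assume t: "t < s" "even t \<noteq> \<pi>"
      have "qubit_factor \<pi> s True (mm e) u w u' t \<noteq> 0"
        using True t s unfolding Q_def by (auto simp: prod_zero_iff)
      then show "(t \<in> u, t \<in> w) = mm e t"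
        using t unfolding qubit_factor_def amplitude_def by (cases "mm e t") (auto split: if_splits)
    qed
    then show ?thesis using True s
      unfolding joint_state_def B fst_conv snd_conv split Qb Q_def[symmetric] F0 F1 UNIV_bool pauli_gate_def
      by (cases "fst (mm e s)"; cases "snd (mm e s)"; cases "s \<in> w"; cases "s \<in> u'") auto
  qed
qed

lemma joint_state_decode:
  assumes s: "s < c" "even s \<noteq> \<pi>"
  shows "(\<Sum>b\<in>UNIV. bell_gate (s \<in> w, s \<in> u) b * joint_state p c \<pi> s True mm (e, set_bit_to s (snd b) u) (set_bit_to s (fst b) w) B)
     = joint_state p c \<pi> (Suc s) False mm (e, u) w B"
proof -
  obtain e' u' where B: "B = (e', u')" by fastforce
  define Q where "Q = (\<Prod>t\<in>{..<c}-{s}. qubit_factor \<pi> (Suc s) False (mm e) u w u' t)"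
  have split: "(\<Prod>t<c. F t) = F s * (\<Prod>t\<in>{..<c}-{s}. F t)" for F :: "nat \<Rightarrow> complex"
    using s by (simp add: prod.remove)
  have Qb: "(\<Prod>t\<in>{..<c}-{s}. qubit_factor \<pi> s True (mm e) (set_bit_to s b' u) (set_bit_to s b w) u' t) = Q" for b b'
    unfolding Q_def by (rule prod.cong[OF refl]) (auto simp: qubit_factor_def amplitude_def)
  have F0: "qubit_factor \<pi> s True (mm e) (set_bit_to s b' u) (set_bit_to s b w) u' s =
      of_bool (s \<notin> u') * (root_half * (if snd (mm e s) \<and> b then -1 else 1) * of_bool (b = (b' \<noteq> fst (mm e s))))" for b b'
    using s unfolding qubit_factor_def amplitude_def by auto
  have F1: "qubit_factor \<pi> (Suc s) False (mm e) u w u' s =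
      of_bool (s \<notin> u') * of_bool ((s \<in> u) = fst (mm e s) \<and> (s \<in> w) = snd (mm e s))"
    using s unfolding qubit_factor_def amplitude_def by auto
  have cs: "c \<noteq> s" using s by simp
  show ?thesis
  proof (cases "e = e' \<and> c \<notin> u \<and> c \<notin> u'")
    case False
    then show ?thesis using cs unfolding joint_state_def B by auto
  next
    case True
    let ?C = "complex_of_real (sqrt (p e)) * (of_bool (s \<notin> u') * Q)"
    have "(\<Sum>b\<in>UNIV. bell_gate (s \<in> w, s \<in> u) b * joint_state p c \<pi> s True mm (e, set_bit_to s (snd b) u) (set_bit_to s (fst b) w) B)
      = ?C * (\<Sum>b\<in>UNIV. bell_gate (s \<in> w, s \<in> u) b * (root_half * (if snd (mm e s) \<and> fst b then -1 else 1) * of_bool (fst b = (snd b \<noteq> fst (mm e s)))))"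
      unfolding sum_distrib_left using True cs
      unfolding joint_state_def B fst_conv snd_conv split Qb F0
      by (intro sum.cong refl) simp
    also have "(\<Sum>b\<in>UNIV. bell_gate (s \<in> w, s \<in> u) b * (root_half * (if snd (mm e s) \<and> fst b then -1 else 1) * of_bool (fst b = (snd b \<noteq> fst (mm e s)))))
      = of_bool ((s \<in> u) = fst (mm e s) \<and> (s \<in> w) = snd (mm e s))"
      unfolding sum_bool_pair bell_gate_def
      by (cases "fst (mm e s)"; cases "snd (mm e s)"; cases "s \<in> w"; cases "s \<in> u") (auto simp: root_half_square)
    also have "?C * of_bool ((s \<in> u) = fst (mm e s) \<and> (s \<in> w) = snd (mm e s)) = joint_state p c \<pi> (Suc s) False mm (e, u) w B"
      using True unfolding joint_state_def B fst_conv snd_conv split F1 Q_def[symmetric] by simp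
    finally show ?thesis .
  qed
qed

section \<open>The alternating protocol\<close>

lemma set_bit_to_diff [simp]: "set_bit_to s b (v - {s}) = set_bit_to s b v"
  unfolding set_bit_to_def by auto

lemma set_bit_to_minus [simp]: "set_bit_to s b v - {s} = v - {s}"
  unfolding set_bit_to_def by auto

lemma set_bit_to_subset: "v \<subseteq> A \<Longrightarrow> s \<in> A \<Longrightarrow> set_bit_to s b v \<subseteq> A"
  unfolding set_bit_to_def by auto

definition received :: "bool \<Rightarrow> nat \<Rightarrow> nat set \<Rightarrow> nat set \<Rightarrow> nat \<Rightarrow> bool \<times> bool" where
  "received \<pi> s u v t = (t < s \<and> even t \<noteq> \<pi> \<and> t \<in> u, t < s \<and> even t \<noteq> \<pi> \<and> t \<in> v)"

text \<open>Workspaces in the protocol model have basis \<open>{..<d}\<close>, so \<open>dec\<close>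
  and \<open>enc\<close> number the actual basis: a seed together with \<open>c + 1\<close> bits,
  one for each message and bit \<open>c\<close> for the output.\<close>

locale superdense_coding =
  fixes E :: "'e set" and p :: "'e \<Rightarrow> real" and c d :: nat
    and dec :: "nat \<Rightarrow> 'e \<times> nat set" and enc :: "'e \<times> nat set \<Rightarrow> nat"
  assumes finE: "finite E" and p_nonneg: "\<And>e. p e \<ge> 0" and p_sum: "(\<Sum>e\<in>E. p e) = 1"
    and dec: "\<And>i. i < d \<Longrightarrow> dec i \<in> E \<times> Pow {..c} \<and> enc (dec i) = i"
    and enc: "\<And>e u. e \<in> E \<Longrightarrow> u \<subseteq> {..c} \<Longrightarrow> enc (e, u) < d \<and> dec (enc (e, u)) = (e, u)"
begin

definition encode_op :: "bool \<Rightarrow> nat \<Rightarrow> ('e \<Rightarrow> nat \<Rightarrow> (nat \<Rightarrow> bool \<times> bool) \<Rightarrow> bool \<times> bool) \<Rightarrow> local_op" where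
  "encode_op \<pi> s \<mu> = (\<lambda>k l. if (fst k, snd k - {s}) = (fst l, snd l - {s})
     then (\<lambda>r. pauli_gate (\<mu> (fst (dec (fst r))) s (received \<pi> s (snd (dec (fst r))) (snd r))))
       (fst k, snd k - {s}) (s \<in> snd k) (s \<in> snd l) else 0)"

definition decode_op :: "nat \<Rightarrow> local_op" where
  "decode_op s = (\<lambda>k l. if (fst (dec (fst k)), snd (dec (fst k)) - {s}, snd k - {s}) = (fst (dec (fst l)), snd (dec (fst l)) - {s}, snd l - {s})
     then (\<lambda>r. bell_gate) (fst (dec (fst k)), snd (dec (fst k)) - {s}, snd k - {s})
       (s \<in> snd k, s \<in> snd (dec (fst k))) (s \<in> snd l, s \<in> snd (dec (fst l))) else 0)"

definition output_op :: "('e \<Rightarrow> (nat \<Rightarrow> bool \<times> bool) \<Rightarrow> bool) \<Rightarrow> local_op" where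
  "output_op out = (\<lambda>k l. if (fst (dec (fst k)), snd (dec (fst k)) - {c}, snd k) = (fst (dec (fst l)), snd (dec (fst l)) - {c}, snd l)
     then (\<lambda>r. pauli_gate (out (fst r) (\<lambda>t. (t \<in> fst (snd r), t \<in> snd (snd r))), False))
       (fst (dec (fst k)), snd (dec (fst k)) - {c}, snd k) (c \<in> snd (dec (fst k))) (c \<in> snd (dec (fst l))) else 0)"

lemma dec_simps:
  assumes "e \<in> E" "u \<subseteq> {..c}"
  shows "enc (e, u) < d" "dec (enc (e, u)) = (e, u)"
  using enc[OF assms] by simp_all

lemma dec_mem:
  assumes "i < d"
  shows "fst (dec i) \<in> E" "snd (dec i) \<subseteq> {..c}" "enc (fst (dec i), snd (dec i)) = i"
  using dec[OF assms] by (auto simp: mem_Times_iff)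

lemma encode_lift:
  assumes "s \<in> G"
  shows "\<And>l. l \<in> local_basis d G \<Longrightarrow> (fst l, snd l - {s}) \<in> {..<d} \<times> Pow (G - {s}) \<and>
      (\<lambda>r b. (fst r, set_bit_to s b (snd r))) (fst l, snd l - {s}) (s \<in> snd l) = l"
    and "\<And>r b. r \<in> {..<d} \<times> Pow (G - {s}) \<Longrightarrow> (fst r, set_bit_to s b (snd r)) \<in> local_basis d G \<and>
      (fst (fst r, set_bit_to s b (snd r)), snd (fst r, set_bit_to s b (snd r)) - {s}) = r \<and>
      (s \<in> snd (fst r, set_bit_to s b (snd r))) = b"
  using assms unfolding local_basis_def by (auto simp: set_bit_to_def split: if_splits)

lemma decode_lift:
  assumes "s \<in> G" "s \<le> c"
  shows "\<And>l. l \<in> local_basis d G \<Longrightarrow>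
      (fst (dec (fst l)), snd (dec (fst l)) - {s}, snd l - {s}) \<in> E \<times> Pow ({..c} - {s}) \<times> Pow (G - {s}) \<and>
      (\<lambda>r b. (enc (fst r, set_bit_to s (snd b) (fst (snd r))), set_bit_to s (fst b) (snd (snd r))))
        (fst (dec (fst l)), snd (dec (fst l)) - {s}, snd l - {s}) (s \<in> snd l, s \<in> snd (dec (fst l))) = l"
    and "\<And>r b. r \<in> E \<times> Pow ({..c} - {s}) \<times> Pow (G - {s}) \<Longrightarrow>
      (enc (fst r, set_bit_to s (snd b) (fst (snd r))), set_bit_to s (fst b) (snd (snd r))) \<in> local_basis d G \<and>
      (\<lambda>l. (fst (dec (fst l)), snd (dec (fst l)) - {s}, snd l - {s}))
        (enc (fst r, set_bit_to s (snd b) (fst (snd r))), set_bit_to s (fst b) (snd (snd r))) = r \<and>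
      (\<lambda>l. (s \<in> snd l, s \<in> snd (dec (fst l)))) (enc (fst r, set_bit_to s (snd b) (fst (snd r))), set_bit_to s (fst b) (snd (snd r))) = b"
proof -
  fix l assume "l \<in> local_basis d G"
  then have l: "fst l < d" "snd l \<subseteq> G" unfolding local_basis_def by auto
  show "(fst (dec (fst l)), snd (dec (fst l)) - {s}, snd l - {s}) \<in> E \<times> Pow ({..c} - {s}) \<times> Pow (G - {s}) \<and>
      (\<lambda>r b. (enc (fst r, set_bit_to s (snd b) (fst (snd r))), set_bit_to s (fst b) (snd (snd r))))
        (fst (dec (fst l)), snd (dec (fst l)) - {s}, snd l - {s}) (s \<in> snd l, s \<in> snd (dec (fst l))) = l"
    using dec_mem[OF l(1)] l(2) by auto
next
  fix r :: "'e \<times> nat set \<times> nat set" and b :: "bool \<times> bool" assume r: "r \<in> E \<times> Pow ({..c} - {s}) \<times> Pow (G - {s})"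
  obtain e u v where r_eq: "r = (e, u, v)" by (cases r)
  have u: "u \<subseteq> {..c}" "v \<subseteq> G" "e \<in> E" "u - {s} = u" "v - {s} = v" using r unfolding r_eq by auto
  have u': "set_bit_to s (snd b) u \<subseteq> {..c}" using u assms(2) by (intro set_bit_to_subset) auto
  have v': "set_bit_to s (fst b) v \<subseteq> G" using u assms(1) by (intro set_bit_to_subset) auto
  show "(enc (fst r, set_bit_to s (snd b) (fst (snd r))), set_bit_to s (fst b) (snd (snd r))) \<in> local_basis d G \<and>
      (\<lambda>l. (fst (dec (fst l)), snd (dec (fst l)) - {s}, snd l - {s}))
        (enc (fst r, set_bit_to s (snd b) (fst (snd r))), set_bit_to s (fst b) (snd (snd r))) = r \<and>
      (\<lambda>l. (s \<in> snd l, s \<in> snd (dec (fst l)))) (enc (fst r, set_bit_to s (snd b) (fst (snd r))), set_bit_to s (fst b) (snd (snd r))) = b"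
    using dec_simps[OF u(3) u'] v' u(4,5) unfolding r_eq local_basis_def by simp
qed

lemma output_lift:
  shows "\<And>l. l \<in> local_basis d G \<Longrightarrow>
      (fst (dec (fst l)), snd (dec (fst l)) - {c}, snd l) \<in> E \<times> Pow ({..c} - {c}) \<times> Pow G \<and>
      (\<lambda>r b. (enc (fst r, set_bit_to c b (fst (snd r))), snd (snd r)))
        (fst (dec (fst l)), snd (dec (fst l)) - {c}, snd l) (c \<in> snd (dec (fst l))) = l"
    and "\<And>r b. r \<in> E \<times> Pow ({..c} - {c}) \<times> Pow G \<Longrightarrow>
      (enc (fst r, set_bit_to c b (fst (snd r))), snd (snd r)) \<in> local_basis d G \<and>
      (\<lambda>l. (fst (dec (fst l)), snd (dec (fst l)) - {c}, snd l)) (enc (fst r, set_bit_to c b (fst (snd r))), snd (snd r)) = r \<and>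
      (\<lambda>l. c \<in> snd (dec (fst l))) (enc (fst r, set_bit_to c b (fst (snd r))), snd (snd r)) = b"
proof -
  fix l assume "l \<in> local_basis d G"
  then have l: "fst l < d" "snd l \<subseteq> G" unfolding local_basis_def by auto
  show "(fst (dec (fst l)), snd (dec (fst l)) - {c}, snd l) \<in> E \<times> Pow ({..c} - {c}) \<times> Pow G \<and>
      (\<lambda>r b. (enc (fst r, set_bit_to c b (fst (snd r))), snd (snd r)))
        (fst (dec (fst l)), snd (dec (fst l)) - {c}, snd l) (c \<in> snd (dec (fst l))) = l"
    using dec_mem[OF l(1)] l(2) by auto
next
  fix r :: "'e \<times> nat set \<times> nat set" and b :: bool assume r: "r \<in> E \<times> Pow ({..c} - {c}) \<times> Pow G"
  obtain e u v where r_eq: "r = (e, u, v)" by (cases r)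
  have u: "u \<subseteq> {..c}" "v \<subseteq> G" "e \<in> E" "u - {c} = u" using r unfolding r_eq by auto
  have u': "set_bit_to c b u \<subseteq> {..c}" using u by (intro set_bit_to_subset) auto
  show "(enc (fst r, set_bit_to c b (fst (snd r))), snd (snd r)) \<in> local_basis d G \<and>
      (\<lambda>l. (fst (dec (fst l)), snd (dec (fst l)) - {c}, snd l)) (enc (fst r, set_bit_to c b (fst (snd r))), snd (snd r)) = r \<and>
      (\<lambda>l. c \<in> snd (dec (fst l))) (enc (fst r, set_bit_to c b (fst (snd r))), snd (snd r)) = b"
    using dec_simps[OF u(3) u'] u(2,4) unfolding r_eq local_basis_def by simp
qed

lemma fin_lb: "G \<subseteq> {..<c} \<Longrightarrow> finite (local_basis d G)"
  unfolding local_basis_def by (simp add: finite_subset)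

lemma unitary_ops:
  assumes G: "G \<subseteq> {..<c}"
  shows "s \<in> G \<Longrightarrow> unitary_on (local_basis d G) (encode_op \<pi> s \<mu>)"
    and "s \<in> G \<Longrightarrow> unitary_on (local_basis d G) (decode_op s)"
    and "unitary_on (local_basis d G) (output_op out)"
proof -
  assume s: "s \<in> G"
  then have sc: "s \<le> c" using G by auto
  show "unitary_on (local_basis d G) (encode_op \<pi> s \<mu>)"
    unfolding encode_op_def
    by (rule lift_unitary[where rest = "\<lambda>k. (fst k, snd k - {s})" and bits = "\<lambda>k. s \<in> snd k", OF fin_lb[OF G] encode_lift[OF s]])
       (assumption | rule unitary_pauli_gate)+
  show "unitary_on (local_basis d G) (decode_op s)"
    unfolding decode_op_def
    by (rule lift_unitary[where rest = "\<lambda>k. (fst (dec (fst k)), snd (dec (fst k)) - {s}, snd k - {s})"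
          and bits = "\<lambda>k. (s \<in> snd k, s \<in> snd (dec (fst k)))", OF fin_lb[OF G] decode_lift[OF s sc]])
       (assumption | rule unitary_bell_gate)+
next
  show "unitary_on (local_basis d G) (output_op out)"
    unfolding output_op_def
    by (rule lift_unitary[where rest = "\<lambda>k. (fst (dec (fst k)), snd (dec (fst k)) - {c}, snd k)"
          and bits = "\<lambda>k. c \<in> snd (dec (fst k))", OF fin_lb[OF G] output_lift])
       (assumption | rule unitary_pauli_gate)+
qed

lemma encode_apply:
  assumes "G \<subseteq> {..<c}" "s \<in> G" "i < d" "v \<subseteq> G"
  shows "(\<Sum>l\<in>local_basis d G. encode_op \<pi> s \<mu> (i, v) l * f l) =
    (\<Sum>b\<in>UNIV. pauli_gate (\<mu> (fst (dec i)) s (received \<pi> s (snd (dec i)) (v - {s}))) (s \<in> v) b * f (i, set_bit_to s b v))"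
proof -
  have k: "(fst (i, v), snd (i, v) - {s}) \<in> {..<d} \<times> Pow (G - {s})" using assms by auto
  show ?thesis unfolding encode_op_def
    using lift_apply[where rest = "\<lambda>k. (fst k, snd k - {s})" and bits = "\<lambda>k. s \<in> snd k",
        OF k fin_lb[OF assms(1)] encode_lift[OF assms(2)],
        of "\<lambda>r. pauli_gate (\<mu> (fst (dec (fst r))) s (received \<pi> s (snd (dec (fst r))) (snd r)))" f] by simp
qed

lemma decode_apply:
  assumes "G \<subseteq> {..<c}" "s \<in> G" "i < d" "v \<subseteq> G"
  shows "(\<Sum>l\<in>local_basis d G. decode_op s (i, v) l * f l) =
    (\<Sum>b\<in>UNIV. bell_gate (s \<in> v, s \<in> snd (dec i)) b * f (enc (fst (dec i), set_bit_to s (snd b) (snd (dec i))), set_bit_to s (fst b) v))"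
proof -
  have sc: "s \<le> c" using assms by auto
  have k: "(fst (dec (fst (i, v))), snd (dec (fst (i, v))) - {s}, snd (i, v) - {s}) \<in> E \<times> Pow ({..c} - {s}) \<times> Pow (G - {s})"
    using assms dec_mem[OF assms(3)] by auto
  show ?thesis unfolding decode_op_def
    using lift_apply[where rest = "\<lambda>k. (fst (dec (fst k)), snd (dec (fst k)) - {s}, snd k - {s})"
        and bits = "\<lambda>k. (s \<in> snd k, s \<in> snd (dec (fst k)))",
        OF k fin_lb[OF assms(1)] decode_lift[OF assms(2) sc], of "\<lambda>r. bell_gate" f] by simp
qed

lemma output_apply:
  assumes "G \<subseteq> {..<c}" "i < d" "v \<subseteq> G"
  shows "(\<Sum>l\<in>local_basis d G. output_op out (i, v) l * f l) =
    (\<Sum>b\<in>UNIV. pauli_gate (out (fst (dec i)) (\<lambda>t. (t \<in> snd (dec i) - {c}, t \<in> v)), False) (c \<in> snd (dec i)) b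
       * f (enc (fst (dec i), set_bit_to c b (snd (dec i))), v))"
proof -
  have k: "(fst (dec (fst (i, v))), snd (dec (fst (i, v))) - {c}, snd (i, v)) \<in> E \<times> Pow ({..c} - {c}) \<times> Pow G"
    using assms dec_mem[OF assms(2)] by auto
  show ?thesis unfolding output_op_def
    using lift_apply[where rest = "\<lambda>k. (fst (dec (fst k)), snd (dec (fst k)) - {c}, snd k)"
        and bits = "\<lambda>k. c \<in> snd (dec (fst k))",
        OF k fin_lb[OF assms(1)] output_lift,
        of "\<lambda>r. pauli_gate (out (fst r) (\<lambda>t. (t \<in> fst (snd r), t \<in> snd (snd r))), False)" f] by simp
qed

lemma set_bit_split: "s \<in> G \<Longrightarrow> set_bit_to s b (w \<inter> G) \<union> (w - G) = set_bit_to s b w"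
  unfolding set_bit_to_def by auto

text \<open>Formulated for an anonymous sender who holds the qubits in \<open>G\<close>: Alice uses
  it with \<open>\<pi>\<close> true, Bob with \<open>\<pi>\<close> false and the two workspaces
  exchanged by \<open>joint_state_swap\<close>.\<close>

lemma encode_step:
  assumes \<Psi>: "\<And>i w j. i < d \<Longrightarrow> w \<subseteq> {..<c} \<Longrightarrow> j < d \<Longrightarrow> \<Psi> i w j = joint_state p c \<pi> s False mm (dec i) w (dec j)"
    and G: "G \<subseteq> {..<c}" "s \<in> G" "\<And>t. t < s \<Longrightarrow> even t \<noteq> \<pi> \<Longrightarrow> t \<in> G" and s: "even s = \<pi>"
    and \<mu>: "\<And>e R. e \<in> E \<Longrightarrow> (\<And>t. t < s \<Longrightarrow> even t \<noteq> \<pi> \<Longrightarrow> R t = mm e t) \<Longrightarrow> \<mu> e s R = mm e s"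
    and i: "i < d" "w \<subseteq> {..<c}" "j < d"
  shows "(\<Sum>l\<in>local_basis d G. encode_op \<pi> s \<mu> (i, w \<inter> G) l * \<Psi> (fst l) (snd l \<union> (w - G)) j)
     = joint_state p c \<pi> s True mm (dec i) w (dec j)"
proof -
  obtain e u where eu: "dec i = (e, u)" by fastforce
  have eE: "e \<in> E" using dec_mem[OF i(1)] eu by simp
  have sc: "s < c" using G by auto
  let ?M = "\<mu> e s (received \<pi> s u (w \<inter> G - {s}))"
  have "(\<Sum>l\<in>local_basis d G. encode_op \<pi> s \<mu> (i, w \<inter> G) l * \<Psi> (fst l) (snd l \<union> (w - G)) j)
     = (\<Sum>b\<in>UNIV. pauli_gate ?M (s \<in> w) b * \<Psi> i (set_bit_to s b w) j)"
    using G(2) by (subst encode_apply[OF G(1,2) i(1)]) (auto simp: eu set_bit_split)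
  also have "\<dots> = (\<Sum>b\<in>UNIV. pauli_gate ?M (s \<in> w) b * joint_state p c \<pi> s False mm (e, u) (set_bit_to s b w) (dec j))"
    using i sc by (intro sum.cong refl) (simp add: \<Psi> eu set_bit_to_subset)
  also have "\<dots> = joint_state p c \<pi> s True mm (e, u) w (dec j)"
  proof (rule joint_state_encode[OF sc s])
    assume *: "\<And>t. t < s \<Longrightarrow> even t \<noteq> \<pi> \<Longrightarrow> (t \<in> u, t \<in> w) = mm e t"
    show "?M = mm e s"
    proof (rule \<mu>[OF eE])
      fix t assume t: "t < s" "even t \<noteq> \<pi>"
      then have "t \<in> G" "t \<noteq> s" using G(3) by auto
      then show "received \<pi> s u (w \<inter> G - {s}) t = mm e t"
        unfolding *[OF t, symmetric] received_def using t by simp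
    qed
  qed
  finally show ?thesis unfolding eu .
qed

lemma decode_step:
  assumes \<Psi>: "\<And>i w j. i < d \<Longrightarrow> w \<subseteq> {..<c} \<Longrightarrow> j < d \<Longrightarrow> \<Psi> i w j = joint_state p c \<pi> s True mm (dec i) w (dec j)"
    and G: "G \<subseteq> {..<c}" "s \<in> G" and s: "even s \<noteq> \<pi>"
    and i: "i < d" "w \<subseteq> {..<c}" "j < d"
  shows "(\<Sum>l\<in>local_basis d G. decode_op s (i, w \<inter> G) l * \<Psi> (fst l) (snd l \<union> (w - G)) j)
     = joint_state p c \<pi> (Suc s) False mm (dec i) w (dec j)"
proof -
  obtain e u where eu: "dec i = (e, u)" by fastforce
  have eE: "e \<in> E" "u \<subseteq> {..c}" using dec_mem[OF i(1)] eu by simp_all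
  have sc: "s < c" using G by auto
  have u': "set_bit_to s b u \<subseteq> {..c}" for b using eE sc by (intro set_bit_to_subset) auto
  have "(\<Sum>l\<in>local_basis d G. decode_op s (i, w \<inter> G) l * \<Psi> (fst l) (snd l \<union> (w - G)) j)
     = (\<Sum>b\<in>UNIV. bell_gate (s \<in> w, s \<in> u) b * \<Psi> (enc (e, set_bit_to s (snd b) u)) (set_bit_to s (fst b) w) j)"
    using G(2) by (subst decode_apply[OF G(1,2) i(1)]) (auto simp: eu set_bit_split)
  also have "\<dots> = (\<Sum>b\<in>UNIV. bell_gate (s \<in> w, s \<in> u) b * joint_state p c \<pi> s True mm (e, set_bit_to s (snd b) u) (set_bit_to s (fst b) w) (dec j))"
    using i sc by (intro sum.cong refl) (simp add: \<Psi> dec_simps[OF eE(1) u'] set_bit_to_subset)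
  also have "\<dots> = joint_state p c \<pi> (Suc s) False mm (e, u) w (dec j)"
    by (rule joint_state_decode[OF sc s])
  finally show ?thesis unfolding eu .
qed

text \<open>Alice's channel qubits just before message \<open>s\<close>: her own that are still
  unsent (even \<open>t \<ge> s\<close>) and those received from Bob (odd
  \<open>t < s\<close>).\<close>

definition alice_qubits :: "nat \<Rightarrow> nat set" where
  "alice_qubits s = {t. t < c \<and> even t = (s \<le> t)}"

definition is_state :: "nat \<Rightarrow> bool \<Rightarrow> ('e \<Rightarrow> nat \<Rightarrow> bool \<times> bool) \<Rightarrow> qstate \<Rightarrow> bool" where
  "is_state s k mm \<psi> \<longleftrightarrow> (\<forall>i w j. i < d \<longrightarrow> w \<subseteq> {..<c} \<longrightarrow> j < d \<longrightarrow> \<psi> (i, w, j) = joint_state p c True s k mm (dec i) w (dec j))"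

lemma alice_qubits_sub: "alice_qubits s \<subseteq> {..<c}"
  unfolding alice_qubits_def by auto

lemma Alice_encodes:
  assumes st: "is_state s False mm \<psi>" and s: "s < c" "even s"
    and \<mu>: "\<And>e R. e \<in> E \<Longrightarrow> (\<And>t. t < s \<Longrightarrow> odd t \<Longrightarrow> R t = mm e t) \<Longrightarrow> \<mu> e s R = mm e s"
  shows "is_state s True mm (apply_Alice d (alice_qubits s) (encode_op True s \<mu>) \<psi>)"
  unfolding is_state_def
proof (intro allI impI)
  fix i w j assume i: "i < d" "w \<subseteq> {..<c}" "j < d"
  have "(\<Sum>l\<in>local_basis d (alice_qubits s). encode_op True s \<mu> (i, w \<inter> alice_qubits s) l * \<psi> (fst l, snd l \<union> (w - alice_qubits s), j))
     = joint_state p c True s True mm (dec i) w (dec j)"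
    by (rule encode_step[where \<Psi> = "\<lambda>i w j. \<psi> (i, w, j)", OF _ alice_qubits_sub])
      (use st s i \<mu> in \<open>auto simp: is_state_def alice_qubits_def\<close>)
  then show "apply_Alice d (alice_qubits s) (encode_op True s \<mu>) \<psi> (i, w, j) = joint_state p c True s True mm (dec i) w (dec j)"
    unfolding apply_Alice_def by (simp add: case_prod_unfold)
qed

lemma Bob_encodes:
  assumes st: "is_state s False mm \<psi>" and s: "s < c" "odd s"
    and \<mu>: "\<And>e R. e \<in> E \<Longrightarrow> (\<And>t. t < s \<Longrightarrow> even t \<Longrightarrow> R t = mm e t) \<Longrightarrow> \<mu> e s R = mm e s"
  shows "is_state s True mm (apply_Bob d ({..<c} - alice_qubits s) (encode_op False s \<mu>) \<psi>)"
  unfolding is_state_def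
proof (intro allI impI)
  let ?G = "{..<c} - alice_qubits s"
  fix i w j assume i: "i < d" "w \<subseteq> {..<c}" "j < d"
  have st': "\<psi> (i, w, j) = joint_state p c False s False mm (dec j) w (dec i)" if "i < d" "w \<subseteq> {..<c}" "j < d" for i w j
    using st that joint_state_swap[of p c True s False mm "dec i" w "dec j"] unfolding is_state_def by simp
  have "(\<Sum>l\<in>local_basis d ?G. encode_op False s \<mu> (j, w \<inter> ?G) l * \<psi> (i, snd l \<union> (w - ?G), fst l))
     = joint_state p c False s True mm (dec j) w (dec i)"
    by (rule encode_step[where \<Psi> = "\<lambda>j w i. \<psi> (i, w, j)", OF _ Diff_subset])
      (use st' s i \<mu> in \<open>auto simp: alice_qubits_def\<close>)
  also have "\<dots> = joint_state p c True s True mm (dec i) w (dec j)"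
    using joint_state_swap[of p c False s True mm "dec j" w "dec i"] by simp
  finally show "apply_Bob d ?G (encode_op False s \<mu>) \<psi> (i, w, j) = joint_state p c True s True mm (dec i) w (dec j)"
    unfolding apply_Bob_def by (simp add: case_prod_unfold)
qed

lemma Alice_decodes:
  assumes st: "is_state s True mm \<psi>" and s: "s < c" "odd s"
  shows "is_state (Suc s) False mm (apply_Alice d (alice_qubits (Suc s)) (decode_op s) \<psi>)"
  unfolding is_state_def
proof (intro allI impI)
  fix i w j assume i: "i < d" "w \<subseteq> {..<c}" "j < d"
  have "(\<Sum>l\<in>local_basis d (alice_qubits (Suc s)). decode_op s (i, w \<inter> alice_qubits (Suc s)) l * \<psi> (fst l, snd l \<union> (w - alice_qubits (Suc s)), j))
     = joint_state p c True (Suc s) False mm (dec i) w (dec j)"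
    by (rule decode_step[where \<Psi> = "\<lambda>i w j. \<psi> (i, w, j)", OF _ alice_qubits_sub])
      (use st s i in \<open>auto simp: is_state_def alice_qubits_def\<close>)
  then show "apply_Alice d (alice_qubits (Suc s)) (decode_op s) \<psi> (i, w, j) = joint_state p c True (Suc s) False mm (dec i) w (dec j)"
    unfolding apply_Alice_def by (simp add: case_prod_unfold)
qed

lemma Bob_decodes:
  assumes st: "is_state s True mm \<psi>" and s: "s < c" "even s"
  shows "is_state (Suc s) False mm (apply_Bob d ({..<c} - alice_qubits (Suc s)) (decode_op s) \<psi>)"
  unfolding is_state_def
proof (intro allI impI)
  let ?G = "{..<c} - alice_qubits (Suc s)"
  fix i w j assume i: "i < d" "w \<subseteq> {..<c}" "j < d"
  have st': "\<psi> (i, w, j) = joint_state p c False s True mm (dec j) w (dec i)" if "i < d" "w \<subseteq> {..<c}" "j < d" for i w j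
    using st that joint_state_swap[of p c True s True mm "dec i" w "dec j"] unfolding is_state_def by simp
  have "(\<Sum>l\<in>local_basis d ?G. decode_op s (j, w \<inter> ?G) l * \<psi> (i, snd l \<union> (w - ?G), fst l))
     = joint_state p c False (Suc s) False mm (dec j) w (dec i)"
    by (rule decode_step[where \<Psi> = "\<lambda>j w i. \<psi> (i, w, j)", OF _ Diff_subset])
      (use st' s i in \<open>auto simp: alice_qubits_def\<close>)
  also have "\<dots> = joint_state p c True (Suc s) False mm (dec i) w (dec j)"
    using joint_state_swap[of p c False "Suc s" False mm "dec j" w "dec i"] by simp
  finally show "apply_Bob d ?G (decode_op s) \<psi> (i, w, j) = joint_state p c True (Suc s) False mm (dec i) w (dec j)"
    unfolding apply_Bob_def by (simp add: case_prod_unfold)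
qed

definition message_steps ::
    "('x \<Rightarrow> 'e \<Rightarrow> nat \<Rightarrow> (nat \<Rightarrow> bool \<times> bool) \<Rightarrow> bool \<times> bool) \<Rightarrow> ('y \<Rightarrow> 'e \<Rightarrow> nat \<Rightarrow> (nat \<Rightarrow> bool \<times> bool) \<Rightarrow> bool \<times> bool) \<Rightarrow>
     nat \<Rightarrow> ('x, 'y) qstep list" where
  "message_steps \<mu>A \<mu>B s = (if even s
     then [Alice_Step (\<lambda>x. encode_op True s (\<mu>A x)) {s}, Bob_Step (\<lambda>_. decode_op s) {}]
     else [Bob_Step (\<lambda>y. encode_op False s (\<mu>B y)) {s}, Alice_Step (\<lambda>_. decode_op s) {}])"

lemma alice_qubits_Suc:
  "s < c \<Longrightarrow> even s \<Longrightarrow> s \<in> alice_qubits s" "s < c \<Longrightarrow> even s \<Longrightarrow> alice_qubits s - {s} = alice_qubits (Suc s)"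
  "s < c \<Longrightarrow> odd s \<Longrightarrow> s \<notin> alice_qubits s" "s < c \<Longrightarrow> odd s \<Longrightarrow> insert s (alice_qubits s) = alice_qubits (Suc s)"
  unfolding alice_qubits_def by (auto simp: Suc_le_eq order_less_le)

lemma valid_message_steps:
  assumes "s \<le> c" "valid_steps X Y d c d (alice_qubits c) ss"
  shows "valid_steps X Y d c d (alice_qubits s) (concat (map (message_steps \<mu>A \<mu>B) [s..<c]) @ ss)"
  using assms(1)
proof (induction s rule: inc_induct)
  case base then show ?case using assms(2) by simp
next
  case (step s)
  have sub: "alice_qubits (Suc s) \<subseteq> {..<c}" by (rule alice_qubits_sub)
  show ?case
  proof (cases "even s")
    case True
    have "s \<notin> alice_qubits (Suc s)" using alice_qubits_Suc(2)[OF step(2) True] by blast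
    then show ?thesis using True step alice_qubits_Suc(1,2)[OF step(2) True]
      by (simp add: upt_conv_Cons message_steps_def unitary_ops[OF alice_qubits_sub] unitary_ops[OF Diff_subset])
  next
    case False
    have "s \<in> alice_qubits (Suc s)" using alice_qubits_Suc(4)[OF step(2) False] by blast
    then show ?thesis using False step alice_qubits_Suc(3,4)[OF step(2) False]
      by (simp add: upt_conv_Cons message_steps_def unitary_ops[OF alice_qubits_sub] unitary_ops[OF Diff_subset])
  qed
qed

lemma run_message_steps:
  assumes "s \<le> c" "is_state s False mm \<psi>"
    and \<mu>A: "\<And>e s R. e \<in> E \<Longrightarrow> s < c \<Longrightarrow> even s \<Longrightarrow> (\<And>t. t < s \<Longrightarrow> odd t \<Longrightarrow> R t = mm e t) \<Longrightarrow> \<mu>A x e s R = mm e s"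
    and \<mu>B: "\<And>e s R. e \<in> E \<Longrightarrow> s < c \<Longrightarrow> odd s \<Longrightarrow> (\<And>t. t < s \<Longrightarrow> even t \<Longrightarrow> R t = mm e t) \<Longrightarrow> \<mu>B y e s R = mm e s"
  shows "\<exists>\<psi>'. run_steps d c d x y (concat (map (message_steps \<mu>A \<mu>B) [s..<c]) @ ss) (alice_qubits s, \<psi>)
      = run_steps d c d x y ss (alice_qubits c, \<psi>') \<and> is_state c False mm \<psi>'"
  using assms(1,2)
proof (induction s arbitrary: \<psi> rule: inc_induct)
  case base then show ?case by auto
next
  case (step s)
  show ?case
  proof (cases "even s")
    case True
    let ?\<psi>1 = "apply_Alice d (alice_qubits s) (encode_op True s (\<mu>A x)) \<psi>"
    have "is_state s True mm ?\<psi>1"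
      by (rule Alice_encodes[OF step.prems step.hyps(2) True]) (use \<mu>A True step.hyps in auto)
    then have "is_state (Suc s) False mm (apply_Bob d ({..<c} - alice_qubits (Suc s)) (decode_op s) ?\<psi>1)"
      by (rule Bob_decodes[OF _ step.hyps(2) True])
    from step.IH[OF this] show ?thesis using True step.hyps alice_qubits_Suc(2)[OF step.hyps(2) True]
      by (simp add: upt_conv_Cons message_steps_def)
  next
    case False
    let ?\<psi>1 = "apply_Bob d ({..<c} - alice_qubits s) (encode_op False s (\<mu>B y)) \<psi>"
    have "is_state s True mm ?\<psi>1"
      by (rule Bob_encodes[OF step.prems step.hyps(2) False]) (use \<mu>B False step.hyps in auto)
    then have "is_state (Suc s) False mm (apply_Alice d (alice_qubits (Suc s)) (decode_op s) ?\<psi>1)"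
      by (rule Alice_decodes[OF _ step.hyps(2) False])
    from step.IH[OF this] show ?thesis using False step.hyps alice_qubits_Suc(4)[OF step.hyps(2) False]
      by (simp add: upt_conv_Cons message_steps_def)
  qed
qed

end

context superdense_coding
begin

definition start :: qstate where
  "start = (\<lambda>(i, w, j). joint_state p c True 0 False (\<lambda>_ _. (False, False)) (dec i) w (dec j))"

text \<open>While nothing is encoded the amplitudes do not depend on the messages, so one state,
  independent of the inputs, starts the run for every \<open>mm\<close>.\<close>

lemma start_is_state: "is_state 0 False mm start"
proof -
  have "qubit_factor \<pi> 0 False m = qubit_factor \<pi> 0 False m'" for \<pi> m m'
    unfolding qubit_factor_def amplitude_def by (intro ext) simp
  then have "joint_state p c True 0 False (\<lambda>_ _. (False, False)) A w B = joint_state p c True 0 False mm A w B" for A w B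
    unfolding joint_state_def by metis
  then show ?thesis unfolding is_state_def start_def by simp
qed

text \<open>The support consists of the points \<open>\<iota> (e, w)\<close>: the channel string
  \<open>w\<close> forces the partner bits, which Alice keeps for odd \<open>t\<close> and Bob for
  even \<open>t\<close>. Each point has squared modulus \<open>p e / 2 ^ c\<close>, and there are
  \<open>2 ^ c\<close> strings.\<close>

lemma start_norm: "(\<Sum>g\<in>global_basis d c d. (cmod (start g))\<^sup>2) = 1"
proof -
  define \<iota> where "\<iota> = (\<lambda>(e, w). (enc (e, {t\<in>w. odd t}), w, enc (e, {t\<in>w. even t})))"
  have sub: "{t\<in>w. odd t} \<subseteq> {..c}" "{t\<in>w. even t} \<subseteq> {..c}" if "w \<subseteq> {..<c}" for w using that by auto
  have fin: "finite (global_basis d c d)" unfolding global_basis_def by simp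
  have "(\<Sum>g\<in>global_basis d c d. (cmod (start g))\<^sup>2) = (\<Sum>g\<in>\<iota> ` (E \<times> Pow {..<c}). (cmod (start g))\<^sup>2)"
  proof (rule sum.mono_neutral_right[OF fin])
    show "\<iota> ` (E \<times> Pow {..<c}) \<subseteq> global_basis d c d"
      using dec_simps sub unfolding \<iota>_def global_basis_def by auto
    show "\<forall>g\<in>global_basis d c d - \<iota> ` (E \<times> Pow {..<c}). (cmod (start g))\<^sup>2 = 0"
    proof
      fix g assume g: "g \<in> global_basis d c d - \<iota> ` (E \<times> Pow {..<c})"
      obtain i w j where g_eq: "g = (i, w, j)" by (cases g)
      have ij: "i < d" "w \<subseteq> {..<c}" "j < d" using g unfolding g_eq global_basis_def by auto
      obtain e u where eu: "dec i = (e, u)" by fastforce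
      obtain e' u' where eu': "dec j = (e', u')" by fastforce
      have mem: "e \<in> E" "u \<subseteq> {..c}" "enc (e, u) = i" "u' \<subseteq> {..c}" "enc (e', u') = j"
        using dec_mem[OF ij(1)] dec_mem[OF ij(3)] eu eu' by simp_all
      have "start g = 0"
      proof (rule ccontr)
        assume nz: "start g \<noteq> 0"
        then have e: "e = e'" "c \<notin> u" "c \<notin> u'" and "(\<Prod>t<c. qubit_factor True 0 False (\<lambda>_. (False, False)) u w u' t) \<noteq> 0"
          unfolding g_eq start_def joint_state_def by (auto simp: eu eu' split: if_splits)
        then have f: "qubit_factor True 0 False (\<lambda>_. (False, False)) u w u' t \<noteq> 0" if "t < c" for t
          using that by (auto simp: prod_zero_iff)
        have lt: "t < c" if "t \<in> u \<or> t \<in> u'" for t using that e mem(2,4) by (auto simp: order_less_le)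
        have "u = {t\<in>w. odd t}"
        proof (intro set_eqI iffI)
          fix t assume "t \<in> u" then show "t \<in> {t\<in>w. odd t}" using f[of t] lt[of t]
            unfolding qubit_factor_def amplitude_def by (auto split: if_splits)
        next
          fix t assume "t \<in> {t\<in>w. odd t}" then show "t \<in> u" using f[of t] ij(2)
            unfolding qubit_factor_def amplitude_def by (auto split: if_splits)
        qed
        moreover have "u' = {t\<in>w. even t}"
        proof (intro set_eqI iffI)
          fix t assume "t \<in> u'" then show "t \<in> {t\<in>w. even t}" using f[of t] lt[of t]
            unfolding qubit_factor_def amplitude_def by (auto split: if_splits)
        next
          fix t assume "t \<in> {t\<in>w. even t}" then show "t \<in> u'" using f[of t] ij(2)
            unfolding qubit_factor_def amplitude_def by (auto split: if_splits)
        qed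
        ultimately have "g = \<iota> (e, w)" unfolding g_eq \<iota>_def using mem(3,5) e by simp
        then show False using g mem(1) ij(2) by blast
      qed
      then show "(cmod (start g))\<^sup>2 = 0" by simp
    qed
  qed
  also have "\<dots> = (\<Sum>\<pi>\<in>E \<times> Pow {..<c}. (cmod (start (\<iota> \<pi>)))\<^sup>2)"
  proof (rule sum.reindex_cong[OF _ refl refl])
    show "inj_on \<iota> (E \<times> Pow {..<c})"
    proof (rule inj_onI)
      fix \<pi> \<rho> assume pr: "\<pi> \<in> E \<times> Pow {..<c}" "\<rho> \<in> E \<times> Pow {..<c}" "\<iota> \<pi> = \<iota> \<rho>"
      obtain e w e' w' where eq: "\<pi> = (e, w)" "\<rho> = (e', w')" by (cases \<pi>, cases \<rho>)
      have "enc (e, {t\<in>w. odd t}) = enc (e', {t\<in>w'. odd t})" "w = w'" using pr(3) unfolding eq \<iota>_def by auto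
      then have "dec (enc (e, {t\<in>w. odd t})) = dec (enc (e', {t\<in>w'. odd t}))" by (simp only:)
      moreover have "e \<in> E" "w \<subseteq> {..<c}" "e' \<in> E" "w' \<subseteq> {..<c}" using pr(1,2) unfolding eq by simp_all
      ultimately have "e = e'" by (simp add: dec_simps(2) sub)
      then show "\<pi> = \<rho>" unfolding eq using \<open>w = w'\<close> by simp
    qed
  qed
  also have "\<dots> = (\<Sum>\<pi>\<in>E \<times> Pow {..<c}. p (fst \<pi>) * (1 / 2) ^ c)"
  proof (rule sum.cong[OF refl])
    fix \<pi> assume pi: "\<pi> \<in> E \<times> Pow {..<c}"
    then obtain e w where eq: "\<pi> = (e, w)" "e \<in> E" "w \<subseteq> {..<c}" by auto
    have "(\<Prod>t<c. qubit_factor True 0 False (\<lambda>_. (False, False)) {t\<in>w. odd t} w {t\<in>w. even t} t) = (\<Prod>t<c. root_half)"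
      by (rule prod.cong[OF refl]) (auto simp: qubit_factor_def amplitude_def)
    then have "start (\<iota> \<pi>) = of_real (sqrt (p e)) * root_half ^ c"
      using eq(3) unfolding eq(1) \<iota>_def start_def joint_state_def by (auto simp: dec_simps(2)[OF eq(2)] sub[OF eq(3)])
    moreover have "(cmod root_half)\<^sup>2 = 1 / 2" unfolding root_half_def by (simp add: norm_divide power_divide)
    then have "(cmod root_half ^ c)\<^sup>2 = (1 / 2) ^ c" by (metis power_mult mult.commute)
    ultimately show "(cmod (start (\<iota> \<pi>)))\<^sup>2 = p (fst \<pi>) * (1 / 2) ^ c"
      using p_nonneg unfolding eq(1) by (simp add: norm_mult norm_power power_mult_distrib)
  qed
  also have "\<dots> = (\<Sum>e\<in>E. \<Sum>w\<in>Pow {..<c}. p e * (1 / 2) ^ c)"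
    unfolding sum.cartesian_product by (simp only: case_prod_unfold)
  also have "\<dots> = (\<Sum>e\<in>E. p e)" by (simp add: card_Pow power_divide)
  finally show ?thesis using p_sum by simp
qed

lemma qubits_sent_message_steps: "sum_list (map qubits_sent (concat (map (message_steps \<mu>A \<mu>B) ss))) = length ss"
  by (induction ss) (auto simp: message_steps_def)

text \<open>\<open>mm x y e t\<close> is message \<open>t\<close> of the run with seed
  \<open>e\<close>; the three functions must work for any \<open>R\<close> that is right on the
  received messages and arbitrary elsewhere. In the end seed \<open>e\<close> leaves the single
  basis state \<open>\<gamma> e\<close> with squared amplitude \<open>p e\<close>, and different
  seeds leave different states, so the superposition of seeds acts like a random choice.\<close>

lemma superdense_simulation:
  fixes X :: "'x set" and Y :: "'y set" and mm :: "'x \<Rightarrow> 'y \<Rightarrow> 'e \<Rightarrow> nat \<Rightarrow> bool \<times> bool"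
    and out :: "'y \<Rightarrow> 'e \<Rightarrow> (nat \<Rightarrow> bool \<times> bool) \<Rightarrow> bool"
  assumes \<mu>A: "\<And>x y e s R. x \<in> X \<Longrightarrow> y \<in> Y \<Longrightarrow> e \<in> E \<Longrightarrow> s < c \<Longrightarrow> even s \<Longrightarrow>
      (\<And>t. t < s \<Longrightarrow> odd t \<Longrightarrow> R t = mm x y e t) \<Longrightarrow> \<mu>A x e s R = mm x y e s"
    and \<mu>B: "\<And>x y e s R. x \<in> X \<Longrightarrow> y \<in> Y \<Longrightarrow> e \<in> E \<Longrightarrow> s < c \<Longrightarrow> odd s \<Longrightarrow>
      (\<And>t. t < s \<Longrightarrow> even t \<Longrightarrow> R t = mm x y e t) \<Longrightarrow> \<mu>B y e s R = mm x y e s"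
    and out: "\<And>x y e R. x \<in> X \<Longrightarrow> y \<in> Y \<Longrightarrow> e \<in> E \<Longrightarrow>
      (\<And>t. t < c \<Longrightarrow> even t \<Longrightarrow> R t = mm x y e t) \<Longrightarrow> out y e R = val x y e"
  shows "\<exists>P :: ('x, 'y) qprotocol. valid_qprotocol X Y P \<and> qcost P = c \<and>
    (\<forall>x\<in>X. \<forall>y\<in>Y. \<forall>v. qoutput_prob P x y v \<ge> (\<Sum>e\<in>{e\<in>E. val x y e = v}. p e))"
proof -
  let ?last = "Bob_Step (\<lambda>y. output_op (out y)) {} :: ('x, 'y) qstep"
  define ss where "ss = concat (map (message_steps \<mu>A \<mu>B) [0..<c]) @ [?last]"
  define P where "P = \<lparr>dimA = d, dimB = d, qubits = c, alice_init = alice_qubits 0, initial = start, steps = ss,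
    measurer = Bob, accept = {(j, v). c \<in> snd (dec j)}\<rparr>"
  let ?G = "{..<c} - alice_qubits c"
  have "valid_steps X Y d c d (alice_qubits c) [?last]" by (simp add: unitary_ops[OF Diff_subset])
  then have "valid_qprotocol X Y P"
    unfolding valid_qprotocol_def P_def ss_def using valid_message_steps[of 0 X Y "[?last]" \<mu>A \<mu>B] start_norm alice_qubits_sub by simp
  moreover have "qcost P = c"
    unfolding qcost_def P_def ss_def by (simp add: qubits_sent_message_steps)
  moreover have "qoutput_prob P x y v \<ge> (\<Sum>e\<in>{e\<in>E. val x y e = v}. p e)" if xy: "x \<in> X" "y \<in> Y" for x y v
  proof -
    let ?mm = "mm x y"
    obtain \<psi> where \<psi>: "run_steps d c d x y ss (alice_qubits 0, start) = run_steps d c d x y [?last] (alice_qubits c, \<psi>)"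
      "is_state c False ?mm \<psi>"
      using run_message_steps[OF le0 start_is_state, of ?mm \<mu>A x \<mu>B y "[?last]"] \<mu>A[OF xy] \<mu>B[OF xy] unfolding ss_def by blast
    define \<phi> where "\<phi> = apply_Bob d ?G (output_op (out y)) \<psi>"
    have run: "run_steps (dimA P) (qubits P) (dimB P) x y (steps P) (alice_init P, initial P) = (alice_qubits c, \<phi>)"
      unfolding P_def \<phi>_def using \<psi>(1) by simp
    define U where "U = (\<lambda>e. {t. t < c \<and> odd t \<and> fst (?mm e t)})"
    define U' where "U' = (\<lambda>e. {t. t < c \<and> even t \<and> fst (?mm e t)})"
    define W where "W = (\<lambda>e. {t. t < c \<and> snd (?mm e t)})"
    define \<gamma> where "\<gamma> = (\<lambda>e. (enc (e, U e), W e, enc (e, set_bit_to c (val x y e) (U' e))))"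
    have sub: "U e \<subseteq> {..c}" "U' e \<subseteq> {..c}" "W e \<subseteq> {..<c}" "c \<notin> U e" "c \<notin> U' e" "set_bit_to c b (U' e) \<subseteq> {..c}" for e b
      unfolding U_def U'_def W_def set_bit_to_def by auto
    have val: "(cmod (\<phi> (\<gamma> e)))\<^sup>2 = p e" if e: "e \<in> E" for e
    proof -
      let ?j = "enc (e, set_bit_to c (val x y e) (U' e))" and ?i = "enc (e, U e)"
      have dj: "dec ?j = (e, set_bit_to c (val x y e) (U' e))" "?j < d" using dec_simps[OF e sub(6)] by auto
      have di: "dec ?i = (e, U e)" "?i < d" using dec_simps[OF e sub(1)] by auto
      have o: "out y e (\<lambda>t. (t \<in> set_bit_to c (val x y e) (U' e) - {c}, t \<in> W e \<inter> ?G)) = val x y e"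
      proof (rule out[OF xy e])
        fix t assume t: "t < c" "even t"
        then have "t \<in> ?G" unfolding alice_qubits_def by simp
        then show "(t \<in> set_bit_to c (val x y e) (U' e) - {c}, t \<in> W e \<inter> ?G) = mm x y e t"
          using t by (cases "mm x y e t") (auto simp: U'_def W_def)
      qed
      have W_split: "(W e \<inter> ?G) \<union> (W e - ?G) = W e" by blast
      have "\<phi> (\<gamma> e) = (\<Sum>l\<in>local_basis d ?G. output_op (out y) (?j, W e \<inter> ?G) l * \<psi> (?i, snd l \<union> (W e - ?G), fst l))"
        unfolding \<phi>_def \<gamma>_def apply_Bob_def by (simp add: case_prod_unfold)
      also have "\<dots> = (\<Sum>b\<in>UNIV. pauli_gate (val x y e, False) (val x y e) b * \<psi> (?i, W e, enc (e, set_bit_to c b (U' e))))"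
      proof -
        have "set_bit_to c b (set_bit_to c b' (U' e)) = set_bit_to c b (U' e)" for b b' unfolding set_bit_to_def by auto
        then show ?thesis
          using output_apply[OF Diff_subset dj(2), of "W e \<inter> ?G" "alice_qubits c" "out y" "\<lambda>l. \<psi> (?i, snd l \<union> (W e - ?G), fst l)"]
          by (simp only: dj(1) fst_conv snd_conv o W_split Int_lower2 mem_set_bit_to if_True simp_thms)
      qed
      \<comment> \<open>Bit \<open>c\<close> was 0 before the last gate, so the controlled flip
        writes the output there.\<close>
      also have "\<dots> = \<psi> (?i, W e, enc (e, set_bit_to c False (U' e)))"
        unfolding UNIV_bool pauli_gate_def by (cases "val x y e") simp_all
      also have "set_bit_to c False (U' e) = U' e" using sub(5)[of e] unfolding set_bit_to_def by simp
      also have "\<psi> (?i, W e, enc (e, U' e)) = joint_state p c True c False ?mm (e, U e) (W e) (e, U' e)"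
        using \<psi>(2) di dec_simps[OF e sub(2)] sub(3)[of e] unfolding is_state_def by simp
      also have "\<dots> = of_real (sqrt (p e)) * (\<Prod>t<c. qubit_factor True c False (?mm e) (U e) (W e) (U' e) t)"
        unfolding joint_state_def using sub(4,5)[of e] by simp
      also have "(\<Prod>t<c. qubit_factor True c False (?mm e) (U e) (W e) (U' e) t) = (\<Prod>t<c. 1)"
        by (rule prod.cong[OF refl]) (auto simp: qubit_factor_def amplitude_def U_def U'_def W_def)
      finally have "\<phi> (\<gamma> e) = of_real (sqrt (p e))" by simp
      then show ?thesis using p_nonneg[of e] by simp
    qed
    let ?S = "{g \<in> global_basis d c d. accepting P (alice_qubits c) g = v}"
    have "(\<Sum>e\<in>{e\<in>E. val x y e = v}. p e) = (\<Sum>e\<in>{e\<in>E. val x y e = v}. (cmod (\<phi> (\<gamma> e)))\<^sup>2)"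
      by (rule sum.cong[OF refl]) (simp add: val)
    also have "\<dots> = (\<Sum>g\<in>\<gamma> ` {e\<in>E. val x y e = v}. (cmod (\<phi> g))\<^sup>2)"
    proof (rule sum.reindex_cong[OF _ refl refl, symmetric])
      show "inj_on \<gamma> {e\<in>E. val x y e = v}"
      proof (rule inj_onI)
        fix e e' assume e: "e \<in> {e\<in>E. val x y e = v}" "e' \<in> {e\<in>E. val x y e = v}" "\<gamma> e = \<gamma> e'"
        then have "dec (enc (e, U e)) = dec (enc (e', U e'))" unfolding \<gamma>_def by simp
        then show "e = e'" using dec_simps(2)[OF _ sub(1)] e(1,2) by simp
      qed
    qed
    also have "\<dots> \<le> (\<Sum>g\<in>?S. (cmod (\<phi> g))\<^sup>2)"
    proof (rule sum_mono2)
      show "finite ?S" unfolding global_basis_def by simp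
      show "\<gamma> ` {e\<in>E. val x y e = v} \<subseteq> ?S"
      proof (rule image_subsetI)
        fix e assume "e \<in> {e\<in>E. val x y e = v}"
        then have e: "e \<in> E" and v: "v = val x y e" by auto
        show "\<gamma> e \<in> ?S" unfolding v
          using dec_simps[OF e sub(1)[of e]] dec_simps[OF e sub(6)[of "val x y e" e]] sub(3)[of e]
          unfolding \<gamma>_def global_basis_def accepting_def P_def by simp
      qed
    qed simp
    also have "\<dots> = qoutput_prob P x y v"
      unfolding qoutput_prob_def run by (simp add: P_def)
    finally show ?thesis .
  qed
  ultimately show ?thesis by blast
qed

end

section \<open>Protocol trees as alternating two-bit messages\<close>

fun leaf :: "('x, 'y) protocol \<Rightarrow> bool" where
  "leaf (Output v) = v"
| "leaf (Alice_Sends \<alpha> t u) = False"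
| "leaf (Bob_Sends \<beta> t u) = False"

text \<open>\<open>M\<close> may compute a message from the current tree or look it up. So one
  recursion covers the true run and its reconstruction by a party that knows only its own input and
  the messages received.\<close>

primrec residual :: "(nat \<Rightarrow> ('x, 'y) protocol \<Rightarrow> bool \<times> bool) \<Rightarrow> ('x, 'y) protocol \<Rightarrow> nat \<Rightarrow> ('x, 'y) protocol" where
  "residual M T 0 = T"
| "residual M T (Suc t) = (if even t then update_A (M t (residual M T t)) (residual M T t)
     else update_B (M t (residual M T t)) (residual M T t))"

lemma residual_cong:
  "(\<And>t. t < s \<Longrightarrow> M t (residual M' T t) = M' t (residual M' T t)) \<Longrightarrow> residual M T s = residual M' T s"
  by (induction s) simp_all

definition honest :: "'x \<Rightarrow> 'y \<Rightarrow> nat \<Rightarrow> ('x, 'y) protocol \<Rightarrow> bool \<times> bool" where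
  "honest x y t T = (if even t then message_A x T else message_B y T)"

lemma residual_output: "protocol_output (residual (honest x y) T s) x y = protocol_output T x y"
  by (induction s) (simp_all add: honest_def update_output)

lemma residual_bits: "bits_exchanged (residual (honest x y) T (2 * k)) x y \<le> bits_exchanged T x y - 2 * k"
proof (induction k)
  case (Suc k)
  let ?T = "residual (honest x y) T (2 * k)"
  have "residual (honest x y) T (2 * Suc k) = update_B (message_B y (update_A (message_A x ?T) ?T)) (update_A (message_A x ?T) ?T)"
    by (simp add: honest_def)
  then show ?case using update_update_bits[of y x ?T] Suc by simp
qed simp

text \<open>An even \<open>c\<close> gives \<open>c div 2\<close> full rounds, each removing two
  levels. For odd \<open>c\<close> the last message is Alice's, and Bob completes the round by an
  update that he need not send. So \<open>c\<close> messages exhaust depth \<open>c\<close> in both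
  cases.\<close>

lemma residual_final:
  assumes "bits_exchanged T x y \<le> c"
  shows "leaf (update_B (message_B y (residual (honest x y) T c)) (residual (honest x y) T c)) = protocol_output T x y"
proof -
  let ?R = "residual (honest x y) T c"
  let ?L = "update_B (message_B y ?R) ?R"
  have "bits_exchanged ?L x y = 0"
  proof (cases "even c")
    case True
    then obtain k where "c = 2 * k" by blast
    then have "bits_exchanged ?R x y = 0" using residual_bits[of x y T k] assms by simp
    then show ?thesis using update_bits_le(2)[of y ?R x] by simp
  next
    case False
    then obtain k where c: "c = Suc (2 * k)" by (metis oddE Suc_eq_plus1)
    let ?T = "residual (honest x y) T (2 * k)"
    have "?R = update_A (message_A x ?T) ?T" unfolding c by (simp add: honest_def)
    then have "bits_exchanged ?L x y \<le> bits_exchanged ?T x y - 2" using update_update_bits[of y x ?T] by simp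
    then show ?thesis using residual_bits[of x y T k] assms c by simp
  qed
  then obtain v where "?L = Output v" by (cases ?L) simp_all
  moreover have "protocol_output ?L x y = protocol_output T x y" by (simp add: update_output residual_output)
  ultimately show ?thesis by simp
qed

definition quantum_protocol_cost :: "real \<Rightarrow> 'x set \<Rightarrow> 'y set \<Rightarrow> ('x \<Rightarrow> 'y \<Rightarrow> bool) \<Rightarrow> nat \<Rightarrow> bool" where
  "quantum_protocol_cost \<epsilon> X Y F c \<longleftrightarrow> (\<exists>P :: ('x, 'y) qprotocol. valid_qprotocol X Y P \<and> qcost P \<le> c \<and>
      (\<forall>x\<in>X. \<forall>y\<in>Y. qoutput_prob P x y (F x y) \<ge> 1 - \<epsilon>))"

lemma quantum_cc_witness:
  assumes "quantum_protocol_cost \<epsilon> X Y F c"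
  shows "quantum_protocol_cost \<epsilon> X Y F (quantum_cc \<epsilon> X Y F)" "quantum_cc \<epsilon> X Y F \<le> c"
  using assms LeastI[of "quantum_protocol_cost \<epsilon> X Y F" c] Least_le[of "quantum_protocol_cost \<epsilon> X Y F" c]
  unfolding quantum_cc_def quantum_protocol_cost_def by auto

lemma quantum_of_randomized:
  fixes X :: "'x set" and Y :: "'y set"
  assumes R: "randomized_protocol_cost \<epsilon> X Y F c" and fin: "finite X" "finite Y" and \<epsilon>: "\<epsilon> < 1"
  shows "quantum_protocol_cost \<epsilon> X Y F c"
proof -
  obtain E :: "('x \<times> 'y) set set" and p :: "('x \<times> 'y) set \<Rightarrow> real" and Q :: "('x \<times> 'y) set \<Rightarrow> ('x, 'y) protocol"
    where E: "finite E" "\<And>e. p e \<ge> 0" "(\<Sum>e\<in>E. p e) = 1"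
    "\<And>x y. x \<in> X \<Longrightarrow> y \<in> Y \<Longrightarrow> (\<Sum>e\<in>{e\<in>E. protocol_output (Q e) x y = F x y}. p e) \<ge> 1 - \<epsilon>"
    "\<And>e x y. x \<in> X \<Longrightarrow> y \<in> Y \<Longrightarrow> bits_exchanged (Q e) x y \<le> c"
    by (rule randomized_finite_seeds[OF R fin \<epsilon>], rule that, assumption+)
  let ?M = "E \<times> Pow {..c}"
  have finM: "finite ?M" using E(1) by simp
  obtain h where h: "bij_betw h {0..<card ?M} ?M" using ex_bij_betw_nat_finite[OF finM] by blast
  interpret superdense_coding E p c "card ?M" h "inv_into {0..<card ?M} h"
  proof
    show "finite E" "\<And>e. p e \<ge> 0" "(\<Sum>e\<in>E. p e) = 1" using E by auto
    show "h i \<in> ?M \<and> inv_into {0..<card ?M} h (h i) = i" if "i < card ?M" for i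
      using that bij_betw_apply[OF h, of i] bij_betw_inv_into_left[OF h, of i] by simp
    show "inv_into {0..<card ?M} h (e, u) < card ?M \<and> h (inv_into {0..<card ?M} h (e, u)) = (e, u)" if "e \<in> E" "u \<subseteq> {..c}" for e u
    proof -
      have mem: "(e, u) \<in> ?M" using that by simp
      have "inv_into {0..<card ?M} h (e, u) \<in> {0..<card ?M}"
        using bij_betw_apply[OF bij_betw_inv_into[OF h] mem] .
      then show ?thesis using bij_betw_inv_into_right[OF h mem] by simp
    qed
  qed
  \<comment> \<open>Each party replays the tree, computing its own messages and reading those of the
    other party from \<open>R\<close>.\<close>
  define \<mu>A where "\<mu>A = (\<lambda>x e s R. message_A x (residual (\<lambda>t T. if even t then message_A x T else R t) (Q e) s))"
  define \<mu>B where "\<mu>B = (\<lambda>y e s R. message_B y (residual (\<lambda>t T. if odd t then message_B y T else R t) (Q e) s))"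
  define out where "out = (\<lambda>y e R. let T = residual (\<lambda>t T. if odd t then message_B y T else R t) (Q e) c in leaf (update_B (message_B y T) T))"
  define mm where "mm = (\<lambda>x y e t. honest x y t (residual (honest x y) (Q e) t))"
  define val where "val = (\<lambda>x y e. protocol_output (Q e) x y)"
  have resA: "residual (\<lambda>t T. if even t then message_A x T else R t) (Q e) s = residual (honest x y) (Q e) s"
    if "\<And>t. t < s \<Longrightarrow> odd t \<Longrightarrow> R t = mm x y e t" for x y e s R
    by (rule residual_cong) (use that in \<open>auto simp: mm_def honest_def\<close>)
  have resB: "residual (\<lambda>t T. if odd t then message_B y T else R t) (Q e) s = residual (honest x y) (Q e) s"
    if "\<And>t. t < s \<Longrightarrow> even t \<Longrightarrow> R t = mm x y e t" for x y e s R
    by (rule residual_cong) (use that in \<open>auto simp: mm_def honest_def\<close>)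
  have "\<exists>P :: ('x, 'y) qprotocol. valid_qprotocol X Y P \<and> qcost P = c \<and>
    (\<forall>x\<in>X. \<forall>y\<in>Y. \<forall>v. qoutput_prob P x y v \<ge> (\<Sum>e\<in>{e\<in>E. val x y e = v}. p e))"
  proof (rule superdense_simulation[of X Y mm \<mu>A \<mu>B out val])
    fix x y e s R assume "even s" "\<And>t. t < s \<Longrightarrow> odd t \<Longrightarrow> R t = mm x y e t"
    then show "\<mu>A x e s R = mm x y e s" unfolding \<mu>A_def using resA[of s R x y e] by (simp add: mm_def honest_def)
  next
    fix x y e s R assume "odd s" "\<And>t. t < s \<Longrightarrow> even t \<Longrightarrow> R t = mm x y e t"
    then show "\<mu>B y e s R = mm x y e s" unfolding \<mu>B_def using resB[of s R x y e] by (simp add: mm_def honest_def)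
  next
    fix x y e R assume xy: "x \<in> X" "y \<in> Y" and "\<And>t. t < c \<Longrightarrow> even t \<Longrightarrow> R t = mm x y e t"
    then show "out y e R = val x y e"
      unfolding out_def val_def using resB[of c R x y e] residual_final[OF E(5)[OF xy, of e]] by (simp add: Let_def)
  qed
  then obtain P :: "('x, 'y) qprotocol" where P: "valid_qprotocol X Y P" "qcost P = c"
    "\<And>x y v. x \<in> X \<Longrightarrow> y \<in> Y \<Longrightarrow> qoutput_prob P x y v \<ge> (\<Sum>e\<in>{e\<in>E. val x y e = v}. p e)" by blast
  have "qoutput_prob P x y (F x y) \<ge> 1 - \<epsilon>" if "x \<in> X" "y \<in> Y" for x y
    using P(3)[OF that, of "F x y"] E(4)[OF that] unfolding val_def by linarith
  then show ?thesis unfolding quantum_protocol_cost_def using P(1,2) by blast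
qed

section \<open>Block sensitivity and communication\<close>

lemma char_vec_in_cube: "char_vec n A \<in> cube n"
  unfolding char_vec_def cube_def by simp

lemma cube_eq_char_vec: "z \<in> cube n \<Longrightarrow> z = char_vec n {i\<in>{1..n}. z i}"
  unfolding char_vec_def cube_def by (auto simp: fun_eq_iff restrict_def PiE_def extensional_def)

lemma bit_xor_char_vec: "bit_xor n (char_vec n A) (char_vec n S) = char_vec n (sym_diff A S)"
  unfolding bit_xor_def char_vec_def by (auto simp: fun_eq_iff restrict_def)

lemma bit_and_char_vec: "bit_and n (char_vec n A) (char_vec n B) = char_vec n (A \<inter> B)"
  unfolding bit_and_def char_vec_def by (auto simp: fun_eq_iff restrict_def)

lemma bit_or_char_vec: "bit_or n (char_vec n A) (char_vec n B) = char_vec n (A \<union> B)"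
  unfolding bit_or_def char_vec_def by (auto simp: fun_eq_iff restrict_def)

lemma block_sensitivity_sets:
  fixes f :: "(nat \<Rightarrow> bool) \<Rightarrow> bool" and n :: nat
  defines "g \<equiv> \<lambda>A. f (char_vec n A)"
  shows "sensitive_blocks {1..n} g z \<B> \<Longrightarrow> card \<B> \<le> block_sensitivity n f"
    and "\<exists>z S. z \<subseteq> {1..n} \<and> disjoint_family_on S {1..block_sensitivity n f} \<and>
      (\<forall>i\<in>{1..block_sensitivity n f}. S i \<subseteq> {1..n} \<and> g (sym_diff z (S i)) \<noteq> g z)"
proof -
  define C where "C = {k. \<exists>z\<in>cube n. \<exists>S :: nat \<Rightarrow> nat set.
      (\<forall>i\<in>{1..k}. S i \<noteq> {} \<and> S i \<subseteq> {1..n}) \<and> disjoint_family_on S {1..k} \<and>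
      (\<forall>i\<in>{1..k}. f (bit_xor n z (char_vec n (S i))) \<noteq> f z)}"
  have C_iff: "k \<in> C \<longleftrightarrow> (\<exists>z\<in>cube n. \<exists>S :: nat \<Rightarrow> nat set.
      (\<forall>i\<in>{1..k}. S i \<noteq> {} \<and> S i \<subseteq> {1..n}) \<and> disjoint_family_on S {1..k} \<and>
      (\<forall>i\<in>{1..k}. f (bit_xor n z (char_vec n (S i))) \<noteq> f z))" for k
    unfolding C_def by (rule mem_Collect_eq)
  have bs: "block_sensitivity n f = Max C" unfolding block_sensitivity_def C_def ..
  \<comment> \<open>One element from each block injects the indices into \<open>{1..n}\<close>; this
    bound is what makes the \<open>Max\<close> in the definition of block sensitivity
    attained.\<close>
  have "k \<le> n" if k: "k \<in> C" for k
  proof -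
    obtain S where S: "\<forall>i\<in>{1..k}. S i \<noteq> {} \<and> S i \<subseteq> {1..n}" "disjoint_family_on S {1..k}"
      using C_iff[THEN iffD1, OF k] by (elim bexE exE conjE) (rule that)
    define h where "h = (\<lambda>i. SOME j. j \<in> S i)"
    have h: "h i \<in> S i" if "i \<in> {1..k}" for i using S(1) that unfolding h_def by (simp add: some_in_eq)
    have "inj_on h {1..k}"
    proof (rule inj_onI, rule ccontr)
      fix i j assume ij: "i \<in> {1..k}" "j \<in> {1..k}" "h i = h j" "i \<noteq> j"
      then have "S i \<inter> S j = {}" using S(2) unfolding disjoint_family_on_def by blast
      then show False using h[OF ij(1)] h[OF ij(2)] ij(3) by auto
    qed
    moreover have "h ` {1..k} \<subseteq> {1..n}" using h S(1) by blast
    ultimately show ?thesis using card_inj_on_le[of h "{1..k}" "{1..n}"] by simp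
  qed
  then have finC: "finite C" by (meson finite_nat_set_iff_bounded_le)
  have "0 \<in> C" unfolding C_def using char_vec_in_cube[of n "{}"] by (auto simp: disjoint_family_on_def)
  then have max_in: "Max C \<in> C" using finC by (intro Max_in) auto
  show "\<exists>z S. z \<subseteq> {1..n} \<and> disjoint_family_on S {1..block_sensitivity n f} \<and>
      (\<forall>i\<in>{1..block_sensitivity n f}. S i \<subseteq> {1..n} \<and> g (sym_diff z (S i)) \<noteq> g z)"
  proof -
    obtain z S where zS: "z \<in> cube n" "\<forall>i\<in>{1..Max C}. S i \<noteq> {} \<and> S i \<subseteq> {1..n}" "disjoint_family_on S {1..Max C}"
      "\<forall>i\<in>{1..Max C}. f (bit_xor n z (char_vec n (S i))) \<noteq> f z"
      using C_iff[THEN iffD1, OF max_in] by (elim bexE exE conjE) (rule that)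
    let ?A = "{i\<in>{1..n}. z i}"
    have z: "z = char_vec n ?A" by (rule cube_eq_char_vec[OF zS(1)])
    have "f (bit_xor n (char_vec n ?A) (char_vec n (S i))) \<noteq> f (char_vec n ?A)" if "i \<in> {1..Max C}" for i
      using zS(4) that z by simp
    then have "\<forall>i\<in>{1..Max C}. S i \<subseteq> {1..n} \<and> g (sym_diff ?A (S i)) \<noteq> g ?A"
      using zS(2) unfolding g_def bit_xor_char_vec by blast
    then show ?thesis unfolding bs using zS(3) by (intro exI[of _ ?A] exI[of _ S]) auto
  qed
  assume sb: "sensitive_blocks {1..n} g z \<B>"
  have finB: "finite \<B>" using sensitive_blocks_finite[OF _ sb] by simp
  obtain S where S: "bij_betw S {1..card \<B>} \<B>" using ex_bij_betw_nat_finite_1[OF finB] by blast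
  have mem: "S i \<in> \<B>" if "i \<in> {1..card \<B>}" for i using bij_betw_apply[OF S that] .
  have "card \<B> \<in> C"
    unfolding C_iff
  proof (intro bexI[of _ "char_vec n z"] exI[of _ S] conjI ballI)
    show "disjoint_family_on S {1..card \<B>}"
      unfolding disjoint_family_on_def
    proof (intro ballI impI)
      fix i j assume ij: "i \<in> {1..card \<B>}" "j \<in> {1..card \<B>}" "i \<noteq> j"
      then have "S i \<noteq> S j" using bij_betw_imp_inj_on[OF S] by (meson inj_on_contraD)
      then show "S i \<inter> S j = {}" using sb mem[OF ij(1)] mem[OF ij(2)]
        unfolding sensitive_blocks_def pairwise_def disjnt_def by blast
    qed
    show "S i \<noteq> {}" if "i \<in> {1..card \<B>}" for i
      using sb mem[OF that] unfolding sensitive_blocks_def by force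
    show "S i \<subseteq> {1..n}" if "i \<in> {1..card \<B>}" for i
      using sb mem[OF that] unfolding sensitive_blocks_def by blast
    show "f (bit_xor n (char_vec n z) (char_vec n (S i))) \<noteq> f (char_vec n z)" if "i \<in> {1..card \<B>}" for i
      using sb mem[OF that] unfolding sensitive_blocks_def g_def bit_xor_char_vec by blast
  qed (rule char_vec_in_cube)
  then show "card \<B> \<le> block_sensitivity n f" unfolding bs by (rule Max_ge[OF finC])
qed

lemma deterministic_protocol_exists:
  fixes f :: "(nat \<Rightarrow> bool) \<Rightarrow> bool" and op :: "(nat \<Rightarrow> bool) \<Rightarrow> (nat \<Rightarrow> bool) \<Rightarrow> (nat \<Rightarrow> bool)"
  assumes op: "\<And>x y. op x y = (\<lambda>i\<in>{1..n}. h (x i) (y i))"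
  shows "\<exists>P :: (nat \<Rightarrow> bool, nat \<Rightarrow> bool) protocol. \<forall>x\<in>cube n. \<forall>y\<in>cube n.
    protocol_output P x y = f (op x y) \<and> bits_exchanged P x y \<le> 2 * block_sensitivity n f ^ 3"
proof -
  let ?p = "\<lambda>x y. {i\<in>{1..n}. h (x i) (y i)}"
  have eq: "op x y = char_vec n (?p x y)" for x y
    unfolding op char_vec_def by (auto simp: fun_eq_iff restrict_def)
  have "protocol_on (cube n) (cube n) ?p (\<lambda>A. f (char_vec n A)) (Pow {1..n}) (2 * block_sensitivity n f ^ 3)"
  proof (rule protocol_on_block_sensitivity)
    show "\<exists>(h' :: bool \<Rightarrow> bool \<Rightarrow> bool) \<alpha> \<beta>. \<forall>x\<in>cube n. \<forall>y\<in>cube n. i \<in> ?p x y \<longleftrightarrow> h' (\<alpha> x) (\<beta> y)" if "i \<in> {1..n}" for i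
      by (rule exI[of _ h], rule exI[of _ "\<lambda>x. x i"], rule exI[of _ "\<lambda>y. y i"]) (use that in simp)
  qed (auto intro: block_sensitivity_sets(1))
  then obtain P :: "(nat \<Rightarrow> bool, nat \<Rightarrow> bool) protocol" where
    P: "\<forall>x\<in>cube n. \<forall>y\<in>cube n. ?p x y \<in> Pow {1..n} \<longrightarrow>
      protocol_output P x y = f (char_vec n (?p x y)) \<and> bits_exchanged P x y \<le> 2 * block_sensitivity n f ^ 3"
    unfolding protocol_on_def by blast
  have "?p x y \<in> Pow {1..n}" for x y by blast
  then show ?thesis unfolding eq using P by blast
qed

text \<open>The gadget: element \<open>(p, q, b)\<close> belongs to Alice's set iff bit \<open>(p, q)\<close> of \<open>x\<close> differs from \<open>b\<close>, and
  to Bob's set iff \<open>q = V p\<close> and \<open>b\<close> is bit \<open>p\<close> of \<open>w\<close>; the intersection is then a copy of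
  \<open>x|\<^sub>V \<oplus> w\<close>.\<close>

lemma quantum_lower_bound:
  fixes P :: "('x, 'y) qprotocol" and \<alpha> :: "'i set \<Rightarrow> 'x" and \<beta> :: "'i set \<Rightarrow> 'y"
  assumes V: "valid_qprotocol X Y P" and fin: "finite I" "I \<noteq> {}"
    and emb: "\<And>s. s \<subseteq> I \<Longrightarrow> \<alpha> s \<in> X" "\<And>t. t \<subseteq> I \<Longrightarrow> \<beta> t \<in> Y"
    and zero: "\<And>s t. s \<subseteq> I \<Longrightarrow> t \<subseteq> I \<Longrightarrow> s \<inter> t = {} \<Longrightarrow> F (\<alpha> s) (\<beta> t) = v0"
    and one: "\<And>s t. s \<subseteq> I \<Longrightarrow> t \<subseteq> I \<Longrightarrow> card (s \<inter> t) = 1 \<Longrightarrow> F (\<alpha> s) (\<beta> t) = (\<not> v0)"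
    and correct: "\<And>x y. x \<in> X \<Longrightarrow> y \<in> Y \<Longrightarrow> qoutput_prob P x y (F x y) \<ge> 2 / 3"
  shows "card I \<le> 10000 * (qcost P)\<^sup>2"
proof -
  let ?Q = "\<lambda>s t. qoutput_prob P (\<alpha> s) (\<beta> t) (\<not> v0)"
  have Q0: "?Q s t \<le> 1 / 3" if "s \<subseteq> I" "t \<subseteq> I" "s \<inter> t = {}" for s t
    using correct[OF emb(1)[OF that(1)] emb(2)[OF that(2)]] zero[OF that]
      qoutput_prob_total[OF V emb(1)[OF that(1)] emb(2)[OF that(2)], of v0] by simp
  have Q1: "?Q s t \<ge> 2 / 3" if "s \<subseteq> I" "t \<subseteq> I" "card (s \<inter> t) = 1" for s t
    using correct[OF emb(1)[OF that(1)] emb(2)[OF that(2)]] one[OF that] by simp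
  have Qb: "0 \<le> ?Q s t \<and> ?Q s t \<le> 1" if "s \<subseteq> I" "t \<subseteq> I" for s t
    using qoutput_prob_total[OF V emb(1)[OF that(1)] emb(2)[OF that(2)], of v0]
      qoutput_prob_nonneg[of P "\<alpha> s" "\<beta> t"] by (metis add_increasing2 add_increasing order_refl)
  \<comment> \<open>The exponential estimate below has additive constants; they fit into a multiple
    of the cost only if the cost is positive.\<close>
  have q1: "1 \<le> qcost P"
  proof (rule ccontr)
    assume "\<not> 1 \<le> qcost P"
    then have c0: "qcost P = 0" by simp
    obtain i where i: "i \<in> I" using fin(2) by blast
    have m: "\<alpha> {i} \<in> X" "\<alpha> {} \<in> X" "\<beta> {i} \<in> Y" "\<beta> {} \<in> Y" using emb i by auto
    have "?Q {i} {i} \<ge> 2 / 3" "?Q {} {i} \<le> 1 / 3" "?Q {i} {} \<le> 1 / 3"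
      using Q0 Q1 i by auto
    moreover have "?Q {i} {i} = ?Q {i} {} \<or> ?Q {i} {i} = ?Q {} {i}"
      using qoutput_prob_no_communication[OF V c0, of "\<not> v0"] m by blast
    ultimately show False by auto
  qed
  \<comment> \<open>One index \<open>p\<close> of the gadget occupies eight elements of
    \<open>I\<close>: four positions times two bit values.\<close>
  define m where "m = card I div 8"
  have I8: "card I < 8 * (m + 1)" unfolding m_def by simp
  have "m + 1 \<le> 1250 * (qcost P)\<^sup>2"
  proof (cases "m = 0")
    case True
    have "1 \<le> (qcost P)\<^sup>2" using q1 by simp
    then show ?thesis using True by simp
  next
    case False
    let ?M = "{..<m}" and ?B = "{..<4::nat}"
    have "card ((?M \<times> ?B) \<times> (UNIV :: bool set)) \<le> card I"
      unfolding card_cartesian_product m_def by simp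
    then obtain \<iota> where \<iota>: "\<iota> ` ((?M \<times> ?B) \<times> (UNIV :: bool set)) \<subseteq> I" "inj_on \<iota> ((?M \<times> ?B) \<times> (UNIV :: bool set))"
      using card_le_inj[of "(?M \<times> ?B) \<times> (UNIV :: bool set)" I] fin(1) by auto
    define s where "s = (\<lambda>x. \<iota> ` {k\<in>(?M \<times> ?B) \<times> UNIV. (fst k \<in> x) \<noteq> snd k})"
    define t where "t = (\<lambda>V w. \<iota> ` ((\<lambda>p. ((p, V p), p \<in> w)) ` ?M))"
    have sI: "s x \<subseteq> I" for x using \<iota>(1) unfolding s_def by blast
    have key: "(\<lambda>p. ((p, V p), p \<in> w)) ` ?M \<subseteq> (?M \<times> ?B) \<times> UNIV" if "V \<in> ?M \<rightarrow>\<^sub>E ?B" for V w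
      using that by (auto simp: PiE_iff)
    have tI: "t V w \<subseteq> I" if "V \<in> ?M \<rightarrow>\<^sub>E ?B" for V w using \<iota>(1) key[OF that, of w] unfolding t_def by blast
    have card_st: "card (s x \<inter> t V w) = card (sym_diff (select ?M x V) w)"
      if "V \<in> ?M \<rightarrow>\<^sub>E ?B" "w \<subseteq> ?M" for x V w
    proof -
      let ?k = "\<lambda>p. ((p, V p), p \<in> w)"
      have "s x \<inter> t V w = \<iota> ` ({k\<in>(?M \<times> ?B) \<times> UNIV. (fst k \<in> x) \<noteq> snd k} \<inter> ?k ` ?M)"
        unfolding s_def t_def by (rule inj_on_image_Int[OF \<iota>(2), symmetric]) (use key[OF that(1)] in auto)
      also have "{k\<in>(?M \<times> ?B) \<times> UNIV. (fst k \<in> x) \<noteq> snd k} \<inter> ?k ` ?M = ?k ` (sym_diff (select ?M x V) w)"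
      proof (intro set_eqI iffI)
        fix k assume "k \<in> {k\<in>(?M \<times> ?B) \<times> UNIV. (fst k \<in> x) \<noteq> snd k} \<inter> ?k ` ?M"
        then obtain p where p: "p \<in> ?M" "k = ?k p" "((p, V p) \<in> x) \<noteq> (p \<in> w)" by auto
        then have "p \<in> sym_diff (select ?M x V) w" unfolding select_def by auto
        then show "k \<in> ?k ` (sym_diff (select ?M x V) w)" using p(2) by blast
      next
        fix k assume "k \<in> ?k ` (sym_diff (select ?M x V) w)"
        then obtain p where p: "p \<in> sym_diff (select ?M x V) w" "k = ?k p" by blast
        then have "p \<in> ?M" "((p, V p) \<in> x) \<noteq> (p \<in> w)" using that(2) unfolding select_def by auto
        then show "k \<in> {k\<in>(?M \<times> ?B) \<times> UNIV. (fst k \<in> x) \<noteq> snd k} \<inter> ?k ` ?M" using p(2) key[OF that(1), of w] by auto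
      qed
      finally have "s x \<inter> t V w = \<iota> ` ?k ` (sym_diff (select ?M x V) w)" .
      moreover have "inj_on \<iota> (?k ` (sym_diff (select ?M x V) w))"
      proof (rule inj_on_subset[OF \<iota>(2)])
        have "sym_diff (select ?M x V) w \<subseteq> ?M" using that(2) unfolding select_def by auto
        then show "?k ` (sym_diff (select ?M x V) w) \<subseteq> (?M \<times> ?B) \<times> UNIV" using key[OF that(1), of w] by blast
      qed
      moreover have "inj_on ?k (sym_diff (select ?M x V) w)" by (auto simp: inj_on_def)
      ultimately show ?thesis by (simp add: card_image)
    qed
    obtain K :: "(nat set list \<times> nat set list) set" and J :: "((nat \<times> nat set) \<times> (nat \<times> nat set)) set" and XX YY where
      K: "card K = 4 ^ qcost P"
      "\<forall>x\<in>X. \<forall>y\<in>Y. complex_of_real (qoutput_prob P x y (\<not> v0)) = (\<Sum>s\<in>K. \<Sum>j\<in>J. XX s j x * YY s j y)"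
      "\<forall>s\<in>K. \<forall>x\<in>X. (\<Sum>j\<in>J. (cmod (XX s j x))\<^sup>2) \<le> 1" "\<forall>s\<in>K. \<forall>y\<in>Y. (\<Sum>j\<in>J. (cmod (YY s j y))\<^sup>2) \<le> 1"
      using qoutput_prob_factorization[OF V, of "\<not> v0"] by blast
    define r where "r = nat \<lfloor>sqrt (real m / 50)\<rfloor>"
    have r_le: "real r \<le> sqrt (real m / 50)" "sqrt (real m / 50) < real r + 1"
      unfolding r_def by (simp_all add: of_nat_nat)
    have "(real r)\<^sup>2 \<le> real m / 50" using power_mono[OF r_le(1), of 2] by simp
    then have "50 * real (r\<^sup>2) \<le> real m" by simp
    then have r50: "50 * r\<^sup>2 \<le> m" using of_nat_le_iff[where 'a = real, of "50 * r\<^sup>2" m] by simp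
    have "real m / 50 < (real r + 1)\<^sup>2"
      using power_strict_mono[OF r_le(2), of 2] by simp
    then have "real m < 50 * (real r + 1)\<^sup>2" by simp
    also have "\<dots> = real (50 * (r + 1)\<^sup>2)" by (simp add: add.commute)
    finally have "real m < real (50 * (r + 1)\<^sup>2)" .
    then have m_less: "m < 50 * (r + 1)\<^sup>2" by (simp only: of_nat_less_iff)
    \<comment> \<open>Blocks of size 4 correspond to \<open>\<beta> = 2\<close>, the least value for
      which the bound grows with \<open>r\<close>.\<close>
    have "real 2 ^ (r + 1) / 10 \<le> real (card K)"
    proof (rule unique_disjointness_bound[where M = ?M and B = ?B and J = J and
          P = "\<lambda>x V w. ?Q (s x) (t V w)" and X = "\<lambda>k j x. XX k j (\<alpha> (s x))" and Y = "\<lambda>k j V w. YY k j (\<beta> (t V w))"])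
      show "50 * r\<^sup>2 \<le> card ?M" "1 \<le> card ?M" using r50 False by simp_all
    next
      fix x V w assume a: "x \<subseteq> ?M \<times> ?B" "V \<in> ?M \<rightarrow>\<^sub>E ?B" "w \<subseteq> ?M"
      have mem: "\<alpha> (s x) \<in> X" "\<beta> (t V w) \<in> Y" using emb(1)[OF sI] emb(2)[OF tI[OF a(2)]] by auto
      show "complex_of_real (?Q (s x) (t V w)) = (\<Sum>k\<in>K. \<Sum>j\<in>J. XX k j (\<alpha> (s x)) * YY k j (\<beta> (t V w)))"
        using K(2) mem by blast
      show "0 \<le> ?Q (s x) (t V w) \<and> ?Q (s x) (t V w) \<le> 1" by (rule Qb[OF sI tI[OF a(2)]])
      show "?Q (s x) (t V w) \<le> 1 / 3" if "sym_diff (select ?M x V) w = {}"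
      proof (rule Q0[OF sI tI[OF a(2)]])
        have "finite (s x \<inter> t V w)" using finite_subset[OF sI fin(1)] by simp
        moreover have "card (s x \<inter> t V w) = 0" unfolding card_st[OF a(2,3)] that by (rule card.empty)
        ultimately show "s x \<inter> t V w = {}" by (simp only: card_0_eq)
      qed
      show "2 / 3 \<le> ?Q (s x) (t V w)" if "card (sym_diff (select ?M x V) w) = 1"
        using Q1[OF sI tI[OF a(2)]] card_st[OF a(2,3)] that by simp
    next
      show "(\<Sum>j\<in>J. (cmod (XX k j (\<alpha> (s x))))\<^sup>2) \<le> 1" if "k \<in> K" for k x
        using K(3) that emb(1)[OF sI] by blast
      show "(\<Sum>j\<in>J. (cmod (YY k j (\<beta> (t V w))))\<^sup>2) \<le> 1" if "k \<in> K" "V \<in> ?M \<rightarrow>\<^sub>E ?B" for k V w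
        using K(4) that emb(2)[OF tI] by blast
    qed simp_all
    then have "real (2 ^ (r + 1)) \<le> real (10 * 4 ^ qcost P)" unfolding K(1) by simp
    then have "(2::nat) ^ (r + 1) \<le> 10 * 4 ^ qcost P" by (simp only: of_nat_le_iff)
    also have "(4::nat) ^ qcost P = 2 ^ (2 * qcost P)" by (simp add: power_mult)
    \<comment> \<open>From \<open>10 < 2 ^ 4\<close> and positive cost follows
      \<open>r + 1 \<le> 2 * qcost P + 3 \<le> 5 * qcost P\<close>. The constants are then
      \<open>50 * 25 = 1250\<close> and, with the eight elements per index, 10000.\<close>
    also have "10 * 2 ^ (2 * qcost P) < (2::nat) ^ (2 * qcost P + 4)" by (simp add: power_add)
    finally have "r + 1 < 2 * qcost P + 4" by (simp only: power_strict_increasing_iff one_less_numeral_iff semiring_norm)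
    then have "r + 1 \<le> 5 * qcost P" using q1 by linarith
    then have "(r + 1)\<^sup>2 \<le> (5 * qcost P)\<^sup>2" by (intro power_mono) auto
    then show ?thesis using m_less by (simp add: power_mult_distrib)
  qed
  then have "8 * (m + 1) \<le> 8 * (1250 * (qcost P)\<^sup>2)" by (rule mult_le_mono2)
  with I8 have "card I < 8 * (1250 * (qcost P)\<^sup>2)" by (rule less_le_trans)
  then show "card I \<le> 10000 * (qcost P)\<^sup>2" by simp
qed

section \<open>Unique disjointness inside AND and OR\<close>

lemma Union_Int_disjoint:
  assumes "disjoint \<B>" "s \<subseteq> \<B>" "t \<subseteq> \<B>"
  shows "\<Union>s \<inter> \<Union>t = \<Union>(s \<inter> t)"
proof
  show "\<Union>s \<inter> \<Union>t \<subseteq> \<Union>(s \<inter> t)"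
  proof
    fix i assume "i \<in> \<Union>s \<inter> \<Union>t"
    then obtain S T where ST: "S \<in> s" "T \<in> t" "i \<in> S" "i \<in> T" by blast
    then have "S = T" using assms unfolding pairwise_def disjnt_def by blast
    then show "i \<in> \<Union>(s \<inter> t)" using ST by blast
  qed
qed blast

text \<open>Each party switches its blocks on above \<open>z\<close>. Since the blocks are disjoint
  and avoid \<open>z\<close>, the conjunction switches on exactly the common ones: no common block
  leaves the point \<open>z\<close>, and a single one flips the value.\<close>

lemma quantum_lower_bound_and:
  fixes P :: "(nat \<Rightarrow> bool, nat \<Rightarrow> bool) qprotocol"
  assumes sb: "sensitive_blocks {1..n} (\<lambda>A. f (char_vec n A)) z \<B>" and zero: "\<forall>B\<in>\<B>. B \<inter> z = {}" and ne: "\<B> \<noteq> {}"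
    and V: "valid_qprotocol (cube n) (cube n) P"
    and correct: "\<And>x y. x \<in> cube n \<Longrightarrow> y \<in> cube n \<Longrightarrow> qoutput_prob P x y (f (bit_and n x y)) \<ge> 2 / 3"
  shows "card \<B> \<le> 10000 * (qcost P)\<^sup>2"
proof (rule quantum_lower_bound[OF V, where \<alpha> = "\<lambda>s. char_vec n (z \<union> \<Union>s)" and \<beta> = "\<lambda>s. char_vec n (z \<union> \<Union>s)"
      and F = "\<lambda>x y. f (bit_and n x y)" and ?v0.0 = "f (char_vec n z)"])
  have dis: "disjoint \<B>" using sb unfolding sensitive_blocks_def by blast
  have eq: "bit_and n (char_vec n (z \<union> \<Union>s)) (char_vec n (z \<union> \<Union>t)) = char_vec n (z \<union> \<Union>(s \<inter> t))"
    if "s \<subseteq> \<B>" "t \<subseteq> \<B>" for s t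
    unfolding bit_and_char_vec Union_Int_disjoint[OF dis that, symmetric] by (simp add: Un_Int_distrib)
  show "finite \<B>" using sensitive_blocks_finite[OF _ sb] by simp
  show "f (bit_and n (char_vec n (z \<union> \<Union>s)) (char_vec n (z \<union> \<Union>t))) = f (char_vec n z)"
    if "s \<subseteq> \<B>" "t \<subseteq> \<B>" "s \<inter> t = {}" for s t using eq[OF that(1,2)] that(3) by simp
  show "f (bit_and n (char_vec n (z \<union> \<Union>s)) (char_vec n (z \<union> \<Union>t))) = (\<not> f (char_vec n z))"
    if st: "s \<subseteq> \<B>" "t \<subseteq> \<B>" "card (s \<inter> t) = 1" for s t
  proof -
    obtain B where B: "s \<inter> t = {B}" using st(3) by (auto simp: card_1_singleton_iff)
    then have BB: "B \<in> \<B>" using st by blast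
    have "z \<union> B = sym_diff z B" using zero BB by blast
    moreover have "f (char_vec n (sym_diff z B)) \<noteq> f (char_vec n z)" using sb BB unfolding sensitive_blocks_def by blast
    ultimately have "f (char_vec n (z \<union> B)) \<noteq> f (char_vec n z)" by (rule ssubst[of _ _ "\<lambda>A. f (char_vec n A) \<noteq> f (char_vec n z)"])
    moreover have "bit_and n (char_vec n (z \<union> \<Union>s)) (char_vec n (z \<union> \<Union>t)) = char_vec n (z \<union> B)"
      using eq[OF st(1,2)] unfolding B by simp
    ultimately show ?thesis by simp
  qed
qed (use ne correct char_vec_in_cube in auto)

text \<open>The dual reduction: each party switches its blocks off inside \<open>z\<close>, and in
  the disjunction only the common ones stay off.\<close>

lemma quantum_lower_bound_or:
  fixes P :: "(nat \<Rightarrow> bool, nat \<Rightarrow> bool) qprotocol"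
  assumes sb: "sensitive_blocks {1..n} (\<lambda>A. f (char_vec n A)) z \<B>" and one: "\<forall>B\<in>\<B>. B \<subseteq> z" and ne: "\<B> \<noteq> {}"
    and V: "valid_qprotocol (cube n) (cube n) P"
    and correct: "\<And>x y. x \<in> cube n \<Longrightarrow> y \<in> cube n \<Longrightarrow> qoutput_prob P x y (f (bit_or n x y)) \<ge> 2 / 3"
  shows "card \<B> \<le> 10000 * (qcost P)\<^sup>2"
proof (rule quantum_lower_bound[OF V, where \<alpha> = "\<lambda>s. char_vec n (z - \<Union>s)" and \<beta> = "\<lambda>s. char_vec n (z - \<Union>s)"
      and F = "\<lambda>x y. f (bit_or n x y)" and ?v0.0 = "f (char_vec n z)"])
  have dis: "disjoint \<B>" using sb unfolding sensitive_blocks_def by blast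
  have eq: "bit_or n (char_vec n (z - \<Union>s)) (char_vec n (z - \<Union>t)) = char_vec n (z - \<Union>(s \<inter> t))"
    if "s \<subseteq> \<B>" "t \<subseteq> \<B>" for s t
    unfolding bit_or_char_vec Union_Int_disjoint[OF dis that, symmetric] by (simp add: Diff_Int)
  show "finite \<B>" using sensitive_blocks_finite[OF _ sb] by simp
  show "f (bit_or n (char_vec n (z - \<Union>s)) (char_vec n (z - \<Union>t))) = f (char_vec n z)"
    if "s \<subseteq> \<B>" "t \<subseteq> \<B>" "s \<inter> t = {}" for s t using eq[OF that(1,2)] that(3) by simp
  show "f (bit_or n (char_vec n (z - \<Union>s)) (char_vec n (z - \<Union>t))) = (\<not> f (char_vec n z))"
    if st: "s \<subseteq> \<B>" "t \<subseteq> \<B>" "card (s \<inter> t) = 1" for s t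
  proof -
    obtain B where B: "s \<inter> t = {B}" using st(3) by (auto simp: card_1_singleton_iff)
    then have BB: "B \<in> \<B>" using st by blast
    have "z - B = sym_diff z B" using one BB by blast
    moreover have "f (char_vec n (sym_diff z B)) \<noteq> f (char_vec n z)" using sb BB unfolding sensitive_blocks_def by blast
    ultimately have "f (char_vec n (z - B)) \<noteq> f (char_vec n z)" by (rule ssubst[of _ _ "\<lambda>A. f (char_vec n A) \<noteq> f (char_vec n z)"])
    moreover have "bit_or n (char_vec n (z - \<Union>s)) (char_vec n (z - \<Union>t)) = char_vec n (z - B)"
      using eq[OF st(1,2)] unfolding B by simp
    ultimately show ?thesis by simp
  qed
qed (use ne correct char_vec_in_cube in auto)

section \<open>The chain of inequalities\<close>

lemma cc_chain:
  fixes f :: "(nat \<Rightarrow> bool) \<Rightarrow> bool" and op :: "(nat \<Rightarrow> bool) \<Rightarrow> (nat \<Rightarrow> bool) \<Rightarrow> (nat \<Rightarrow> bool)"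
  assumes op: "\<And>x y. op x y = (\<lambda>i\<in>{1..n}. h (x i) (y i))"
  defines "F \<equiv> \<lambda>x y. f (op x y)"
  shows "randomized_cc (1/3) (cube n) (cube n) F \<le> deterministic_cc (cube n) (cube n) F"
    "quantum_cc (1/3) (cube n) (cube n) F \<le> randomized_cc (1/3) (cube n) (cube n) F"
    "deterministic_cc (cube n) (cube n) F \<le> 2 * block_sensitivity n f ^ 3"
    "\<exists>P :: (nat \<Rightarrow> bool, nat \<Rightarrow> bool) qprotocol. valid_qprotocol (cube n) (cube n) P \<and>
       qcost P \<le> quantum_cc (1/3) (cube n) (cube n) F \<and> (\<forall>x\<in>cube n. \<forall>y\<in>cube n. qoutput_prob P x y (F x y) \<ge> 2 / 3)"
proof -
  have "\<exists>D :: (nat \<Rightarrow> bool, nat \<Rightarrow> bool) protocol. \<forall>x\<in>cube n. \<forall>y\<in>cube n.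
      protocol_output D x y = F x y \<and> bits_exchanged D x y \<le> 2 * block_sensitivity n f ^ 3"
    unfolding F_def by (rule deterministic_protocol_exists[OF op])
  then obtain D :: "(nat \<Rightarrow> bool, nat \<Rightarrow> bool) protocol" where D: "\<forall>x\<in>cube n. \<forall>y\<in>cube n.
      protocol_output D x y = F x y \<and> bits_exchanged D x y \<le> 2 * block_sensitivity n f ^ 3" ..
  have fin: "finite (cube n)" unfolding cube_def by (intro finite_PiE) auto
  show "randomized_cc (1/3) (cube n) (cube n) F \<le> deterministic_cc (cube n) (cube n) F"
    by (rule randomized_cc_le_deterministic_cc[OF D]) simp
  show "deterministic_cc (cube n) (cube n) F \<le> 2 * block_sensitivity n f ^ 3"
    by (rule deterministic_cc_witness(2)[OF D])
  have "randomized_protocol_cost (1/3) (cube n) (cube n) F (randomized_cc (1/3) (cube n) (cube n) F)"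
    by (rule randomized_cc_witness(1)[OF randomized_of_deterministic[OF D]]) simp
  then have Q: "quantum_protocol_cost (1/3) (cube n) (cube n) F (randomized_cc (1/3) (cube n) (cube n) F)"
    by (rule quantum_of_randomized[OF _ fin fin]) simp
  show "quantum_cc (1/3) (cube n) (cube n) F \<le> randomized_cc (1/3) (cube n) (cube n) F"
    by (rule quantum_cc_witness(2)[OF Q])
  show "\<exists>P :: (nat \<Rightarrow> bool, nat \<Rightarrow> bool) qprotocol. valid_qprotocol (cube n) (cube n) P \<and>
       qcost P \<le> quantum_cc (1/3) (cube n) (cube n) F \<and> (\<forall>x\<in>cube n. \<forall>y\<in>cube n. qoutput_prob P x y (F x y) \<ge> 2 / 3)"
    using quantum_cc_witness(1)[OF Q] unfolding quantum_protocol_cost_def by simp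
qed

lemma power_estimates:
  fixes bs K q D :: nat
  assumes "bs \<le> 4 * K\<^sup>2 + 3 * K" "K \<le> 10000 * q\<^sup>2" "D \<le> 2 * bs ^ 3"
  shows "real q \<ge> 1 / 200 * real bs powr (1/4)"
    and "1 / 200 * real bs powr (1/4) \<ge> 1 / 400 * real D powr (1/12)"
proof -
  have "K \<le> K\<^sup>2" by (simp add: power2_eq_square)
  \<comment> \<open>The factor is rounded up from 7 to 16 because
    \<open>16 * 10000\<^sup>2 = 200 ^ 4\<close> is a fourth power.\<close>
  then have "bs \<le> 16 * K\<^sup>2" using assms(1) by linarith
  then have "real bs \<le> real (16 * K\<^sup>2)" by (simp only: of_nat_le_iff)
  also have "\<dots> \<le> real (16 * (10000 * q\<^sup>2)\<^sup>2)" by (intro of_nat_mono mult_le_mono2 power_mono assms(2)) simp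
  also have "\<dots> = (200 * real q) ^ 4" by (simp add: power_mult_distrib flip: power_mult)
  finally have "real bs powr (1/4) \<le> ((200 * real q) ^ 4) powr (1/4)" by (intro powr_mono2) auto
  also have "((200 * real q) ^ 4) powr (1/4) = ((200 * real q) powr 4) powr (1/4)" by (simp only: powr_numeral)
  also have "\<dots> = 200 * real q" unfolding powr_powr by simp
  finally show "real q \<ge> 1 / 200 * real bs powr (1/4)" by simp
  have "real D \<le> real (2 * bs ^ 3)" using assms(3) by (simp only: of_nat_le_iff)
  then have "real D powr (1/12) \<le> (2 * real bs ^ 3) powr (1/12)" by (intro powr_mono2) auto
  also have "(2 * real bs ^ 3) powr (1/12) = 2 powr (1/12) * (real bs powr 3) powr (1/12)"
    by (simp add: powr_mult powr_numeral)
  also have "\<dots> = 2 powr (1/12) * real bs powr (1/4)" unfolding powr_powr by simp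
  \<comment> \<open>Rounding \<open>2 powr (1/12)\<close> up to 2 turns 1/200 into the constant
    1/400.\<close>
  also have "\<dots> \<le> 2 powr 1 * real bs powr (1/4)" by (intro mult_right_mono powr_mono) auto
  finally show "1 / 200 * real bs powr (1/4) \<ge> 1 / 400 * real D powr (1/12)" by simp
qed

theorem corollary1p2:
  "\<exists>c1 c2 :: real. c1 > 0 \<and> c2 > 0 \<and>
    (\<forall>(n :: nat) (f :: (nat \<Rightarrow> bool) \<Rightarrow> bool). n \<ge> 1 \<longrightarrow>
      (let X = cube n;
           F1 = (\<lambda>x y. f (bit_and n x y));
           F2 = (\<lambda>x y. f (bit_or n x y));
           bs = real (block_sensitivity n f);
           chain = (\<lambda>F.
          deterministic_cc X X F \<ge> randomized_cc (1/3) X X F \<and>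
          randomized_cc (1/3) X X F \<ge> quantum_cc (1/3) X X F \<and>
          real (quantum_cc (1/3) X X F) \<ge> c1 * bs powr (1/4) \<and>
          c1 * bs powr (1/4) \<ge> c2 * real (deterministic_cc X X F) powr (1/12))
       in chain F1 \<or> chain F2))"
proof -
  have main: "chain F1 \<or> chain F2"
    if defs: "F1 = (\<lambda>x y. f (bit_and n x y))" "F2 = (\<lambda>x y. f (bit_or n x y))"
      and chain: "chain = (\<lambda>F.
          deterministic_cc (cube n) (cube n) F \<ge> randomized_cc (1/3) (cube n) (cube n) F \<and>
          randomized_cc (1/3) (cube n) (cube n) F \<ge> quantum_cc (1/3) (cube n) (cube n) F \<and>
          real (quantum_cc (1/3) (cube n) (cube n) F) \<ge> 1 / 200 * real (block_sensitivity n f) powr (1/4) \<and>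
          1 / 200 * real (block_sensitivity n f) powr (1/4)
            \<ge> 1 / 400 * real (deterministic_cc (cube n) (cube n) F) powr (1/12))"
    for n :: nat and f :: "(nat \<Rightarrow> bool) \<Rightarrow> bool" and F1 F2 chain
  proof -
    let ?U = "{1..n}" and ?g = "\<lambda>A. f (char_vec n A)" and ?bs = "block_sensitivity n f"
    note C1 = cc_chain[where op = "bit_and n" and h = "(\<and>)" and f = f, OF bit_and_def, folded defs(1)]
    note C2 = cc_chain[where op = "bit_or n" and h = "(\<or>)" and f = f, OF bit_or_def, folded defs(2)]
    \<comment> \<open>Maximizing over families of both colours at once makes the two hypotheses of
      \<open>monochromatic_blocks_bound\<close> hold with the same bound; the colour of a family
      attaining the maximum then decides between AND and OR.\<close>
    define mono where "mono = (\<lambda>\<B>. \<exists>z. sensitive_blocks ?U ?g z \<B> \<and> ((\<forall>B\<in>\<B>. B \<inter> z = {}) \<or> (\<forall>B\<in>\<B>. B \<subseteq> z)))"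
    have "mono {}" unfolding mono_def sensitive_blocks_def by auto
    moreover have "\<forall>\<B>. mono \<B> \<longrightarrow> card \<B> < Suc ?bs"
      unfolding mono_def using block_sensitivity_sets(1) by (metis le_imp_less_Suc)
    ultimately obtain \<B> where B: "mono \<B>" "\<And>\<B>'. mono \<B>' \<Longrightarrow> card \<B>' \<le> card \<B>"
      using ex_has_greatest_nat[of mono "{}" card "Suc ?bs"] by blast
    obtain z0 S where S: "z0 \<subseteq> ?U" "disjoint_family_on S {1..?bs}" "\<forall>i\<in>{1..?bs}. S i \<subseteq> ?U \<and> ?g (sym_diff z0 (S i)) \<noteq> ?g z0"
      using block_sensitivity_sets(2)[of n f] by blast
    have "card {1..?bs} \<le> 4 * (card \<B>)\<^sup>2 + 3 * card \<B>"
    proof (rule monochromatic_blocks_bound[where U = ?U and g = ?g and z = z0 and S = S])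
      show "card \<B>' \<le> card \<B>" if "sensitive_blocks ?U ?g z \<B>'" "\<forall>B\<in>\<B>'. B \<inter> z = {}" for z \<B>'
        by (rule B(2)) (use that in \<open>auto simp: mono_def\<close>)
      show "card \<B>' \<le> card \<B>" if "sensitive_blocks ?U ?g z \<B>'" "\<forall>B\<in>\<B>'. B \<subseteq> z" for z \<B>'
        by (rule B(2)) (use that in \<open>auto simp: mono_def\<close>)
    qed (use S in auto)
    then have bound: "?bs \<le> 4 * (card \<B>)\<^sup>2 + 3 * card \<B>" by simp
    obtain z where z: "sensitive_blocks ?U ?g z \<B>" "(\<forall>B\<in>\<B>. B \<inter> z = {}) \<or> (\<forall>B\<in>\<B>. B \<subseteq> z)"
      using B(1) unfolding mono_def by blast
    have cost: "card \<B> \<le> 10000 * q\<^sup>2" if "card \<B> \<le> 10000 * q'\<^sup>2" "q' \<le> q" for q q' :: nat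
      using that(1) mult_le_mono2[OF power_mono[OF that(2) le0, of 2], of 10000] by (rule order_trans)
    from z(2) show ?thesis
    proof
      assume zero: "\<forall>B\<in>\<B>. B \<inter> z = {}"
      obtain P :: "(nat \<Rightarrow> bool, nat \<Rightarrow> bool) qprotocol" where P: "valid_qprotocol (cube n) (cube n) P"
        "qcost P \<le> quantum_cc (1/3) (cube n) (cube n) F1" "\<forall>x\<in>cube n. \<forall>y\<in>cube n. qoutput_prob P x y (f (bit_and n x y)) \<ge> 2 / 3"
        using C1(4) by blast
      have "card \<B> \<le> 10000 * (qcost P)\<^sup>2"
        by (cases "\<B> = {}") (simp, rule quantum_lower_bound_and[OF z(1) zero _ P(1)], use P(3) in auto)
      from power_estimates[OF bound cost[OF this P(2)] C1(3)] show ?thesis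
        using C1(1,2) unfolding chain by blast
    next
      assume one: "\<forall>B\<in>\<B>. B \<subseteq> z"
      obtain P :: "(nat \<Rightarrow> bool, nat \<Rightarrow> bool) qprotocol" where P: "valid_qprotocol (cube n) (cube n) P"
        "qcost P \<le> quantum_cc (1/3) (cube n) (cube n) F2" "\<forall>x\<in>cube n. \<forall>y\<in>cube n. qoutput_prob P x y (f (bit_or n x y)) \<ge> 2 / 3"
        using C2(4) by blast
      have "card \<B> \<le> 10000 * (qcost P)\<^sup>2"
        by (cases "\<B> = {}") (simp, rule quantum_lower_bound_or[OF z(1) one _ P(1)], use P(3) in auto)
      from power_estimates[OF bound cost[OF this P(2)] C2(3)] show ?thesis
        using C2(1,2) unfolding chain by blast
    qed
  qed
  show ?thesis
    by (rule exI[of _ "1 / 200"], rule exI[of _ "1 / 400"], unfold Let_def, intro conjI allI impI)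
      (simp, simp, rule main[OF refl refl refl])
qed

end
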